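(* Assume: (i) for every realisation $\xi$, $l(\cdot;\xi):\mathbb{R}^d\to\mathbb{R}$ is $G$-Lipschitz with respect to $\|\cdot\|_2$ and differentiable with $\|\nabla l(x;\xi)-\nabla l(y;\xi)\|_2\le L\|x-y\|_2$ for all $x,y\in\mathbb{R}^d$; (ii) $\mathbb{E}[\nabla l(x;\xi)]=\nabla l(x)$ for all $x\in\mathbb{R}^d$, and $\mathbb{E}[\|\nabla l(x)-\nabla l(x;\xi)\|_2^2]\le\sigma^2$ for all $x\in\mathcal{K}$; (iii) there is $D>0$ with $\|P(x,g,\eta)\|_1\le D$ for all $\eta>0$, $x\in\mathcal{K}$, $g\in\mathbb{R}^d$; (iv) there is $R>0$ with $f(x)\in[0,R]$ for all $x\in\mathcal{K}$. Let $T\ge1$ and run the algorithm ZO-AdaExpGrad$+$ (described in the context) for $T$ iterations with mini-batch size $m=2Te(2\ln d-1)$, smoothing parameter $\nu=\frac{1}{d\sqrt{T}}$ and $$\lambda_t=\frac{1}{\max\{\|x_t\|_1,\|v_t\|_1\}+1},\qquad \alpha_t=\sqrt{\max\Big\{\sum_{s=1}^{t-1}\lambda_s^2\alpha_s^2\|v_s-x_s\|_1^2,\ 1\Big\}}.$$ Then $$\mathbb{E}\big[\|\mathcal{G}_\tau\|_1^2\big]\le\sqrt{\frac{2e(2\ln d-1)}{mT}}\,(10V+C),$$ where $C=8R^2+8R+16L^2(D+1)^2$, $V=10G^2+8\sigma^2+2L^2$, $\mathcal{G}_t=\frac{\alpha_t}{D+1}\big(x_t-P(x_t,\nabla l(x_t),\alpha_t)\big)$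 is the generalised gradient at $x_t$, and $\tau$ is the random output index of the algorithm.
   Context: $\mathcal{K}\subseteq\mathbb{R}^d$ is closed and convex, $l(x)=\mathbb{E}_\xi[l(x;\xi)]$, $r$ is a convex function on $\mathbb{R}^d$, $f=l+r$. Define $$\phi(x)=\sum_{i=1}^d\Big(\big(|x_i|+\tfrac1d\big)\ln(d|x_i|+1)-|x_i|\Big),\qquad \mathcal{B}_\phi(x,y)=\phi(x)-\phi(y)-\langle\nabla\phi(y),x-y\rangle,$$ $$P(x,g,\eta)=\arg\min_{y\in\mathcal{K}}\langle g,y\rangle+r(y)+\eta\,\mathcal{B}_\phi(y,x).$$ The function $(D+1)\phi$ plays the role of the ($1$-strongly convex w.r.t. $\|\cdot\|_1$ on the $\ell_1$-ball of radius $D$) distance-generating function; the update with coefficient $\alpha_t$ and $\phi$ is the same as with $(D+1)\phi$ and step size $\alpha_t/(D+1)$, and $\mathcal{G}_t$ is the generalised gradient associated with the latter. Algorithm ZO-AdaExpGrad$+$: start from an arbitrary $x_1\in\mathcal{K}$. For $t=1,\dots,T$: draw independent random vectors $u_{t,j}\in\{-1,1\}^d$, $j=1,\dots,m$, with independent Rademacher coordinates, and independent copies $\xi_{t,j}$ of $\xi$ (all independent of each other and of the past); set $$d_t=\frac{1}{m\nu}\sum_{j=1}^m\big(l(x_t+\nu u_{t,j};\xi_{t,j})-l(x_t;\xi_{t,j})\big)u_{t,j},$$ $$v_t=\arg\min_{x\in\mathcal{K}}\langle d_t,x\rangle+r(x)+\alpha_t\mathcal{B}_\phi(x,x_t),\qquad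 x_{t+1}=\Big(1-\frac{\alpha_t}{\alpha_{t+1}}\Big)x_t+\frac{\alpha_t}{\alpha_{t+1}}v_t.$$ Finally draw $\tau$ uniformly from $\{1,\dots,T\}$, independently of everything else, and return $x_\tau$. The number $m=2Te(2\ln d-1)$ is treated as a positive integer, as in the paper. Expectation is over all randomness. *)

theory Defs
  imports "HOL-Probability.Probability"
begin

definition l1_norm :: "real ^ 'n \<Rightarrow> real" where
  "l1_norm x = (\<Sum>i\<in>UNIV. \<bar>x $ i\<bar>)"

definition grad :: "(real ^ 'n \<Rightarrow> real) \<Rightarrow> real ^ 'n \<Rightarrow> real ^ 'n" where
  "grad f x = (THE D. GDERIV f x :> D)"

definition phi :: "real ^ 'n \<Rightarrow> real" where
  "phi x = (\<Sum>i\<in>UNIV.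
     (\<bar>x $ i\<bar> + 1 / real CARD('n)) * ln (real CARD('n) * \<bar>x $ i\<bar> + 1) - \<bar>x $ i\<bar>)"

definition bregman :: "(real ^ 'n \<Rightarrow> real) \<Rightarrow> real ^ 'n \<Rightarrow> real ^ 'n \<Rightarrow> real" where
  "bregman \<psi> x y = \<psi> x - \<psi> y - grad \<psi> y \<bullet> (x - y)"

text \<open>The minimiser exists and is unique for closed convex nonempty \<open>K\<close>, convex \<open>r\<close> and
  \<open>\<eta> > 0\<close>, as \<open>phi\<close> is strictly convex and of superlinear growth; so nothing depends on
  the choice operator inside \<open>arg_min_on\<close>.\<close>

definition prox_map ::
  "(real ^ 'n) set \<Rightarrow> (real ^ 'n \<Rightarrow> real) \<Rightarrow> real ^ 'n \<Rightarrow> real ^ 'n \<Rightarrow> real \<Rightarrow> real ^ 'n" where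
  "prox_map K r x g \<eta> = arg_min_on (\<lambda>y. g \<bullet> y + r y + \<eta> * bregman phi y x) K"

text \<open>The update with coefficient \<open>\<alpha>\<close> and \<open>phi\<close> is the one with distance-generating
  function \<open>(D + 1) phi\<close> and coefficient \<open>\<alpha> / (D + 1)\<close>; the latter is the prefactor.\<close>

definition gen_grad ::
  "(real ^ 'n) set \<Rightarrow> (real ^ 'n \<Rightarrow> real) \<Rightarrow> real \<Rightarrow> real ^ 'n \<Rightarrow> real ^ 'n \<Rightarrow> real \<Rightarrow> real ^ 'n" where
  "gen_grad K r D x g \<alpha> = (\<alpha> / (D + 1)) *\<^sub>R (x - prox_map K r x g \<alpha>)"

definition mean_loss :: "'b measure \<Rightarrow> (real ^ 'n \<Rightarrow> 'b \<Rightarrow> real) \<Rightarrow> real ^ 'n \<Rightarrow> real" where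
  "mean_loss \<Xi> l x = (\<integral>z. l x z \<partial>\<Xi>)"

definition zo_grad_est ::
  "(real ^ 'n \<Rightarrow> 'b \<Rightarrow> real) \<Rightarrow> nat \<Rightarrow> real \<Rightarrow> (nat \<Rightarrow> 'b) \<Rightarrow> (nat \<Rightarrow> real ^ 'n)
     \<Rightarrow> real ^ 'n \<Rightarrow> real ^ 'n" where
  "zo_grad_est l m \<nu> \<xi> u x =
     (1 / (real m * \<nu>)) *\<^sub>R (\<Sum>j=1..m. (l (x + \<nu> *\<^sub>R u j) (\<xi> j) - l x (\<xi> j)) *\<^sub>R u j)"

definition step_lambda :: "real ^ 'n \<Rightarrow> real ^ 'n \<Rightarrow> real" where
  "step_lambda x v = 1 / (max (l1_norm x) (l1_norm v) + 1)"

text \<open>A trajectory of ZO-AdaExpGrad+ for one fixed realisation of the samples \<open>\<xi> t j\<close> and of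
  the directions \<open>u t j\<close>. The equations determine \<open>x\<close> and \<open>\<alpha>\<close> on \<open>{1..T+1}\<close> and \<open>v\<close> on
  \<open>{1..T}\<close>.\<close>

definition zo_adaexpgrad_plus ::
  "(real ^ 'n) set \<Rightarrow> (real ^ 'n \<Rightarrow> real) \<Rightarrow> (real ^ 'n \<Rightarrow> 'b \<Rightarrow> real) \<Rightarrow>
   nat \<Rightarrow> nat \<Rightarrow> real \<Rightarrow> real ^ 'n \<Rightarrow>
   (nat \<Rightarrow> nat \<Rightarrow> 'b) \<Rightarrow> (nat \<Rightarrow> nat \<Rightarrow> real ^ 'n) \<Rightarrow>
   (nat \<Rightarrow> real ^ 'n) \<Rightarrow> (nat \<Rightarrow> real ^ 'n) \<Rightarrow> (nat \<Rightarrow> real) \<Rightarrow> bool" where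
  "zo_adaexpgrad_plus K r l T m \<nu> x1 \<xi> u x v \<alpha> \<longleftrightarrow>
     x 1 = x1 \<and>
     (\<forall>t\<in>{1..T+1}. \<alpha> t =
        sqrt (max (\<Sum>s=1..<t. (step_lambda (x s) (v s))\<^sup>2 * (\<alpha> s)\<^sup>2 * (l1_norm (v s - x s))\<^sup>2) 1)) \<and>
     (\<forall>t\<in>{1..T}.
        v t = prox_map K r (x t) (zo_grad_est l m \<nu> (\<xi> t) (u t) (x t)) (\<alpha> t) \<and>
        x (t + 1) = (1 - \<alpha> t / \<alpha> (t + 1)) *\<^sub>R x t + (\<alpha> t / \<alpha> (t + 1)) *\<^sub>R v t)"

text \<open>The basic random variables have different types, so their joint independence is expressed
  by the independence of the sigma-algebras they generate, over a common index type.\<close>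

datatype 'n source = Data nat nat | Coord nat nat 'n | Output

definition sampling_scheme ::
  "'a measure \<Rightarrow> 'b measure \<Rightarrow> nat \<Rightarrow> nat \<Rightarrow> (nat \<Rightarrow> nat \<Rightarrow> 'a \<Rightarrow> 'b) \<Rightarrow>
   (nat \<Rightarrow> nat \<Rightarrow> 'a \<Rightarrow> real ^ 'n) \<Rightarrow> ('a \<Rightarrow> nat) \<Rightarrow> bool" where
  "sampling_scheme M \<Xi> T m \<xi> u \<tau> \<longleftrightarrow>
     (\<forall>t\<in>{1..T}. \<forall>j\<in>{1..m}. \<xi> t j \<in> measurable M \<Xi> \<and> distr M \<Xi> (\<xi> t j) = \<Xi>) \<and>
     (\<forall>t\<in>{1..T}. \<forall>j\<in>{1..m}. \<forall>i.
        (\<lambda>\<omega>. u t j \<omega> $ i) \<in> measurable M (count_space {-1, 1}) \<and>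
        distr M (count_space {-1, 1}) (\<lambda>\<omega>. u t j \<omega> $ i) = uniform_count_measure {-1, 1}) \<and>
     \<tau> \<in> measurable M (count_space {1..T}) \<and>
     distr M (count_space {1..T}) \<tau> = uniform_count_measure {1..T} \<and>
     prob_space.indep_sets M
       (\<lambda>k. case k of
          Data t j \<Rightarrow> sets (vimage_algebra (space M) (\<xi> t j) \<Xi>)
        | Coord t j i \<Rightarrow>
            sets (vimage_algebra (space M) (\<lambda>\<omega>. u t j \<omega> $ i) (count_space {-1, 1}))
        | Output \<Rightarrow> sets (vimage_algebra (space M) \<tau> (count_space {1..T})))
       ({Data t j | t j. t \<in> {1..T} \<and> j \<in> {1..m}} \<union>
        {Coord t j i | t j i. t \<in> {1..T} \<and> j \<in> {1..m}} \<union> {Output})"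

end

theory Submission
  imports Defs "HOL-Real_Asymp.Real_Asymp"
begin

text \<open>Write \<open>\<mu> = 1 / (D + 1)\<close>, let \<open>e t\<close> be the sup norm of the error of the gradient estimate at
\<open>x t\<close>, and let \<open>q t = \<mu> * \<alpha> t * \<parallel>v t - x t\<parallel>\<^sub>1\<close>. Two prox steps from the same point with the same
coefficient \<open>\<alpha>\<close> differ by at most \<open>(D + 1) / \<alpha>\<close> times the sup-norm distance of their linear terms
(\<open>prox_map_lipschitz_gradient\<close>), so the generalised gradient has \<open>\<parallel>\<cdot>\<parallel>\<^sub>1\<close>-norm at most \<open>q t + e t\<close>,
and it is enough to bound \<open>Z = (\<Sum>t. (q t)\<^sup>2)\<close> and \<open>E = (\<Sum>t. (e t)\<^sup>2)\<close>.

For \<open>Z\<close> the argument is pathwise. The prox objective grows quadratically around its minimiser, with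
modulus \<open>\<alpha> * step_lambda\<close> (\<open>prox_map_growth\<close>), and this gives a descent inequality for each step. It is
multiplied by the constant \<open>\<mu>\<close> and not by the varying factor \<open>step_lambda\<close>: then the decreases of
the objective, weighted by the increasing \<open>\<alpha> (t + 1)\<close>, can be summed by parts against
\<open>0 \<le> f \<le> R\<close>. As \<open>\<mu> \<le> step_lambda \<le> 1\<close>, the step sizes are comparable with the partial sums of
\<open>(q t)\<^sup>2\<close> from both sides: \<open>\<mu> * \<alpha> (T + 1) \<le> 1 + sqrt Z\<close>, and the curvature terms add up to at most
\<open>L * (D + 1) * sqrt Z\<close>. So \<open>Z \<le> R + (R + sqrt E + L * (D + 1)) * sqrt Z\<close>, a quadratic inequality
that bounds \<open>Z\<close> by \<open>R\<close>, \<open>R\<^sup>2\<close>, \<open>E\<close> and \<open>L\<^sup>2 * (D + 1)\<^sup>2\<close> (\<open>sum_gen_grad_square_bound\<close>).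

For the expectation of \<open>E\<close>, the difference quotient along a sign vector \<open>u\<close> is \<open>\<nabla>l \<bullet> u\<close> up to
\<open>L * \<nu> * d / 2\<close>, and \<open>(\<nabla>l \<bullet> u) u\<close> has mean \<open>\<nabla>l\<close>. What remains is the average of \<open>m\<close> independent
centred vectors, measured in the sup norm. The potential \<open>(\<Sum>i. (x\<^sub>i\<^sup>2 + \<epsilon>)\<^sup>k)\<^sup>1\<^sup>/\<^sup>k\<close> dominates the
squared sup norm, and its second derivative along \<open>h\<close> is at most
\<open>2 (2 k - 1) d\<^sup>1\<^sup>/\<^sup>k \<parallel>h\<parallel>\<^sub>\<infinity>\<^sup>2\<close> (\<open>soft_sup_square_smooth\<close>). Each further sample therefore raises its mean
by a fixed amount, and \<open>k = max 1 (ln d)\<close> makes the constant \<open>(2 k - 1) d\<^sup>1\<^sup>/\<^sup>k\<close> at most \<open>20 / 9\<close>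
times \<open>e (2 ln d - 1)\<close> (\<open>potential_constant_le\<close>), which the choice of the batch size cancels: the mean of \<open>(e t)\<^sup>2\<close> is of order \<open>1 / T\<close> (\<open>zo_error_second_moment\<close>). Past and
fresh samples are separated by Fubini's theorem (\<open>nn_integral_indep_pair\<close>), because the iterate
\<open>x t\<close> is a measurable function of the samples of the earlier rounds (\<open>adapted\<close>). The output index
is independent of the run, so it turns the sum over \<open>t\<close> into an average
(\<open>expectation_at_output\<close>). Rounding the batch size up to an integer costs at most a factor
\<open>2 / 3\<close> on the right-hand side, and the constants leave room for it.\<close>

section \<open>Quadratic bounds, norms and gradients\<close>

lemma taylor_upper_of_deriv_bound:
  fixes f f' :: "real \<Rightarrow> real"
  assumes f: "\<And>s. (f has_real_derivative f' s) (at s)"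
    and bound: "\<And>s. 0 \<le> s \<Longrightarrow> s \<le> 1 \<Longrightarrow> f' s \<le> f' 0 + 2 * c * s"
  shows "f 1 \<le> f 0 + f' 0 + c"
proof -
  have "(\<lambda>s. f s - f' 0 * s - c * s\<^sup>2) 1 \<le> (\<lambda>s. f s - f' 0 * s - c * s\<^sup>2) 0"
  proof (rule DERIV_nonpos_imp_nonincreasing[where f = "\<lambda>s. f s - f' 0 * s - c * s\<^sup>2"])
    fix s :: real assume s: "0 \<le> s" "s \<le> 1"
    have "((\<lambda>s. f s - f' 0 * s - c * s\<^sup>2) has_real_derivative (f' s - f' 0 - 2 * c * s)) (at s)"
      by (auto intro!: derivative_eq_intros f)
    with bound[OF s] show "\<exists>y. ((\<lambda>s. f s - f' 0 * s - c * s\<^sup>2) has_real_derivative y) (at s) \<and> y \<le> 0"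
      by force
  qed simp
  then show ?thesis by simp
qed

lemma taylor_upper_of_second_deriv_bound:
  fixes f f' f'' :: "real \<Rightarrow> real"
  assumes f: "\<And>s. (f has_real_derivative f' s) (at s)"
    and f': "\<And>s. (f' has_real_derivative f'' s) (at s)"
    and bound: "\<And>s. 0 \<le> s \<Longrightarrow> s \<le> 1 \<Longrightarrow> f'' s \<le> 2 * c"
  shows "f 1 \<le> f 0 + f' 0 + c"
proof (rule taylor_upper_of_deriv_bound[OF f])
  fix s :: real assume s: "0 \<le> s" "s \<le> 1"
  have "(\<lambda>s. f' s - 2 * c * s) s \<le> (\<lambda>s. f' s - 2 * c * s) 0"
  proof (rule DERIV_nonpos_imp_nonincreasing[where f = "\<lambda>s. f' s - 2 * c * s"])
    fix y assume y: "0 \<le> y" "y \<le> s"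
    have "((\<lambda>s. f' s - 2 * c * s) has_real_derivative (f'' y - 2 * c)) (at y)"
      by (auto intro!: derivative_eq_intros f')
    with bound[of y] y s
    show "\<exists>z. ((\<lambda>s. f' s - 2 * c * s) has_real_derivative z) (at y) \<and> z \<le> 0"
      by force
  qed (use s in simp)
  then show "f' s \<le> f' 0 + 2 * c * s" by simp
qed

lemma l1_norm_nonneg [simp]: "0 \<le> l1_norm x"
  by (simp add: l1_norm_def sum_nonneg)

lemma l1_norm_minus_commute: "l1_norm (x - y) = l1_norm (y - x)"
  by (simp add: l1_norm_def abs_minus_commute)

lemma l1_norm_scaleR: "l1_norm (a *\<^sub>R x) = \<bar>a\<bar> * l1_norm x"
  by (simp add: l1_norm_def abs_mult sum_distrib_left)

lemma l1_norm_triangle: "l1_norm (x + y) \<le> l1_norm x + l1_norm y"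
  unfolding l1_norm_def sum.distrib[symmetric] by (intro sum_mono) (simp add: abs_triangle_ineq)

lemma norm_le_l1_norm: "norm x \<le> l1_norm x"
  using norm_le_l1_cart by (simp add: l1_norm_def)

lemma convex_comb_l1_norm_le:
  assumes "0 \<le> s" "s \<le> 1"
  shows "l1_norm (x + s *\<^sub>R (y - x)) \<le> max (l1_norm x) (l1_norm y)"
proof -
  have "x + s *\<^sub>R (y - x) = (1 - s) *\<^sub>R x + s *\<^sub>R y" by (simp add: algebra_simps)
  then have "l1_norm (x + s *\<^sub>R (y - x)) \<le> (1 - s) * l1_norm x + s * l1_norm y"
    using l1_norm_triangle[of "(1 - s) *\<^sub>R x" "s *\<^sub>R y"] assms by (simp add: l1_norm_scaleR)
  also have "\<dots> \<le> (1 - s) * max (l1_norm x) (l1_norm y) + s * max (l1_norm x) (l1_norm y)"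
    using assms by (intro add_mono mult_left_mono) auto
  also have "\<dots> = max (l1_norm x) (l1_norm y)" by (simp add: algebra_simps)
  finally show ?thesis .
qed

lemma infnorm_nonneg [simp]: "0 \<le> infnorm x"
  by (rule infnorm_pos_le)

lemma infnorm_leI:
  fixes x :: "real ^ 'n"
  shows "(\<And>i. \<bar>x $ i\<bar> \<le> b) \<Longrightarrow> infnorm x \<le> b"
  unfolding infnorm_cart by (rule cSup_least) auto

text \<open>The sup norm is dual to \<open>\<parallel>\<cdot>\<parallel>\<^sub>1\<close>, hence the errors of gradients are measured in it.\<close>

lemma inner_le_infnorm_l1_norm:
  fixes g x :: "real ^ 'n"
  shows "\<bar>g \<bullet> x\<bar> \<le> infnorm g * l1_norm x"
proof -
  have "\<bar>g \<bullet> x\<bar> \<le> (\<Sum>i\<in>UNIV. \<bar>g $ i\<bar> * \<bar>x $ i\<bar>)"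
    unfolding inner_vec_def by (rule order_trans[OF sum_abs]) (simp add: abs_mult)
  also have "\<dots> \<le> (\<Sum>i\<in>UNIV. infnorm g * \<bar>x $ i\<bar>)"
    by (intro sum_mono mult_right_mono component_le_infnorm_cart) auto
  finally show ?thesis by (simp add: l1_norm_def sum_distrib_left)
qed

lemma gradI:
  assumes "GDERIV f x :> D"
  shows "grad f x = D"
  unfolding grad_def
proof (rule the_equality)
  fix E assume "GDERIV f x :> E"
  then have "(\<lambda>h. h \<bullet> E) = (\<lambda>h. h \<bullet> D)"
    using assms unfolding gderiv_def by (rule has_derivative_unique)
  then have "h \<bullet> E = h \<bullet> D" for h by meson
  then show "E = D" by (rule vector_eq_ldot[THEN iffD1, OF allI])
qed (fact assms)

text \<open>Riesz representation of the derivative, with the vector built from the images of the coordinate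
axes; it identifies the description operator in \<open>grad\<close> for every differentiable function.\<close>

lemma differentiable_imp_GDERIV_grad:
  fixes f :: "real ^ 'n \<Rightarrow> real"
  assumes "f differentiable (at x)"
  shows "GDERIV f x :> grad f x"
proof -
  obtain f' where f': "(f has_derivative f') (at x)" using assms by (auto simp: differentiable_def)
  then have lin: "linear f'" by (rule has_derivative_linear)
  have "f' h = h \<bullet> (\<chi> i. f' (axis i 1))" for h
  proof -
    have "f' h = f' (\<Sum>i\<in>UNIV. (h $ i) *\<^sub>R axis i 1)"
      using basis_expansion[of h] by (simp add: scalar_mult_eq_scaleR)
    also have "\<dots> = h \<bullet> (\<chi> i. f' (axis i 1))"
      using lin by (simp add: linear_sum linear_cmul inner_vec_def)
    finally show ?thesis .
  qed
  then have "f' = (\<lambda>h. h \<bullet> (\<chi> i. f' (axis i 1)))" by (rule ext)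
  with f' have "GDERIV f x :> (\<chi> i. f' (axis i 1))" by (simp only: gderiv_def)
  then show ?thesis using gradI[OF \<open>GDERIV f x :> _\<close>] by (simp only:)
qed

lemma GDERIV_line:
  assumes "GDERIV f (x + s *\<^sub>R h) :> D"
  shows "((\<lambda>s. f (x + s *\<^sub>R h)) has_real_derivative (D \<bullet> h)) (at s)"
proof -
  have "((\<lambda>s. x + s *\<^sub>R h) has_derivative (\<lambda>t. t *\<^sub>R h)) (at s)"
    by (auto intro!: derivative_eq_intros)
  from diff_chain_at[OF this assms[unfolded gderiv_def]] show ?thesis
    by (simp add: o_def has_field_derivative_def inner_commute mult_commute_abs)
qed

text \<open>Used for the mean loss, where it yields descent, and for a single sample, where it bounds the bias
of the difference quotient.\<close>

lemma l_smooth_quadratic_bound: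
  fixes f :: "real ^ 'n \<Rightarrow> real"
  assumes diff: "\<And>y. f differentiable (at y)"
    and smooth: "\<And>y y'. norm (grad f y - grad f y') \<le> L * norm (y - y')"
  shows "\<bar>f (x + h) - f x - grad f x \<bullet> h\<bar> \<le> L / 2 * (norm h)\<^sup>2"
proof -
  have der: "((\<lambda>s. f (x + s *\<^sub>R h)) has_real_derivative (grad f (x + s *\<^sub>R h) \<bullet> h)) (at s)" for s
    by (rule GDERIV_line[OF differentiable_imp_GDERIV_grad[OF diff]])
  have *: "\<bar>grad f (x + s *\<^sub>R h) \<bullet> h - grad f x \<bullet> h\<bar> \<le> L * (norm h)\<^sup>2 * s" if "0 \<le> s" for s
  proof -
    have "\<bar>grad f (x + s *\<^sub>R h) \<bullet> h - grad f x \<bullet> h\<bar> \<le> norm (grad f (x + s *\<^sub>R h) - grad f x) * norm h"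
      by (metis Cauchy_Schwarz_ineq2 inner_diff_left)
    also have "\<dots> \<le> (L * norm (s *\<^sub>R h)) * norm h"
      using smooth[of "x + s *\<^sub>R h" x] by (intro mult_right_mono) auto
    finally show ?thesis using that by (simp add: power2_eq_square mult_ac)
  qed
  have "f (x + 1 *\<^sub>R h) \<le> f (x + 0 *\<^sub>R h) + grad f (x + 0 *\<^sub>R h) \<bullet> h + L / 2 * (norm h)\<^sup>2"
    by (rule taylor_upper_of_deriv_bound[OF der]) (use * in \<open>fastforce simp: abs_le_iff\<close>)
  moreover have "- f (x + 1 *\<^sub>R h) \<le> - f (x + 0 *\<^sub>R h) + - (grad f (x + 0 *\<^sub>R h) \<bullet> h) + L / 2 * (norm h)\<^sup>2"
    by (rule taylor_upper_of_deriv_bound[OF DERIV_minus[OF der]])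
       (use * in \<open>fastforce simp: abs_le_iff\<close>)
  ultimately have "f (x + h) \<le> f x + grad f x \<bullet> h + L / 2 * (norm h)\<^sup>2"
    and "- f (x + h) \<le> - f x + - (grad f x \<bullet> h) + L / 2 * (norm h)\<^sup>2" by simp_all
  then show ?thesis by linarith
qed

section \<open>The entropy-like distance-generating function\<close>

definition phi1 :: "real \<Rightarrow> real \<Rightarrow> real" where
  "phi1 c a = (\<bar>a\<bar> + 1 / c) * ln (c * \<bar>a\<bar> + 1) - \<bar>a\<bar>"

definition phi1' :: "real \<Rightarrow> real \<Rightarrow> real" where
  "phi1' c a = sgn a * ln (c * \<bar>a\<bar> + 1)"

text \<open>The absolute values do no harm at \<open>0\<close>: the one-sided derivatives there agree for \<open>phi1\<close> and again
for \<open>phi1'\<close>, so that \<open>phi1\<close> is twice differentiable everywhere.\<close>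

lemma DERIV_phi1:
  assumes c: "c > 0"
  shows "(phi1 c has_real_derivative phi1' c a) (at a)"
proof -
  have p: "((\<lambda>a. (a + 1 / c) * ln (c * a + 1) - a) has_real_derivative ln (c * a + 1)) (at a)"
    if "a \<ge> 0" for a
  proof -
    have 1: "c * a + 1 > 0" using that c by (simp add: add_nonneg_pos)
    then have 2: "a * c + 1 \<noteq> 0" by (simp add: mult.commute)
    show ?thesis using 1 2 c by (auto intro!: derivative_eq_intros simp: divide_simps)
  qed
  consider "a > 0" | "a < 0" | "a = 0" by linarith
  then show ?thesis
  proof cases
    case 1
    have "(phi1 c has_real_derivative ln (c * a + 1)) (at a)"
      by (rule has_field_derivative_transform_within_open[OF p, of _ "{0<..}"])
         (use 1 in \<open>auto simp: phi1_def\<close>)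
    with 1 show ?thesis by (simp add: phi1'_def)
  next
    case 2
    have "((\<lambda>a. ((-a) + 1 / c) * ln (c * (-a) + 1) - (-a)) has_real_derivative ln (c * (-a) + 1) * (-1)) (at a)"
      by (rule DERIV_chain2[OF p]) (use 2 in \<open>auto intro!: derivative_eq_intros\<close>)
    then have "(phi1 c has_real_derivative ln (c * (-a) + 1) * (-1)) (at a)"
      by (rule has_field_derivative_transform_within_open[of _ _ _ "{..<0}"])
         (use 2 in \<open>auto simp: phi1_def\<close>)
    with 2 show ?thesis by (simp add: phi1'_def)
  next
    case 3
    have "((\<lambda>h. ((\<bar>h\<bar> + 1 / c) * ln (c * \<bar>h\<bar> + 1) - \<bar>h\<bar>) / h) \<longlongrightarrow> 0) (at_left 0)"
      using c by real_asymp
    moreover have "((\<lambda>h. ((\<bar>h\<bar> + 1 / c) * ln (c * \<bar>h\<bar> + 1) - \<bar>h\<bar>) / h) \<longlongrightarrow> 0) (at_right 0)"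
      using c by real_asymp
    ultimately have "((\<lambda>h. ((\<bar>h\<bar> + 1 / c) * ln (c * \<bar>h\<bar> + 1) - \<bar>h\<bar>) / h) \<longlongrightarrow> 0) (at 0)"
      by (rule filterlim_split_at)
    with 3 show ?thesis by (simp add: has_field_derivative_iff phi1_def phi1'_def)
  qed
qed

lemma DERIV_phi1':
  assumes c: "c > 0"
  shows "(phi1' c has_real_derivative 1 / (\<bar>a\<bar> + 1 / c)) (at a)"
proof -
  have p: "((\<lambda>a. ln (c * a + 1)) has_real_derivative 1 / (a + 1 / c)) (at a)"
    if "a \<ge> 0" for a
  proof -
    have 1: "c * a + 1 > 0" using that c by (simp add: add_nonneg_pos)
    then have 2: "a * c + 1 \<noteq> 0" by (simp add: mult.commute)
    show ?thesis using 1 2 c by (auto intro!: derivative_eq_intros simp: divide_simps)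
  qed
  consider "a > 0" | "a < 0" | "a = 0" by linarith
  then show ?thesis
  proof cases
    case 1
    have "(phi1' c has_real_derivative 1 / (a + 1 / c)) (at a)"
      by (rule has_field_derivative_transform_within_open[OF p, of _ "{0<..}"])
         (use 1 in \<open>auto simp: phi1'_def\<close>)
    with 1 show ?thesis by simp
  next
    case 2
    have "((\<lambda>a. - ln (c * (-a) + 1)) has_real_derivative - (1 / (-a + 1 / c) * (-1))) (at a)"
      by (intro DERIV_minus DERIV_chain2[OF p]) (use 2 in \<open>auto intro!: derivative_eq_intros\<close>)
    then have "(phi1' c has_real_derivative - (1 / (-a + 1 / c) * (-1))) (at a)"
      by (rule has_field_derivative_transform_within_open[of _ _ _ "{..<0}"])
         (use 2 in \<open>auto simp: phi1'_def\<close>)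
    with 2 show ?thesis by simp
  next
    case 3
    have "((\<lambda>h. sgn h * ln (c * \<bar>h\<bar> + 1) / h) \<longlongrightarrow> c) (at_left 0)"
      using c by real_asymp
    moreover have "((\<lambda>h. sgn h * ln (c * \<bar>h\<bar> + 1) / h) \<longlongrightarrow> c) (at_right 0)"
      using c by real_asymp
    ultimately have "((\<lambda>h. sgn h * ln (c * \<bar>h\<bar> + 1) / h) \<longlongrightarrow> c) (at 0)"
      by (rule filterlim_split_at)
    with 3 show ?thesis by (simp add: has_field_derivative_iff phi1'_def)
  qed
qed

text \<open>Superlinear growth: from \<open>ln (c * \<bar>a\<bar> + 1) \<ge> B + 1\<close> on, the function lies above \<open>B * \<bar>a\<bar>\<close>; before
that point, the right-hand side is at most \<open>0\<close>, and \<open>phi1\<close> is nonnegative.\<close>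

lemma phi1_lower:
  assumes c: "c > 0" and B: "B \<ge> 0"
  shows "phi1 c a \<ge> B * \<bar>a\<bar> - B * exp (B + 1) / c"
proof -
  define y where "y = ln (c * \<bar>a\<bar> + 1)"
  have pos: "c * \<bar>a\<bar> + 1 > 0" using c by (simp add: add_nonneg_pos)
  have "1 / (c * \<bar>a\<bar> + 1) - 1 \<ge> - y"
    using ln_le_minus_one[of "1 / (c * \<bar>a\<bar> + 1)"] pos by (simp add: y_def ln_div)
  then have "(\<bar>a\<bar> + 1 / c) * y \<ge> (\<bar>a\<bar> + 1 / c) * (1 - 1 / (c * \<bar>a\<bar> + 1))"
    using c by (intro mult_left_mono) auto
  also have "(\<bar>a\<bar> + 1 / c) * (1 - 1 / (c * \<bar>a\<bar> + 1)) = \<bar>a\<bar>"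
  proof -
    have "\<bar>a\<bar> + 1 / c = (c * \<bar>a\<bar> + 1) / c" using c by (simp add: field_simps)
    moreover have "1 - 1 / (c * \<bar>a\<bar> + 1) = c * \<bar>a\<bar> / (c * \<bar>a\<bar> + 1)" using pos by (simp add: field_simps)
    ultimately show ?thesis using pos c by simp
  qed
  finally have nn: "phi1 c a \<ge> 0" by (simp add: phi1_def y_def)
  show ?thesis
  proof (cases "y \<ge> B + 1")
    case True
    then have "\<bar>a\<bar> * (B + 1) \<le> \<bar>a\<bar> * y" by (intro mult_left_mono) auto
    moreover have "1 / c * y \<ge> 0" using True B c by simp
    moreover have "phi1 c a = \<bar>a\<bar> * y + 1 / c * y - \<bar>a\<bar>"
      by (simp only: phi1_def y_def[symmetric] distrib_right)
    ultimately have "phi1 c a \<ge> B * \<bar>a\<bar>" by (simp add: algebra_simps)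
    moreover have "B * exp (B + 1) / c \<ge> 0" using B c by simp
    ultimately show ?thesis by linarith
  next
    case False
    then have "exp y \<le> exp (B + 1)" by simp
    then have "c * \<bar>a\<bar> \<le> exp (B + 1)" using pos by (simp add: y_def)
    then have "\<bar>a\<bar> \<le> exp (B + 1) / c" using c by (simp add: field_simps)
    then have "B * \<bar>a\<bar> \<le> B * exp (B + 1) / c" using B mult_left_mono by fastforce
    with nn show ?thesis by linarith
  qed
qed

lemma phi_eq_sum_phi1: "phi (x :: real ^ 'n) = (\<Sum>i\<in>UNIV. phi1 (real CARD('n)) (x $ i))"
  by (simp add: phi_def phi1_def)

lemma
  fixes x :: "real ^ 'n"
  shows GDERIV_phi: "GDERIV phi x :> (\<chi> i. phi1' (real CARD('n)) (x $ i))"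
    and grad_phi: "grad phi x = (\<chi> i. phi1' (real CARD('n)) (x $ i))"
proof -
  have "((\<lambda>x. phi1 (real CARD('n)) (x $ i)) has_derivative (\<lambda>h. phi1' (real CARD('n)) (x $ i) * (h $ i))) (at x)" for i
  proof -
    have nth: "((\<lambda>x. x $ i) has_derivative (\<lambda>h. h $ i)) (at x)"
      by (rule bounded_linear_imp_has_derivative[OF bounded_linear_vec_nth])
    show ?thesis
      by (rule has_derivative_compose[OF nth DERIV_phi1[unfolded has_field_derivative_def]]) simp
  qed
  then have "((\<lambda>x. \<Sum>i\<in>UNIV. phi1 (real CARD('n)) (x $ i)) has_derivative
      (\<lambda>h. \<Sum>i\<in>UNIV. phi1' (real CARD('n)) (x $ i) * (h $ i))) (at x)"
    by (rule has_derivative_sum)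
  then show *: "GDERIV phi x :> (\<chi> i. phi1' (real CARD('n)) (x $ i))"
    by (simp add: gderiv_def phi_eq_sum_phi1[abs_def] inner_vec_def mult.commute)
  show "grad phi x = (\<chi> i. phi1' (real CARD('n)) (x $ i))" by (rule gradI[OF *])
qed

lemma continuous_phi: "continuous_on S (phi :: real ^ 'n \<Rightarrow> real)"
proof -
  have "continuous_on UNIV (phi1 (real CARD('n)))"
    by (rule DERIV_continuous_on) (rule has_field_derivative_at_within[OF DERIV_phi1], simp)
  then have "continuous_on S (\<lambda>x :: real ^ 'n. phi1 (real CARD('n)) (x $ i))" for i
    by (rule continuous_on_compose2) (auto intro: continuous_on_component continuous_on_id)
  then show ?thesis unfolding phi_eq_sum_phi1[abs_def] by (intro continuous_on_sum)
qed

lemma continuous_grad_phi: "continuous_on S (grad (phi :: real ^ 'n \<Rightarrow> real))"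
proof -
  have "continuous_on UNIV (phi1' (real CARD('n)))"
    by (rule DERIV_continuous_on) (rule has_field_derivative_at_within[OF DERIV_phi1'], simp)
  then have "continuous_on S (\<lambda>x :: real ^ 'n. phi1' (real CARD('n)) (x $ i))" for i
    by (rule continuous_on_compose2) (auto intro: continuous_on_component continuous_on_id)
  then show ?thesis unfolding grad_phi[abs_def] by (intro continuous_on_vec_lambda)
qed

text \<open>The Hessian of \<open>phi\<close> at \<open>z\<close> is diagonal with entries \<open>1 / (\<bar>z\<^sub>i\<bar> + 1 / d)\<close>. By Cauchy-Schwarz it is
bounded below by \<open>\<parallel>h\<parallel>\<^sub>1\<^sup>2\<close> divided by the sum of the inverse entries, which is \<open>\<parallel>z\<parallel>\<^sub>1 + 1\<close>.\<close>

lemma phi_hessian_lower: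
  fixes z h :: "real ^ 'n"
  shows "(l1_norm h)\<^sup>2 \<le> (\<Sum>i\<in>UNIV. (h $ i)\<^sup>2 / (\<bar>z $ i\<bar> + 1 / real CARD('n))) * (l1_norm z + 1)"
proof -
  define b where "b = (\<lambda>i. \<bar>z $ i\<bar> + 1 / real CARD('n))"
  have b: "b i > 0" for i unfolding b_def by (intro add_nonneg_pos) auto
  have sb: "(\<Sum>i\<in>UNIV. b i) = l1_norm z + 1"
    by (simp add: b_def sum.distrib l1_norm_def)
  have "(\<Sum>i\<in>UNIV. (\<bar>h $ i\<bar> / sqrt (b i)) * sqrt (b i))\<^sup>2
      \<le> (\<Sum>i\<in>UNIV. (\<bar>h $ i\<bar> / sqrt (b i))\<^sup>2) * (\<Sum>i\<in>UNIV. (sqrt (b i))\<^sup>2)"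
    by (rule Cauchy_Schwarz_ineq_sum)
  moreover have "(\<bar>h $ i\<bar> / sqrt (b i)) * sqrt (b i) = \<bar>h $ i\<bar>" for i using b[of i] by simp
  moreover have "(\<bar>h $ i\<bar> / sqrt (b i))\<^sup>2 = (h $ i)\<^sup>2 / b i" for i
    using b[of i] by (simp add: power_divide)
  moreover have "(sqrt (b i))\<^sup>2 = b i" for i using b[of i] by simp
  ultimately have "(\<Sum>i\<in>UNIV. \<bar>h $ i\<bar>)\<^sup>2 \<le> (\<Sum>i\<in>UNIV. (h $ i)\<^sup>2 / b i) * (\<Sum>i\<in>UNIV. b i)"
    by (simp only:)
  then show ?thesis unfolding sb by (simp add: b_def l1_norm_def)
qed

lemma max_l1_norm_nonneg: "0 \<le> max (l1_norm x) (l1_norm y)"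
  using l1_norm_nonneg[of x] by linarith

lemma step_lambda_pos: "step_lambda x y > 0"
  unfolding step_lambda_def using max_l1_norm_nonneg[of x y] by simp

lemma step_lambda_le_one: "step_lambda x y \<le> 1"
  unfolding step_lambda_def using max_l1_norm_nonneg[of x y] by simp

lemma step_lambda_antimono:
  assumes "max (l1_norm x) (l1_norm y) \<le> max (l1_norm x') (l1_norm y')"
  shows "step_lambda x' y' \<le> step_lambda x y"
  unfolding step_lambda_def using assms max_l1_norm_nonneg[of x y] by (intro frac_le) linarith+

text \<open>On the segment from \<open>x\<close> to \<open>y\<close> the \<open>\<parallel>\<cdot>\<parallel>\<^sub>1\<close>-norm is at most the larger one of the two endpoints, so
\<open>step_lambda x y\<close> bounds the Hessian from below all along it.\<close>

lemma bregman_phi_lower: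
  fixes x y :: "real ^ 'n"
  shows "bregman phi y x \<ge> step_lambda x y / 2 * (l1_norm (y - x))\<^sup>2"
proof -
  let ?c = "real CARD('n)"
  define h where "h = y - x"
  define f' where "f' = (\<lambda>s. \<Sum>i\<in>UNIV. phi1' ?c (x $ i + s * h $ i) * h $ i)"
  define f'' where "f'' = (\<lambda>s. \<Sum>i\<in>UNIV. 1 / (\<bar>x $ i + s * h $ i\<bar> + 1 / ?c) * (h $ i) * h $ i)"
  have "- phi (x + 1 *\<^sub>R h) \<le> - phi (x + 0 *\<^sub>R h) + - f' 0 + - (step_lambda x y / 2 * (l1_norm h)\<^sup>2)"
  proof (rule taylor_upper_of_second_deriv_bound)
    fix s
    show "((\<lambda>s. - phi (x + s *\<^sub>R h)) has_real_derivative - f' s) (at s)"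
      using DERIV_minus[OF GDERIV_line[OF GDERIV_phi[of "x + s *\<^sub>R h"]]]
      by (simp add: f'_def inner_vec_def)
    have "((\<lambda>s. x $ i + s * h $ i) has_real_derivative h $ i) (at s)" for i
      by (auto intro!: derivative_eq_intros)
    then have "((\<lambda>s. phi1' ?c (x $ i + s * h $ i)) has_real_derivative
        1 / (\<bar>x $ i + s * h $ i\<bar> + 1 / ?c) * (h $ i)) (at s)" for i
      by (rule DERIV_chain2[OF DERIV_phi1', rotated]) simp
    then show "((\<lambda>s. - f' s) has_real_derivative - f'' s) (at s)"
      unfolding f'_def f''_def by (intro DERIV_minus DERIV_sum DERIV_cmult_right)
  next
    fix s :: real assume "0 \<le> s" "s \<le> 1"
    then have "l1_norm (x + s *\<^sub>R h) \<le> max (l1_norm x) (l1_norm y)"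
      unfolding h_def by (rule convex_comb_l1_norm_le)
    moreover have "f'' s = (\<Sum>i\<in>UNIV. (h $ i)\<^sup>2 / (\<bar>(x + s *\<^sub>R h) $ i\<bar> + 1 / ?c))"
      by (simp add: f''_def power2_eq_square)
    moreover from this have "f'' s \<ge> 0" by (auto intro!: sum_nonneg divide_nonneg_nonneg)
    ultimately have "f'' s * (l1_norm (x + s *\<^sub>R h) + 1) \<le> f'' s * (max (l1_norm x) (l1_norm y) + 1)"
      and "(l1_norm h)\<^sup>2 \<le> f'' s * (l1_norm (x + s *\<^sub>R h) + 1)"
      using phi_hessian_lower[of h "x + s *\<^sub>R h"] by (simp_all only: add_right_mono mult_left_mono)
    then have "(l1_norm h)\<^sup>2 \<le> f'' s * (max (l1_norm x) (l1_norm y) + 1)" by (rule order_trans[rotated])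
    then have "step_lambda x y * (l1_norm h)\<^sup>2 \<le> f'' s"
      using max_l1_norm_nonneg[of x y] by (simp add: step_lambda_def pos_divide_le_eq)
    then show "- f'' s \<le> 2 * - (step_lambda x y / 2 * (l1_norm h)\<^sup>2)" by simp
  qed
  moreover have "f' 0 = grad phi x \<bullet> h" by (simp add: f'_def grad_phi inner_vec_def)
  ultimately show ?thesis by (simp add: bregman_def h_def)
qed

text \<open>Both endpoints are compared with the intermediate point by \<open>bregman_phi_lower\<close>; in the convex
combination of the two inequalities the gradient terms cancel.\<close>

lemma phi_strongly_convex:
  fixes x y :: "real ^ 'n"
  assumes s: "0 \<le> s" "s \<le> 1"
  shows "phi (x + s *\<^sub>R (y - x)) \<le> (1 - s) * phi x + s * phi y
     - s * (1 - s) * (step_lambda x y / 2 * (l1_norm (y - x))\<^sup>2)"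
proof -
  define z where "z = x + s *\<^sub>R (y - x)"
  define b where "b = step_lambda x y / 2 * (l1_norm (y - x))\<^sup>2"
  have z: "l1_norm z \<le> max (l1_norm x) (l1_norm y)" unfolding z_def by (rule convex_comb_l1_norm_le[OF s])
  have "x - z = (- s) *\<^sub>R (y - x)" "y - z = (1 - s) *\<^sub>R (y - x)" by (auto simp: z_def algebra_simps)
  then have eqs: "l1_norm (x - z) = s * l1_norm (y - x)" "l1_norm (y - z) = (1 - s) * l1_norm (y - x)"
    "grad phi z \<bullet> (x - z) = - s * (grad phi z \<bullet> (y - x))"
    "grad phi z \<bullet> (y - z) = (1 - s) * (grad phi z \<bullet> (y - x))"
    using s by (simp_all only: l1_norm_scaleR inner_scaleR_right) auto
  have "step_lambda x y / 2 * (s * l1_norm (y - x))\<^sup>2 \<le> step_lambda z x / 2 * (s * l1_norm (y - x))\<^sup>2"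
    "step_lambda x y / 2 * ((1 - s) * l1_norm (y - x))\<^sup>2 \<le> step_lambda z y / 2 * ((1 - s) * l1_norm (y - x))\<^sup>2"
    using z by (auto intro!: mult_right_mono divide_right_mono step_lambda_antimono)
  with bregman_phi_lower[of z x] bregman_phi_lower[of z y]
  have "s\<^sup>2 * b \<le> phi x - phi z + s * (grad phi z \<bullet> (y - x))"
    "(1 - s)\<^sup>2 * b \<le> phi y - phi z - (1 - s) * (grad phi z \<bullet> (y - x))"
    by (auto simp: bregman_def eqs b_def power_mult_distrib mult_ac)
  then have "(1 - s) * (s\<^sup>2 * b) + s * ((1 - s)\<^sup>2 * b)
      \<le> (1 - s) * (phi x - phi z + s * (grad phi z \<bullet> (y - x)))
          + s * (phi y - phi z - (1 - s) * (grad phi z \<bullet> (y - x)))"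
    using s by (intro add_mono mult_left_mono) auto
  also have "\<dots> = (1 - s) * phi x + s * phi y - phi z" by (simp add: algebra_simps)
  also have "(1 - s) * (s\<^sup>2 * b) + s * ((1 - s)\<^sup>2 * b) = s * (1 - s) * b"
    by (simp add: power2_eq_square algebra_simps)
  finally show ?thesis by (simp add: z_def b_def)
qed

section \<open>The proximal map\<close>

abbreviation prox_obj ::
  "(real ^ 'n \<Rightarrow> real) \<Rightarrow> real ^ 'n \<Rightarrow> real ^ 'n \<Rightarrow> real \<Rightarrow> real ^ 'n \<Rightarrow> real" where
  "prox_obj r x g \<eta> \<equiv> (\<lambda>y. g \<bullet> y + r y + \<eta> * bregman phi y x)"

text \<open>A convex function falls at most linearly: on the unit ball it has a minimum, and a point farther
away is compared with the point of the ball on the same ray.\<close>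

lemma convex_linear_lower_bound:
  fixes r :: "real ^ 'n \<Rightarrow> real"
  assumes r: "convex_on UNIV r"
  obtains c where "c \<ge> 0" "\<And>y. r y \<ge> r x - c * (1 + norm (y - x))"
proof -
  have "continuous_on (cball x 1) r"
    using convex_on_continuous[OF open_UNIV r] by (rule continuous_on_subset) simp
  then obtain z where z: "z \<in> cball x 1" "\<And>y. y \<in> cball x 1 \<Longrightarrow> r z \<le> r y"
    using continuous_attains_inf[of "cball x 1" r] by auto
  define c where "c = r x - r z"
  have c: "c \<ge> 0" using z(2)[of x] by (simp add: c_def)
  show thesis
  proof (rule that[OF c])
    fix y
    show "r y \<ge> r x - c * (1 + norm (y - x))"
    proof (cases "norm (y - x) \<ge> 1")
      case False
      then have "r z \<le> r y" by (intro z(2)) (simp add: dist_norm norm_minus_commute)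
      then have "r y \<ge> r x - c" by (simp add: c_def)
      moreover have "c * 1 \<le> c * (1 + norm (y - x))" using c by (intro mult_left_mono) auto
      ultimately show ?thesis by linarith
    next
      case y: True
      define s where "s = 1 / norm (y - x)"
      have s: "0 < s" "s \<le> 1" "s * norm (y - x) = 1" using y by (auto simp: s_def divide_le_eq_1)
      have "dist x (x + s *\<^sub>R (y - x)) = s * norm (y - x)" using s(1) by (simp add: dist_norm)
      then have "r z \<le> r (x + s *\<^sub>R (y - x))" using s(3) by (intro z(2)) simp
      also have "x + s *\<^sub>R (y - x) = (1 - s) *\<^sub>R x + s *\<^sub>R y" by (simp add: algebra_simps)
      also have "r \<dots> \<le> (1 - s) * r x + s * r y"
        by (rule convex_onD[OF r]) (use s in auto)
      finally have "s * r y \<ge> s * r x - c" by (simp add: algebra_simps c_def)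
      then have "s * r y \<ge> s * r x - c * (s * norm (y - x))" by (simp add: s(3))
      then have "s * (r x - c * norm (y - x)) \<le> s * r y" by (simp add: algebra_simps)
      then have "r y \<ge> r x - c * norm (y - x)"
        using s by (simp add: mult_le_cancel_left_pos)
      with c show ?thesis by (simp add: algebra_simps)
    qed
  qed
qed

lemma continuous_prox_obj:
  assumes "convex_on UNIV r"
  shows "continuous_on S (prox_obj r x g \<eta>)"
  unfolding bregman_def using continuous_on_subset[OF convex_on_continuous[OF open_UNIV assms]]
  by (intro continuous_intros continuous_phi) auto

lemma phi_superlinear:
  fixes y :: "real ^ 'n"
  assumes "B \<ge> 0"
  shows "phi y \<ge> B * l1_norm y - B * exp (B + 1)"
proof -
  have "(\<Sum>i\<in>(UNIV :: 'n set). B * \<bar>y $ i\<bar> - B * exp (B + 1) / real CARD('n)) \<le> phi y"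
    unfolding phi_eq_sum_phi1 by (intro sum_mono phi1_lower) (use assms in auto)
  then show ?thesis by (simp add: sum_subtractf l1_norm_def sum_distrib_left)
qed

text \<open>The linear term and \<open>r\<close> decrease at most linearly, and \<open>\<eta> * phi\<close> outgrows every linear function.\<close>

lemma prox_obj_coercive:
  fixes r :: "real ^ 'n \<Rightarrow> real"
  assumes r: "convex_on UNIV r" and \<eta>: "\<eta> > 0"
  obtains \<rho> where "\<And>y. norm y > \<rho> \<Longrightarrow> prox_obj r x g \<eta> y > b"
proof -
  obtain c where c: "c \<ge> 0" "\<And>y. r y \<ge> r x - c * (1 + norm (y - x))"
    using convex_linear_lower_bound[OF r] by metis
  \<comment> \<open>The slope \<open>B\<close> is chosen such that \<open>\<eta> * (B * norm y)\<close> compensates \<open>g\<close>, \<open>r\<close> and the gradient of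
    \<open>phi\<close> at \<open>x\<close>, with a summand \<open>norm y\<close> to spare.\<close>
  define B where "B = (norm g + c + 1) / \<eta> + norm (grad phi x)"
  define k where "k = b - r x + c * (1 + norm x) + \<eta> * (B * exp (B + 1) + phi x) - \<eta> * (grad phi x \<bullet> x)"
  have B: "B \<ge> 0" using c(1) \<eta> by (simp add: B_def)
  show thesis
  proof (rule that)
    fix y :: "real ^ 'n" assume y: "norm y > k"
    have 1: "r y \<ge> r x - c * norm y - c * (1 + norm x)"
      using c(2)[of y] mult_left_mono[OF norm_triangle_ineq4[of y x] c(1)] by (simp add: algebra_simps)
    have 2: "g \<bullet> y \<ge> - norm g * norm y"
      using Cauchy_Schwarz_ineq2[of g y] by linarith
    have 3: "grad phi x \<bullet> y \<le> norm (grad phi x) * norm y"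
      using Cauchy_Schwarz_ineq2[of "grad phi x" y] by linarith
    have 4: "phi y \<ge> B * norm y - B * exp (B + 1)"
      using phi_superlinear[OF B, of y] mult_left_mono[OF norm_le_l1_norm[of y] B] by linarith
    have "bregman phi y x \<ge> (B - norm (grad phi x)) * norm y - B * exp (B + 1) - phi x + grad phi x \<bullet> x"
      using 3 4 by (simp add: bregman_def algebra_simps inner_diff_right)
    from mult_left_mono[OF this, of \<eta>] \<eta>
    have "\<eta> * bregman phi y x \<ge> \<eta> * ((norm g + c + 1) / \<eta>) * norm y - \<eta> * (B * exp (B + 1) + phi x)
        + \<eta> * (grad phi x \<bullet> x)"
      by (simp add: B_def algebra_simps)
    then have "\<eta> * bregman phi y x \<ge> (norm g + c + 1) * norm y - \<eta> * (B * exp (B + 1) + phi x)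
        + \<eta> * (grad phi x \<bullet> x)"
      using \<eta> by simp
    with 1 2 have "prox_obj r x g \<eta> y \<ge> norm y + b - k" by (simp add: k_def algebra_simps)
    with y show "prox_obj r x g \<eta> y > b" by simp
  qed
qed

context
  fixes K :: "(real ^ 'n) set" and r :: "real ^ 'n \<Rightarrow> real"
  assumes K: "closed K" "convex K" "K \<noteq> {}" and r: "convex_on UNIV r"
begin

text \<open>Coercivity reduces the minimisation to a compact set. So the choice operator in \<open>prox_map\<close>
returns a true minimiser.\<close>

lemma
  assumes \<eta>: "\<eta> > 0"
  shows prox_map_in: "prox_map K r x g \<eta> \<in> K"
    and prox_map_le: "y \<in> K \<Longrightarrow> prox_obj r x g \<eta> (prox_map K r x g \<eta>) \<le> prox_obj r x g \<eta> y"
proof -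
  let ?F = "prox_obj r x g \<eta>"
  obtain y0 where y0: "y0 \<in> K" using K by blast
  obtain \<rho> where \<rho>: "\<And>y. norm y > \<rho> \<Longrightarrow> ?F y > ?F y0"
    using prox_obj_coercive[OF r \<eta>] by metis
  let ?S = "K \<inter> cball 0 \<rho>"
  have "compact ?S" using K(1) by (simp add: closed_Int_compact)
  moreover have y0S: "y0 \<in> ?S" using y0 \<rho>[of y0] by force
  ultimately obtain p where p: "p \<in> ?S" "\<And>y. y \<in> ?S \<Longrightarrow> ?F p \<le> ?F y"
    using continuous_attains_inf[OF _ _ continuous_prox_obj[OF r]] by (metis empty_iff)
  have "?F p \<le> ?F y" if "y \<in> K" for y
  proof (cases "y \<in> ?S")
    case False
    then have "?F y > ?F y0" using that \<rho>[of y] by auto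
    then show ?thesis using p(2)[OF y0S] by linarith
  qed (use p in simp)
  then have "is_arg_min ?F (\<lambda>y. y \<in> K) p" using p(1) by (simp add: is_arg_min_linorder)
  then have "is_arg_min ?F (\<lambda>y. y \<in> K) (prox_map K r x g \<eta>)"
    unfolding prox_map_def arg_min_on_def arg_min_def by (rule someI)
  then show "prox_map K r x g \<eta> \<in> K"
    and "y \<in> K \<Longrightarrow> prox_obj r x g \<eta> (prox_map K r x g \<eta>) \<le> prox_obj r x g \<eta> y"
    by (auto simp: is_arg_min_linorder)
qed

text \<open>The strong convexity of \<open>phi\<close> passes to the prox objective: minimality of \<open>p\<close> is tested at the
points \<open>p + s (y - p)\<close>, the result is divided by \<open>s\<close>, and \<open>s\<close> tends to \<open>0\<close>.\<close>

lemma prox_map_growth: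
  fixes x g :: "real ^ 'n"
  assumes \<eta>: "\<eta> > 0" and y: "y \<in> K"
  defines "p \<equiv> prox_map K r x g \<eta>"
  shows "prox_obj r x g \<eta> p + \<eta> * (step_lambda p y / 2 * (l1_norm (y - p))\<^sup>2) \<le> prox_obj r x g \<eta> y"
proof -
  let ?F = "prox_obj r x g \<eta>"
  define b where "b = \<eta> * (step_lambda p y / 2 * (l1_norm (y - p))\<^sup>2)"
  have p: "p \<in> K" unfolding p_def by (rule prox_map_in[OF \<eta>])
  have *: "(1 - s) * b \<le> ?F y - ?F p" if s: "0 < s" "s < 1" for s
  proof -
    let ?z = "p + s *\<^sub>R (y - p)"
    have z: "?z = (1 - s) *\<^sub>R p + s *\<^sub>R y" by (simp add: algebra_simps)
    then have "?z \<in> K" using convexD[OF K(2) p y, of "1 - s" s] s by simp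
    then have "?F p \<le> ?F ?z" unfolding p_def by (rule prox_map_le[OF \<eta>])
    moreover have "r ?z \<le> (1 - s) * r p + s * r y"
      unfolding z by (rule convex_onD[OF r]) (use s in auto)
    moreover have "\<eta> * phi ?z \<le> \<eta> * ((1 - s) * phi p + s * phi y
        - s * (1 - s) * (step_lambda p y / 2 * (l1_norm (y - p))\<^sup>2))"
      by (rule mult_left_mono[OF phi_strongly_convex]) (use s \<eta> in auto)
    moreover have "g \<bullet> ?z = (1 - s) * (g \<bullet> p) + s * (g \<bullet> y)"
      by (simp add: inner_add_right inner_diff_right algebra_simps)
    moreover have "grad phi x \<bullet> (?z - x) = (1 - s) * (grad phi x \<bullet> (p - x)) + s * (grad phi x \<bullet> (y - x))"
      by (simp add: inner_add_right inner_diff_right algebra_simps)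
    ultimately have "?F p \<le> (1 - s) * ?F p + s * ?F y - s * (1 - s) * b"
      unfolding bregman_def b_def by (simp add: algebra_simps)
    then have "s * ((1 - s) * b) \<le> s * (?F y - ?F p)" by (simp add: algebra_simps)
    then show ?thesis using s by (simp add: mult_le_cancel_left_pos)
  qed
  have "((\<lambda>s. (1 - s) * b) \<longlongrightarrow> (1 - 0) * b) (at_right 0)" by (intro tendsto_intros)
  moreover have "\<forall>\<^sub>F s in at_right 0. (1 - s) * b \<le> ?F y - ?F p"
    using eventually_at_right_real[OF zero_less_one] by eventually_elim (use * in auto)
  ultimately have "(1 - 0) * b \<le> ?F y - ?F p" by (rule tendsto_upperbound) simp
  then show ?thesis by (simp add: b_def)
qed

text \<open>As \<open>\<eta>\<close> grows, \<open>prox_map K r x 0 \<eta>\<close> tends to \<open>x\<close>. So a bound on all values of the proximal map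
bounds \<open>K\<close> itself, including the starting point of the algorithm.\<close>

lemma prox_bounded_imp_l1_norm_le:
  assumes D: "D \<ge> 0" and bounded: "\<And>y g \<eta>. \<eta> > 0 \<Longrightarrow> y \<in> K \<Longrightarrow> l1_norm (prox_map K r y g \<eta>) \<le> D"
    and x: "x \<in> K"
  shows "l1_norm x \<le> D"
proof (rule field_le_epsilon)
  fix e :: real assume e: "e > 0"
  obtain c where c: "c \<ge> 0" "\<And>y. r y \<ge> r x - c * (1 + norm (y - x))"
    using convex_linear_lower_bound[OF r] by metis
  \<comment> \<open>\<open>1 / N\<close> is a lower bound for \<open>step_lambda\<close>, and \<open>c * N\<close> bounds the decrease of \<open>r\<close> from \<open>x\<close> to
    the prox point; \<open>\<eta>\<close> is taken so large that a prox point farther than \<open>e\<close> from \<open>x\<close> would cost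
    more than this decrease.\<close>
  define N where "N = l1_norm x + D + 1"
  define \<eta> where "\<eta> = (c * N + 1) * N / e\<^sup>2"
  have N: "N \<ge> 1" using D by (simp add: N_def)
  have cN: "c * N \<ge> 0" using c(1) N by simp
  then have \<eta>: "\<eta> > 0" using N e by (simp add: \<eta>_def add_nonneg_pos)
  define p where "p = prox_map K r x 0 \<eta>"
  have p: "l1_norm p \<le> D" unfolding p_def by (rule bounded[OF \<eta> x])
  have "1 / N \<le> step_lambda x p"
    unfolding step_lambda_def N_def using p D max_l1_norm_nonneg[of x p] l1_norm_nonneg[of x]
        by (intro frac_le) linarith+
  then have "1 / N / 2 * (l1_norm (p - x))\<^sup>2 \<le> step_lambda x p / 2 * (l1_norm (p - x))\<^sup>2"
    by (intro mult_right_mono divide_right_mono) auto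
  also have "\<dots> \<le> bregman phi p x" by (rule bregman_phi_lower)
  finally have 1: "1 / N / 2 * (l1_norm (p - x))\<^sup>2 \<le> bregman phi p x" .
  have 2: "1 / N / 2 * (l1_norm (p - x))\<^sup>2 \<le> step_lambda p x / 2 * (l1_norm (x - p))\<^sup>2"
    using \<open>1 / N \<le> step_lambda x p\<close> unfolding l1_norm_minus_commute[of x p]
    by (intro mult_right_mono divide_right_mono) (auto simp: step_lambda_def max.commute)
  have "prox_obj r x 0 \<eta> p + \<eta> * (step_lambda p x / 2 * (l1_norm (x - p))\<^sup>2) \<le> prox_obj r x 0 \<eta> x"
    unfolding p_def by (rule prox_map_growth[OF \<eta> x])
  moreover have "bregman phi x x = 0" by (simp add: bregman_def)
  ultimately have "r p + \<eta> * bregman phi p x + \<eta> * (step_lambda p x / 2 * (l1_norm (x - p))\<^sup>2) \<le> r x"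
    by simp
  with mult_left_mono[OF 1, of \<eta>] mult_left_mono[OF 2, of \<eta>] \<eta>
  have "\<eta> * (1 / N * (l1_norm (p - x))\<^sup>2) \<le> r x - r p" by simp
  also have "\<dots> \<le> c * (1 + norm (p - x))" using c(2)[of p] by simp
  also have "\<dots> \<le> c * N"
    using norm_triangle_ineq4[of p x] norm_le_l1_norm[of p] norm_le_l1_norm[of x] p c(1)
    by (intro mult_left_mono) (auto simp: N_def)
  finally have "(c * N + 1) / e\<^sup>2 * (l1_norm (p - x))\<^sup>2 \<le> c * N" using N by (simp add: \<eta>_def)
  then have "(c * N + 1) * (l1_norm (p - x))\<^sup>2 \<le> c * N * e\<^sup>2" using e by (simp add: field_simps)
  also have "\<dots> \<le> (c * N + 1) * e\<^sup>2" by (intro mult_right_mono) auto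
  finally have "(l1_norm (p - x))\<^sup>2 \<le> e\<^sup>2" using cN by (simp add: mult_le_cancel_left_pos)
  then have "l1_norm (p - x) \<le> e" by (rule power2_le_imp_le) (use e in simp)
  moreover have "l1_norm x \<le> l1_norm p + l1_norm (x - p)"
    using l1_norm_triangle[of p "x - p"] by simp
  ultimately show "l1_norm x \<le> D + e" using p by (simp add: l1_norm_minus_commute[of x p])
qed

text \<open>Each of the two minimisers is inserted as the competitor of the other one in \<open>prox_map_growth\<close>; on
the right only the difference of the two objectives survives. With equal coefficients this gives
Lipschitz continuity in the gradient, in general it gives continuity in all arguments.\<close>

lemma prox_map_stability:
  fixes x g x' g' :: "real ^ 'n"
  assumes \<eta>: "\<eta> > 0" "\<eta>' > 0" and D: "\<And>y. y \<in> K \<Longrightarrow> l1_norm y \<le> D"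
  defines "p \<equiv> prox_map K r x g \<eta>" and "p' \<equiv> prox_map K r x' g' \<eta>'"
  shows "(\<eta> + \<eta>') / (2 * (D + 1)) * (l1_norm (p - p'))\<^sup>2
    \<le> ((g - \<eta> *\<^sub>R grad phi x) - (g' - \<eta>' *\<^sub>R grad phi x')) \<bullet> (p' - p) + (\<eta> - \<eta>') * (phi p' - phi p)"
proof -
  have p: "p \<in> K" "p' \<in> K" unfolding p_def p'_def using \<eta> by (auto intro: prox_map_in)
  have D0: "D \<ge> 0" using D[OF p(1)] l1_norm_nonneg[of p] by linarith
  have lam: "1 / (D + 1) \<le> step_lambda p p'" "1 / (D + 1) \<le> step_lambda p' p"
    unfolding step_lambda_def using D[OF p(1)] D[OF p(2)] max_l1_norm_nonneg[of p p'] max_l1_norm_nonneg[of p' p]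
    by (auto intro!: frac_le)
  have "1 / (D + 1) / 2 * (l1_norm (p - p'))\<^sup>2 \<le> step_lambda p p' / 2 * (l1_norm (p' - p))\<^sup>2"
    "1 / (D + 1) / 2 * (l1_norm (p - p'))\<^sup>2 \<le> step_lambda p' p / 2 * (l1_norm (p - p'))\<^sup>2"
    unfolding l1_norm_minus_commute[of p' p] using lam by (intro mult_right_mono divide_right_mono; simp)+
  moreover have "(\<eta> + \<eta>') / (2 * (D + 1)) * (l1_norm (p - p'))\<^sup>2
      = \<eta> * (1 / (D + 1) / 2 * (l1_norm (p - p'))\<^sup>2) + \<eta>' * (1 / (D + 1) / 2 * (l1_norm (p - p'))\<^sup>2)"
  proof -
    have "(a + b) / (2 * c) * N = a * (1 / c / 2 * N) + b * (1 / c / 2 * N)" for a b c N :: real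
      by (simp add: add_divide_distrib distrib_right mult.commute[of 2])
    then show ?thesis by blast
  qed
  ultimately have "(\<eta> + \<eta>') / (2 * (D + 1)) * (l1_norm (p - p'))\<^sup>2
     \<le> \<eta> * (step_lambda p p' / 2 * (l1_norm (p' - p))\<^sup>2) + \<eta>' * (step_lambda p' p / 2 * (l1_norm (p - p'))\<^sup>2)"
    using \<eta> by (simp only: add_mono mult_left_mono less_imp_le)
  also have "\<dots> \<le> (prox_obj r x g \<eta> p' - prox_obj r x g \<eta> p) + (prox_obj r x' g' \<eta>' p - prox_obj r x' g' \<eta>' p')"
    using prox_map_growth[OF \<eta>(1) p(2), where x = x and g = g]
      prox_map_growth[OF \<eta>(2) p(1), where x = x' and g = g']
    by (simp add: p_def[symmetric] p'_def[symmetric])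
  also have "\<dots> = ((g - \<eta> *\<^sub>R grad phi x) - (g' - \<eta>' *\<^sub>R grad phi x')) \<bullet> (p' - p) + (\<eta> - \<eta>') * (phi p' - phi p)"
    by (simp add: bregman_def inner_diff_left inner_diff_right algebra_simps)
  finally show ?thesis .
qed

lemma prox_map_lipschitz_gradient:
  assumes \<eta>: "\<eta> > 0" and D: "\<And>y. y \<in> K \<Longrightarrow> l1_norm y \<le> D"
  shows "\<eta> / (D + 1) * l1_norm (prox_map K r x g \<eta> - prox_map K r x g' \<eta>) \<le> infnorm (g - g')"
proof -
  define p p' where "p = prox_map K r x g \<eta>" and "p' = prox_map K r x g' \<eta>"
  have "\<eta> / (D + 1) * (l1_norm (p - p'))\<^sup>2 \<le> (g - g') \<bullet> (p' - p)"
  proof -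
    have "(\<eta> + \<eta>) / (2 * (D + 1)) = \<eta> / (D
        + 1)" by (simp only: mult_2[symmetric] mult_divide_mult_cancel_left_if) simp
    then show ?thesis using prox_map_stability[OF \<eta> \<eta> D, of x g x g'] by (simp add: p_def p'_def)
  qed
  also have "\<dots> \<le> infnorm (g - g') * l1_norm (p - p')"
    using inner_le_infnorm_l1_norm[of "g - g'" "p' - p"] by (simp add: l1_norm_minus_commute[of p' p])
  finally have *: "(\<eta> / (D + 1) * l1_norm (p - p')) * l1_norm (p - p') \<le> infnorm (g - g') * l1_norm (p - p')"
    by (simp add: power2_eq_square)
  show ?thesis unfolding p_def[symmetric] p'_def[symmetric]
  proof (cases "l1_norm (p - p') = 0")
    case False
    then have "l1_norm (p - p') > 0" using l1_norm_nonneg[of "p - p'"] by linarith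
    then show "\<eta> / (D + 1) * l1_norm (p - p') \<le> infnorm (g - g')"
      using * by (rule mult_right_le_imp_le[rotated])
  qed simp
qed

text \<open>This makes the iterates measurable functions of the samples.\<close>

lemma prox_map_continuous:
  assumes D: "\<And>y. y \<in> K \<Longrightarrow> l1_norm y \<le> D"
  shows "continuous_on (UNIV \<times> UNIV \<times> {0<..}) (\<lambda>(x, g, \<eta>). prox_map K r x g \<eta>)"
  unfolding continuous_on
proof safe
  fix x0 g0 :: "real ^ 'n" and \<eta>0 :: real assume \<eta>0: "\<eta>0 > 0"
  define A :: "((real ^ 'n) \<times> (real ^ 'n) \<times> real) set" where "A = UNIV \<times> UNIV \<times> {0<..}"
  define q where "q = (\<lambda>z. prox_map K r (fst z) (fst (snd z)) (snd (snd z)))"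
  define q0 where "q0 = prox_map K r x0 g0 \<eta>0"
  let ?F = "at (x0, g0, \<eta>0) within A"
  have D0: "D \<ge> 0" using D K(3) l1_norm_nonneg order_trans by blast
  have "compact K"
  proof -
    have "bounded K" unfolding bounded_iff
      using D norm_le_l1_norm order_trans by blast
    then show ?thesis using K(1) by (simp add: compact_eq_bounded_closed)
  qed
  then have "bounded (phi ` K)"
    by (intro compact_imp_bounded compact_continuous_image continuous_phi)
  then obtain W where W: "\<And>y. y \<in> K \<Longrightarrow> \<bar>phi y\<bar> \<le> W" by (auto simp: bounded_iff)
  define w where "w = (\<lambda>z. infnorm ((fst (snd z) - snd (snd z) *\<^sub>R grad phi (fst z)) - (g0 - \<eta>0 *\<^sub>R grad phi x0)) * (2 * D)
    + \<bar>snd (snd z) - \<eta>0\<bar> * (2 * W))"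
  have le: "(l1_norm (q z - q0))\<^sup>2 \<le> 2 * (D + 1) / \<eta>0 * w z" if z: "z \<in> A" for z
  proof -
    obtain x g \<eta> where z_eq: "z = (x, g, \<eta>)" by (cases z)
    have \<eta>: "\<eta> > 0" using z by (simp add: A_def z_eq)
    have K': "q z \<in> K" "q0 \<in> K" unfolding q_def q0_def z_eq using \<eta> \<eta>0 by (auto intro: prox_map_in)
    have "\<eta>0 / (2 * (D + 1)) * (l1_norm (q z - q0))\<^sup>2 \<le> (\<eta> + \<eta>0) / (2 * (D + 1)) * (l1_norm (q z - q0))\<^sup>2"
      using \<eta> D0 by (intro mult_right_mono divide_right_mono) auto
    also have "\<dots> \<le> ((g - \<eta> *\<^sub>R grad phi x) - (g0 - \<eta>0 *\<^sub>R grad phi x0)) \<bullet> (q0 - q z)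
        + (\<eta> - \<eta>0) * (phi q0 - phi (q z))"
      using prox_map_stability[OF \<eta> \<eta>0 D, of x g x0 g0] by (simp add: q_def q0_def z_eq)
    also have "\<dots> \<le> w z"
    proof (rule add_mono[of _ "infnorm _ * (2 * D)" _ "\<bar>\<eta> - \<eta>0\<bar> * (2 * W)", THEN order_trans])
      have "l1_norm (q0 - q z) \<le> 2 * D"
        using l1_norm_triangle[of q0 "- q z"] l1_norm_scaleR[of "-1" "q z"] D[OF K'(1)] D[OF K'(2)] by simp
      then show "((g - \<eta> *\<^sub>R grad phi x) - (g0 - \<eta>0 *\<^sub>R grad phi x0)) \<bullet> (q0 - q z)
         \<le> infnorm ((g - \<eta> *\<^sub>R grad phi x) - (g0 - \<eta>0 *\<^sub>R grad phi x0)) * (2 * D)"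
        using inner_le_infnorm_l1_norm[of "(g - \<eta> *\<^sub>R grad phi x) - (g0 - \<eta>0 *\<^sub>R grad phi x0)" "q0 - q z"]
          mult_left_mono[OF _ infnorm_nonneg, of "l1_norm (q0 - q z)" "2 * D"
            "(g - \<eta> *\<^sub>R grad phi x) - (g0 - \<eta>0 *\<^sub>R grad phi x0)"] by linarith
      have "(\<eta> - \<eta>0) * (phi q0 - phi (q z)) \<le> \<bar>\<eta> - \<eta>0\<bar> * \<bar>phi q0 - phi (q z)\<bar>"
        by (metis abs_ge_self abs_mult)
      also have "\<dots> \<le> \<bar>\<eta> - \<eta>0\<bar> * (2 * W)"
        using W[OF K'(1)] W[OF K'(2)] by (intro mult_left_mono) auto
      finally show "(\<eta> - \<eta>0) * (phi q0 - phi (q z)) \<le> \<bar>\<eta> - \<eta>0\<bar> * (2 * W)" .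
    qed (simp add: w_def z_eq)
    finally show ?thesis using \<eta>0 D0 by (simp add: field_simps)
  qed
  have tw: "(w \<longlongrightarrow> infnorm ((g0 - \<eta>0 *\<^sub>R grad phi x0) - (g0 - \<eta>0 *\<^sub>R grad phi x0)) * (2 * D)
      + \<bar>\<eta>0 - \<eta>0\<bar> * (2 * W)) ?F"
  proof -
    have f: "(fst \<longlongrightarrow> x0) ?F" "((\<lambda>z. fst (snd z)) \<longlongrightarrow> g0) ?F" "((\<lambda>z. snd (snd z)) \<longlongrightarrow> \<eta>0) ?F"
      by (auto intro!: tendsto_eq_intros)
    have "isCont (grad phi) x0"
      using continuous_grad_phi continuous_on_eq_continuous_at[OF open_UNIV] by blast
    then have "((\<lambda>z. grad phi (fst z)) \<longlongrightarrow> grad phi x0) ?F" by (rule isCont_tendsto_compose) (rule f)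
    then show ?thesis unfolding w_def by (intro tendsto_intros f)
  qed
  have "((\<lambda>z. norm (q z - q0)) \<longlongrightarrow> 0) ?F"
  proof (rule tendsto_sandwich[OF _ _ tendsto_const])
    show "\<forall>\<^sub>F z in ?F. norm (q z - q0) \<le> sqrt (2 * (D + 1) / \<eta>0 * w z)"
      unfolding eventually_at_filter
      by (rule always_eventually) (meson le norm_le_l1_norm order_trans real_le_rsqrt)
    have "((\<lambda>z. sqrt (2 * (D + 1) / \<eta>0 * w z)) \<longlongrightarrow> sqrt (2 * (D
        + 1) / \<eta>0 * (infnorm ((g0 - \<eta>0 *\<^sub>R grad phi x0) - (g0 - \<eta>0 *\<^sub>R grad phi x0)) * (2 * D) + \<bar>\<eta>0 - \<eta>0\<bar> * (2 * W)))) ?F"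
      by (intro tendsto_intros tw)
    then show "((\<lambda>z. sqrt (2 * (D + 1) / \<eta>0 * w z)) \<longlongrightarrow> 0) ?F" by (simp add: infnorm_0)
  qed simp
  then have "(q \<longlongrightarrow> q0) ?F" by (simp add: LIM_zero_iff tendsto_norm_zero_iff)
  then show "((\<lambda>(x, g, \<eta>). prox_map K r x g \<eta>) \<longlongrightarrow> prox_map K r x0 g0 \<eta>0) (at (x0, g0, \<eta>0) within UNIV \<times> UNIV \<times> {0<..})"
    by (simp add: q_def q0_def A_def case_prod_unfold)
qed

end

section \<open>Pathwise analysis of the adaptive step sizes\<close>

text \<open>Since \<open>b \<le> 2 (sqrt (A + b) - sqrt A) sqrt (A + b)\<close>, the sum is dominated by a telescoping one.
Leading zeros of \<open>a\<close> contribute \<open>0 / 0 = 0\<close>.\<close>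

lemma sum_div_sqrt_partial_sums_le:
  fixes a :: "nat \<Rightarrow> real"
  assumes a: "\<And>t. a t \<ge> 0"
  shows "(\<Sum>t=1..n. a t / sqrt (\<Sum>s=1..t. a s)) \<le> 2 * sqrt (\<Sum>t=1..n. a t)"
proof (induction n)
  case (Suc n)
  define A where "A = (\<Sum>t=1..n. a t)"
  have A: "A \<ge> 0" unfolding A_def by (intro sum_nonneg) (use a in auto)
  let ?b = "a (Suc n)"
  have "?b / sqrt (A + ?b) \<le> 2 * (sqrt (A + ?b) - sqrt A)"
  proof (cases "A + ?b = 0")
    case True
    then have "A = 0" using A a[of "Suc n"] by linarith
    with True show ?thesis by simp
  next
    case False
    then have pos: "sqrt (A + ?b) > 0" using A a[of "Suc n"] by (simp add: less_le)
    have "sqrt A \<le> sqrt (A + ?b)" using a[of "Suc n"] by simp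
    then have "(sqrt (A + ?b) - sqrt A) * (sqrt (A + ?b) + sqrt A)
        \<le> (sqrt (A + ?b) - sqrt A) * (2 * sqrt (A + ?b))"
      by (intro mult_left_mono) auto
    moreover have "(sqrt (A + ?b) - sqrt A) * (sqrt (A + ?b) + sqrt A) = ?b"
      using A a[of "Suc n"] by (simp add: algebra_simps flip: power2_eq_square)
    ultimately have "?b \<le> 2 * (sqrt (A + ?b) - sqrt A) * sqrt (A + ?b)" by (simp only: mult_ac)
    then show ?thesis using pos by (simp add: pos_divide_le_eq)
  qed
  with Suc.IH show ?case by (simp add: A_def)
qed simp

text \<open>Summation by parts; as \<open>\<alpha>\<close> increases, the total variation of the weights is \<open>\<alpha> (n + 1) - \<alpha> 1\<close>.\<close>

lemma abel_sum_lower_bound: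
  fixes \<alpha> f :: "nat \<Rightarrow> real"
  assumes mono: "\<And>t. t \<in> {1..n} \<Longrightarrow> \<alpha> t \<le> \<alpha> (t + 1)" and pos: "\<alpha> 1 \<ge> 0"
    and f: "\<And>t. t \<in> {1..n+1} \<Longrightarrow> 0 \<le> f t \<and> f t \<le> R"
  shows "(\<Sum>t=1..n. \<alpha> (t + 1) * (f (t + 1) - f t)) \<ge> \<alpha> (n + 1) * f (n + 1) - R * \<alpha> (n + 1)"
  using mono f
proof (induction n)
  case 0
  then show ?case using mult_right_mono[OF _ pos, of "f 1" R] by (simp add: mult.commute)
next
  case (Suc n)
  have IH: "(\<Sum>t=1..n. \<alpha> (t + 1) * (f (t + 1) - f t)) \<ge> \<alpha> (n + 1) * f (n + 1) - R * \<alpha> (n + 1)"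
    using Suc.prems by (intro Suc.IH) auto
  have "(\<alpha> (n + 2) - \<alpha> (n + 1)) * (R - f (n + 1)) \<ge> 0"
    using Suc.prems(1)[of "Suc n"] Suc.prems(2)[of "Suc n"] by (intro mult_nonneg_nonneg) auto
  with IH show ?case by (simp add: algebra_simps)
qed

text \<open>Young's inequality absorbs \<open>sqrt Z\<close>. The three summands of the factor are then squared with the
Cauchy-Schwarz weights \<open>2/5\<close>, \<open>2/5\<close>, \<open>1/5\<close>; they are chosen to match the proportions of the
constants in the final bound.\<close>

lemma quadratic_self_bound:
  fixes Z R E M :: real
  assumes "Z \<ge> 0" "E \<ge> 0" and le: "Z \<le> R + (R + sqrt E + M) * sqrt Z"
  shows "Z \<le> 2 * R + 5 / 2 * R\<^sup>2 + 5 / 2 * E + 5 * M\<^sup>2"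
proof -
  define s where "s = R + sqrt E + M"
  have "0 \<le> (s - sqrt Z)\<^sup>2" by simp
  then have "2 * (s * sqrt Z) \<le> s\<^sup>2 + Z" using assms(1) by (simp add: power2_diff algebra_simps)
  moreover have "s\<^sup>2 \<le> 5 / 2 * R\<^sup>2 + 5 / 2 * (sqrt E)\<^sup>2 + 5 * M\<^sup>2"
  proof -
    \<comment> \<open>Lagrange's identity for these weights\<close>
    have "0 \<le> 4/25 * (5/2 * R - 5/2 * sqrt E)\<^sup>2 + 2/25 * (5/2 * R - 5 * M)\<^sup>2 + 2/25 * (5/2 * sqrt E - 5 * M)\<^sup>2"
      by simp
    then show ?thesis by (simp add: s_def power2_eq_square algebra_simps)
  qed
  ultimately show ?thesis using le assms(2) by (simp add: s_def)
qed

lemma lipschitz_gradient_constant_nonneg: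
  fixes f :: "real ^ 'n \<Rightarrow> real"
  assumes "\<And>y y'. norm (grad f y - grad f y') \<le> L * norm (y - y')"
  shows "L \<ge> 0"
proof -
  obtain b :: "real ^ 'n" where "norm b = 1" using vector_choose_size[of 1] by auto
  then have "norm (grad f b - grad f 0) \<le> L" using assms[of b 0] by simp
  then show ?thesis by (rule order_trans[OF norm_ge_zero])
qed

text \<open>One trajectory, for an arbitrary sequence \<open>d\<close> in place of the gradient estimates of \<open>f0\<close>.\<close>

locale adaexpgrad_run =
  fixes K :: "(real ^ 'n) set" and r f0 :: "real ^ 'n \<Rightarrow> real" and L D R :: real
    and T :: nat and x v d :: "nat \<Rightarrow> real ^ 'n" and \<alpha> :: "nat \<Rightarrow> real"
  assumes K: "closed K" "convex K" and r: "convex_on UNIV r"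
    and diff: "\<And>y. f0 differentiable (at y)"
    and smooth: "\<And>y y'. norm (grad f0 y - grad f0 y') \<le> L * norm (y - y')"
    and D: "\<And>y. y \<in> K \<Longrightarrow> l1_norm y \<le> D"
    and R: "\<And>y. y \<in> K \<Longrightarrow> f0 y + r y \<in> {0..R}"
    and x1: "x 1 \<in> K"
    and \<alpha>_eq: "\<And>t. t \<in> {1..T+1} \<Longrightarrow> \<alpha> t =
        sqrt (max (\<Sum>s=1..<t. (step_lambda (x s) (v s))\<^sup>2 * (\<alpha> s)\<^sup>2 * (l1_norm (v s - x s))\<^sup>2) 1)"
    and v_eq: "\<And>t. t \<in> {1..T} \<Longrightarrow> v t = prox_map K r (x t) (d t) (\<alpha> t)"
    and x_eq: "\<And>t. t \<in> {1..T} \<Longrightarrow>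
        x (t + 1) = (1 - \<alpha> t / \<alpha> (t + 1)) *\<^sub>R x t + (\<alpha> t / \<alpha> (t + 1)) *\<^sub>R v t"
begin

abbreviation "S t \<equiv> (step_lambda (x t) (v t))\<^sup>2 * (\<alpha> t)\<^sup>2 * (l1_norm (v t - x t))\<^sup>2"

text \<open>This is the \<open>\<parallel>\<cdot>\<parallel>\<^sub>1\<close>-norm of the generalised gradient with \<open>d t\<close> in place of the true gradient.\<close>

definition q :: "nat \<Rightarrow> real" where
  "q t = \<alpha> t / (D + 1) * l1_norm (v t - x t)"

definition e :: "nat \<Rightarrow> real" where
  "e t = infnorm (d t - grad f0 (x t))"

lemma K_nonempty: "K \<noteq> {}" using x1 by auto

lemma D_nonneg: "D \<ge> 0" using D[OF x1] l1_norm_nonneg[of "x 1"] by linarith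

lemma R_nonneg: "R \<ge> 0" using R[OF x1] by auto

lemma \<alpha>_ge_1: "t \<in> {1..T+1} \<Longrightarrow> \<alpha> t \<ge> 1"
  by (subst \<alpha>_eq) auto

lemma \<alpha>_square: "t \<in> {1..T+1} \<Longrightarrow> (\<alpha> t)\<^sup>2 = max (\<Sum>s=1..<t. S s) 1"
  by (subst \<alpha>_eq) auto

lemma \<alpha>_mono:
  assumes "t \<in> {1..T}"
  shows "\<alpha> t \<le> \<alpha> (t + 1)"
proof -
  have "(\<Sum>s=1..<t. S s) \<le> (\<Sum>s=1..<t+1. S s)" by (intro sum_mono2) auto
  then have "max (\<Sum>s=1..<t. S s) 1 \<le> max (\<Sum>s=1..<t+1. S s) 1" by (rule max.mono) simp
  then have "(\<alpha> t)\<^sup>2 \<le> (\<alpha> (t + 1))\<^sup>2"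
    using \<alpha>_square[of t] \<alpha>_square[of "t + 1"] assms by (simp only: atLeastAtMost_iff) simp
  then show ?thesis by (rule power2_le_imp_le) (use \<alpha>_ge_1[of "t + 1"] assms in auto)
qed

lemma step_size_range:
  assumes "t \<in> {1..T}"
  shows "0 < \<alpha> t / \<alpha> (t + 1)" "\<alpha> t / \<alpha> (t + 1) \<le> 1"
  using \<alpha>_mono[OF assms] \<alpha>_ge_1[of t] \<alpha>_ge_1[of "t + 1"] assms by auto

lemma v_in:
  assumes t: "t \<in> {1..T}"
  shows "v t \<in> K"
proof -
  have "\<alpha> t > 0" using \<alpha>_ge_1[of t] t by auto
  then show ?thesis unfolding v_eq[OF t] by (rule prox_map_in[OF K K_nonempty r])
qed

lemma x_in: "t \<in> {1..T+1} \<Longrightarrow> x t \<in> K"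
proof (induction t)
  case (Suc t)
  show ?case
  proof (cases "t = 0")
    case True then show ?thesis using x1 by simp
  next
    case False
    then have t: "t \<in> {1..T}" using Suc.prems by auto
    with Suc show ?thesis using x_eq[OF t] step_size_range[OF t] v_in[OF t]
      by (auto intro!: convexD[OF K(2)])
  qed
qed simp

lemma lambda_ge:
  assumes t: "t \<in> {1..T}"
  shows "1 / (D + 1) \<le> step_lambda (x t) (v t)"
proof -
  have "x t \<in> K" using x_in t by simp
  then show ?thesis
    unfolding step_lambda_def using D[of "x t"] D[OF v_in[OF t]] max_l1_norm_nonneg[of "x t" "v t"]
    by (intro frac_le) auto
qed

text \<open>Together with the next lemma: up to powers of \<open>D + 1\<close>, the step sizes are governed by the partial
sums of \<open>(q t)\<^sup>2\<close>. This direction bounds them from below.\<close>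

lemma q_square_le_S:
  assumes t: "t \<in> {1..T}"
  shows "(q t)\<^sup>2 \<le> S t"
proof -
  have "(1 / (D + 1) * (\<alpha> t * l1_norm (v t - x t)))\<^sup>2
      \<le> (step_lambda (x t) (v t) * (\<alpha> t * l1_norm (v t - x t)))\<^sup>2"
    using lambda_ge[OF t] \<alpha>_ge_1[of t] D_nonneg t by (intro power_mono mult_right_mono) auto
  then show ?thesis by (simp add: q_def power_mult_distrib)
qed

lemma S_le_q_square:
  shows "S t / (D + 1)\<^sup>2 \<le> (q t)\<^sup>2"
proof -
  have "(step_lambda (x t) (v t))\<^sup>2 \<le> 1"
    using step_lambda_pos[of "x t" "v t"] step_lambda_le_one[of "x t" "v t"] by (simp add: power_le_one)
  then have "(step_lambda (x t) (v t))\<^sup>2 * ((\<alpha> t)\<^sup>2 * (l1_norm (v t - x t))\<^sup>2)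
      \<le> 1 * ((\<alpha> t)\<^sup>2 * (l1_norm (v t - x t))\<^sup>2)"
    by (rule mult_right_mono) simp
  from divide_right_mono[OF this, of "(D + 1)\<^sup>2"] show ?thesis
    by (simp add: q_def power_mult_distrib power_divide)
qed

text \<open>The descent inequality, scaled by \<open>\<alpha> (t + 1) / (D + 1)\<close>. Smoothness handles \<open>f0\<close>, convexity handles
\<open>r\<close> along the averaging step, and \<open>prox_map_growth\<close> together with \<open>bregman_phi_lower\<close> provides the
decrease \<open>\<alpha> t * step_lambda * \<parallel>v t - x t\<parallel>\<^sub>1\<^sup>2\<close>. The scaling leaves \<open>(q t)\<^sup>2\<close> on the left and \<open>q t\<close>
without a factor \<open>D + 1\<close> next to the error \<open>e t\<close>.\<close>

lemma one_step:
  assumes t: "t \<in> {1..T}"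
  shows "(q t)\<^sup>2 + \<alpha> (t + 1) / (D + 1) * ((f0 (x (t + 1)) + r (x (t + 1))) - (f0 (x t) + r (x t)))
     \<le> e t * q t + L / 2 * (D + 1) * ((q t)\<^sup>2 / \<alpha> (t + 1))"
proof -
  define a a' \<beta> h \<Delta> lam where "a = \<alpha> t" and "a' = \<alpha> (t + 1)" and "\<beta> = a / a'" and "h = v t - x t"
    and "\<Delta> = l1_norm h" and "lam = step_lambda (x t) (v t)"
  have pos: "a > 0" "a' > 0" using \<alpha>_ge_1[of t] \<alpha>_ge_1[of "t + 1"] t by (auto simp: a_def a'_def)
  have \<beta>: "0 < \<beta>" "\<beta> \<le> 1" using step_size_range[OF t] by (auto simp: \<beta>_def a_def a'_def)
  have L: "L \<ge> 0" using lipschitz_gradient_constant_nonneg[OF smooth] .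
  have \<Delta>: "\<Delta> \<ge> 0" by (simp add: \<Delta>_def)
  have xK: "x t \<in> K" using x_in t by simp
  have x': "x (t + 1) = x t + \<beta> *\<^sub>R h" "x (t + 1) = (1 - \<beta>) *\<^sub>R x t + \<beta> *\<^sub>R v t"
    using x_eq[OF t] by (simp_all add: \<beta>_def a_def a'_def h_def algebra_simps)
  have "f0 (x (t + 1)) \<le> f0 (x t) + \<beta> * (grad f0 (x t) \<bullet> h) + L / 2 * (norm (\<beta> *\<^sub>R h))\<^sup>2"
    using l_smooth_quadratic_bound[OF diff smooth, of "x t" "\<beta> *\<^sub>R h"] unfolding x'(1) inner_scaleR_right
    by linarith
  also have "(norm (\<beta> *\<^sub>R h))\<^sup>2 \<le> \<beta>\<^sup>2 * \<Delta>\<^sup>2"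
    using norm_le_l1_norm[of h] \<beta> by (simp add: power_mult_distrib \<Delta>_def mult_left_mono power_mono)
  finally have 1: "f0 (x (t + 1)) \<le> f0 (x t) + \<beta> * (grad f0 (x t) \<bullet> h) + L / 2 * (\<beta>\<^sup>2 * \<Delta>\<^sup>2)"
    using L by (simp add: mult_left_mono)
  have 2: "r (x (t + 1)) \<le> r (x t) + \<beta> * (r (v t) - r (x t))"
    unfolding x'(2) using convex_onD[OF r, of \<beta> "x t" "v t"] \<beta> by (simp add: algebra_simps)
  have lam: "step_lambda (v t) (x t) = lam" by (simp add: lam_def step_lambda_def max.commute)
  have "prox_obj r (x t) (d t) a (v t) + a * (lam / 2 * \<Delta>\<^sup>2) \<le> prox_obj r (x t) (d t) a (x t)"
    using prox_map_growth[OF K K_nonempty r pos(1) xK, where x = "x t" and g = "d t"]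
    by (simp add: v_eq[OF t, symmetric, folded a_def] lam \<Delta>_def h_def l1_norm_minus_commute[of "x t"])
  moreover have "bregman phi (x t) (x t) = 0" by (simp add: bregman_def)
  moreover have "a * (lam / 2 * \<Delta>\<^sup>2) \<le> a * bregman phi (v t) (x t)"
    using bregman_phi_lower[of "x t" "v t"] pos by (intro mult_left_mono) (auto simp: lam_def \<Delta>_def h_def)
  ultimately have 3: "d t \<bullet> h + r (v t) - r (x t) \<le> - (a * lam * \<Delta>\<^sup>2)"
    by (simp add: h_def inner_diff_right)
  have "\<bar>(d t - grad f0 (x t)) \<bullet> h\<bar> \<le> e t * \<Delta>"
    unfolding e_def \<Delta>_def by (rule inner_le_infnorm_l1_norm)
  then have 4: "grad f0 (x t) \<bullet> h \<le> d t \<bullet> h + e t * \<Delta>" by (simp add: inner_diff_left abs_le_iff)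
  have "(f0 (x (t + 1)) + r (x (t + 1))) - (f0 (x t) + r (x t))
      \<le> \<beta> * (grad f0 (x t) \<bullet> h + (r (v t) - r (x t))) + L / 2 * (\<beta>\<^sup>2 * \<Delta>\<^sup>2)"
    using 1 2 by (simp add: algebra_simps)
  also have "\<dots> \<le> \<beta> * (e t * \<Delta> - a * lam * \<Delta>\<^sup>2) + L / 2 * (\<beta>\<^sup>2 * \<Delta>\<^sup>2)"
    using 3 4 \<beta> by (intro add_right_mono mult_left_mono) auto
  finally have "a' / (D + 1) * ((f0 (x (t + 1)) + r (x (t + 1))) - (f0 (x t) + r (x t)))
      \<le> a' / (D + 1) * (\<beta> * (e t * \<Delta> - a * lam * \<Delta>\<^sup>2) + L / 2 * (\<beta>\<^sup>2 * \<Delta>\<^sup>2))"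
    using pos D_nonneg by (intro mult_left_mono) auto
  also have "\<dots> = a / (D + 1) * (e t * \<Delta> - a * lam * \<Delta>\<^sup>2) + a / (D + 1) * (L / 2 * (a / a' * \<Delta>\<^sup>2))"
    using pos by (simp add: \<beta>_def distrib_left power2_eq_square) 
  also have "\<dots> = e t * q t - lam * (a\<^sup>2 * \<Delta>\<^sup>2 / (D + 1)) + L / 2 * (D + 1) * ((q t)\<^sup>2 / a')"
    using D_nonneg pos by (simp add: q_def a_def[symmetric] h_def[symmetric] \<Delta>_def[symmetric] power2_eq_square right_diff_distrib mult_ac)
  also have "\<dots> \<le> e t * q t - (q t)\<^sup>2 + L / 2 * (D + 1) * ((q t)\<^sup>2 / a')"
  proof -
    have "1 / (D + 1) * (a\<^sup>2 * \<Delta>\<^sup>2 / (D + 1)) \<le> lam * (a\<^sup>2 * \<Delta>\<^sup>2 / (D + 1))"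
      using lambda_ge[OF t] D_nonneg by (intro mult_right_mono) (auto simp: lam_def)
    moreover have "(q t)\<^sup>2 = 1 / (D + 1) * (a\<^sup>2 * \<Delta>\<^sup>2 / (D + 1))"
      by (simp add: q_def a_def[symmetric] h_def[symmetric] \<Delta>_def[symmetric] power2_eq_square)
    ultimately show ?thesis by simp
  qed
  finally show ?thesis by (simp add: a'_def)
qed

lemma sum_q_square_bound:
  "(\<Sum>t=1..T. (q t)\<^sup>2) \<le> 2 * R + 5 / 2 * R\<^sup>2 + 5 / 2 * (\<Sum>t=1..T. (e t)\<^sup>2) + 5 * (L * (D + 1))\<^sup>2"
proof (rule quadratic_self_bound)
  let ?Z = "\<Sum>t=1..T. (q t)\<^sup>2" and ?E = "\<Sum>t=1..T. (e t)\<^sup>2"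
  let ?F = "\<lambda>t. f0 (x t) + r (x t)"
  have L: "L \<ge> 0" using lipschitz_gradient_constant_nonneg[OF smooth] .
  show "0 \<le> ?Z" "0 \<le> ?E" by (simp_all add: sum_nonneg)
  have "?Z + (\<Sum>t=1..T. \<alpha> (t + 1) / (D + 1) * (?F (t + 1) - ?F t))
     \<le> (\<Sum>t=1..T. e t * q t) + (\<Sum>t=1..T. L / 2 * (D + 1) * ((q t)\<^sup>2 / \<alpha> (t + 1)))"
    unfolding sum.distrib[symmetric] by (rule sum_mono) (rule one_step)
  moreover have "(\<Sum>t=1..T. \<alpha> (t + 1) / (D + 1) * (?F (t + 1) - ?F t)) \<ge> - (R * (1 + sqrt ?Z))"
  proof -
    have nn: "\<alpha> (T + 1) * ?F (T + 1) \<ge> 0"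
      using \<alpha>_ge_1[of "T + 1"] R[OF x_in, of "T + 1"] by (intro mult_nonneg_nonneg) auto
    have "- (R * \<alpha> (T + 1)) \<le> \<alpha> (T + 1) * ?F (T + 1) - R * \<alpha> (T + 1)" using nn by simp
    also have "\<dots> \<le> (\<Sum>t=1..T. \<alpha> (t + 1) * (?F (t + 1) - ?F t))"
      by (rule abel_sum_lower_bound) (use \<alpha>_mono \<alpha>_ge_1[of 1] R[OF x_in] in auto)
    finally have "- (R * \<alpha> (T + 1)) / (D + 1) \<le> (\<Sum>t=1..T. \<alpha> (t + 1) * (?F (t + 1) - ?F t)) / (D + 1)"
      using D_nonneg by (intro divide_right_mono) auto
    also have "\<dots> = (\<Sum>t=1..T. \<alpha> (t + 1) / (D + 1) * (?F (t + 1) - ?F t))"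
      by (simp add: sum_divide_distrib)
    finally have "- (R * (\<alpha> (T + 1) / (D + 1))) \<le> (\<Sum>t=1..T. \<alpha> (t + 1) / (D + 1) * (?F (t + 1) - ?F t))" by simp
    moreover have "\<alpha> (T + 1) / (D + 1) \<le> 1 + sqrt ?Z"
    proof (rule power2_le_imp_le)
      have "{1..<T+1} = {1..T}" by auto
      then have "(\<alpha> (T + 1))\<^sup>2 \<le> 1 + (\<Sum>t=1..T. S t)"
        using \<alpha>_square[of "T + 1"] by (simp add: sum_nonneg)
      then have "(\<alpha> (T + 1) / (D + 1))\<^sup>2 \<le> 1 / (D + 1)\<^sup>2 + (\<Sum>t=1..T. S t / (D + 1)\<^sup>2)"
        by (simp add: power_divide divide_right_mono flip: sum_divide_distrib add_divide_distrib)
      also have "\<dots> \<le> 1 + ?Z"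
        using D_nonneg by (intro add_mono sum_mono S_le_q_square) (simp add: divide_le_eq_1)
      also have "\<dots> \<le> (1 + sqrt ?Z)\<^sup>2" by (simp add: power2_sum sum_nonneg)
      finally show "(\<alpha> (T + 1) / (D + 1))\<^sup>2 \<le> (1 + sqrt ?Z)\<^sup>2" .
    qed (simp add: sum_nonneg)
    ultimately show ?thesis using mult_left_mono[OF _ R_nonneg] by (smt (verit))
  qed
  moreover have "(\<Sum>t=1..T. e t * q t) \<le> sqrt ?E * sqrt ?Z"
  proof (rule real_le_rsqrt[THEN order_trans])
    show "(\<Sum>t=1..T. e t * q t)\<^sup>2 \<le> ?E * ?Z" by (rule Cauchy_Schwarz_ineq_sum)
  qed (simp add: real_sqrt_mult)
  moreover have "(\<Sum>t=1..T. L / 2 * (D + 1) * ((q t)\<^sup>2 / \<alpha> (t + 1))) \<le> L * (D + 1) * sqrt ?Z"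
  proof -
    have "(q t)\<^sup>2 / \<alpha> (t + 1) \<le> (q t)\<^sup>2 / sqrt (\<Sum>s=1..t. (q s)\<^sup>2)" if t: "t \<in> {1..T}" for t
    proof (cases "q t = 0")
      case False
      have "(q t)\<^sup>2 \<le> (\<Sum>s=1..t. (q s)\<^sup>2)" using t by (intro member_le_sum) auto
      then have pos: "(\<Sum>s=1..t. (q s)\<^sup>2) > 0" using False by (smt (verit) zero_less_power2)
      have "{1..<t+1} = {1..t}" by auto
      then have "(\<Sum>s=1..t. (q s)\<^sup>2) \<le> (\<Sum>s=1..<t+1. S s)"
        using t by (simp only:) (intro sum_mono q_square_le_S, auto)
      also have "\<dots> \<le> (\<alpha> (t + 1))\<^sup>2" using t by (subst \<alpha>_square) auto
      finally have "sqrt (\<Sum>s=1..t. (q s)\<^sup>2) \<le> \<alpha> (t + 1)"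
        using \<alpha>_ge_1[of "t + 1"] t by (intro real_le_lsqrt) (auto simp: sum_nonneg)
      moreover have "\<alpha> (t + 1) > 0" using \<alpha>_ge_1[of "t + 1"] t by auto
      ultimately show ?thesis using pos by (intro divide_left_mono mult_pos_pos) auto
    qed simp
    then have "(\<Sum>t=1..T. (q t)\<^sup>2 / \<alpha> (t + 1)) \<le> (\<Sum>t=1..T. (q t)\<^sup>2 / sqrt (\<Sum>s=1..t. (q s)\<^sup>2))"
      by (rule sum_mono)
    also have "\<dots> \<le> 2 * sqrt ?Z" by (rule sum_div_sqrt_partial_sums_le) simp
    finally have "L / 2 * (D + 1) * (\<Sum>t=1..T. (q t)\<^sup>2 / \<alpha> (t + 1)) \<le> L / 2 * (D + 1) * (2 * sqrt ?Z)"
      using L D_nonneg by (intro mult_left_mono) auto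
    then show ?thesis by (simp add: sum_distrib_left)
  qed
  ultimately show "?Z \<le> R + (R + sqrt ?E + L * (D + 1)) * sqrt ?Z" by (simp add: algebra_simps)
qed

text \<open>The generalised gradient uses the prox step with the true gradient, and \<open>v t\<close> is the prox step with
\<open>d t\<close>; the two differ by the stability of the proximal map.\<close>

lemma gen_grad_le:
  assumes t: "t \<in> {1..T}"
  shows "l1_norm (gen_grad K r D (x t) (grad f0 (x t)) (\<alpha> t)) \<le> q t + e t"
proof -
  define p where "p = prox_map K r (x t) (grad f0 (x t)) (\<alpha> t)"
  have \<alpha>: "\<alpha> t > 0" using \<alpha>_ge_1[of t] t by auto
  have "\<alpha> t / (D + 1) * l1_norm (v t - p) \<le> e t"
    using prox_map_lipschitz_gradient[OF K K_nonempty r \<alpha> D, of "x t" "d t" "grad f0 (x t)"]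
    by (simp add: p_def v_eq[OF t, symmetric] e_def)
  moreover have "l1_norm (x t - p) \<le> l1_norm (v t - x t) + l1_norm (v t - p)"
    using l1_norm_triangle[of "x t - v t" "v t - p"] by (simp add: l1_norm_minus_commute)
  then have "\<alpha> t / (D + 1) * l1_norm (x t - p) \<le> \<alpha> t / (D + 1) * (l1_norm (v t - x t) + l1_norm (v t - p))"
    using \<alpha> D_nonneg by (intro mult_left_mono) auto
  ultimately show ?thesis using \<alpha> D_nonneg
    by (simp add: gen_grad_def p_def[symmetric] l1_norm_scaleR q_def distrib_left)
qed

lemma sum_gen_grad_square_bound:
  "(\<Sum>t=1..T. (l1_norm (gen_grad K r D (x t) (grad f0 (x t)) (\<alpha> t)))\<^sup>2)
   \<le> 4 * R + 5 * R\<^sup>2 + 10 * L\<^sup>2 * (D + 1)\<^sup>2 + 7 * (\<Sum>t=1..T. (infnorm (d t - grad f0 (x t)))\<^sup>2)"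
proof -
  have "(l1_norm (gen_grad K r D (x t) (grad f0 (x t)) (\<alpha> t)))\<^sup>2 \<le> 2 * (q t)\<^sup>2 + 2 * (e t)\<^sup>2"
    if t: "t \<in> {1..T}" for t
  proof -
    have "(l1_norm (gen_grad K r D (x t) (grad f0 (x t)) (\<alpha> t)))\<^sup>2 \<le> (q t + e t)\<^sup>2"
      by (rule power_mono[OF gen_grad_le[OF t]]) simp
    also have "\<dots> \<le> 2 * (q t)\<^sup>2 + 2 * (e t)\<^sup>2"
      using sum_squares_bound[of "q t" "e t"] by (simp add: power2_sum)
    finally show ?thesis .
  qed
  then have "(\<Sum>t=1..T. (l1_norm (gen_grad K r D (x t) (grad f0 (x t)) (\<alpha> t)))\<^sup>2)
      \<le> (\<Sum>t=1..T. 2 * (q t)\<^sup>2 + 2 * (e t)\<^sup>2)" by (rule sum_mono)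
  also have "\<dots> = 2 * (\<Sum>t=1..T. (q t)\<^sup>2) + 2 * (\<Sum>t=1..T. (e t)\<^sup>2)"
    by (simp add: sum.distrib sum_distrib_left)
  finally show ?thesis using sum_q_square_bound by (simp add: e_def power_mult_distrib)
qed

end

section \<open>A smooth potential for the squared sup norm\<close>

text \<open>For \<open>\<epsilon> = 0\<close> this is the square of the \<open>\<ell>\<^sub>p\<close>-norm with \<open>p = 2 k\<close>. The shift \<open>\<epsilon>\<close> keeps the bases of
all powers positive, so that the potential is smooth also where coordinates vanish.\<close>

definition soft_sup_square :: "real \<Rightarrow> real \<Rightarrow> real ^ 'n \<Rightarrow> real" where
  "soft_sup_square k \<epsilon> x = (\<Sum>i\<in>UNIV. ((x $ i)\<^sup>2 + \<epsilon>) powr k) powr (1 / k)"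

lemma soft_sup_square_nonneg: "soft_sup_square k \<epsilon> x \<ge> 0"
  by (simp add: soft_sup_square_def)

lemma soft_sup_square_zero:
  assumes "k \<ge> 1" "\<epsilon> > 0"
  shows "soft_sup_square k \<epsilon> (0 :: real ^ 'n) = real CARD('n) powr (1 / k) * \<epsilon>"
  using assms by (simp add: soft_sup_square_def powr_mult powr_powr)

lemma infnorm_square_le_soft_sup_square:
  fixes x :: "real ^ 'n"
  assumes k: "k \<ge> 1" and \<epsilon>: "\<epsilon> > 0"
  shows "(infnorm x)\<^sup>2 \<le> soft_sup_square k \<epsilon> x"
proof -
  have "\<bar>x $ i\<bar> \<le> sqrt (soft_sup_square k \<epsilon> x)" for i
  proof (rule real_le_rsqrt)
    have "((x $ i)\<^sup>2 + \<epsilon>) powr k \<le> (\<Sum>i\<in>UNIV. ((x $ i)\<^sup>2 + \<epsilon>) powr k)"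
      by (rule member_le_sum) auto
    then have "(((x $ i)\<^sup>2 + \<epsilon>) powr k) powr (1 / k) \<le> soft_sup_square k \<epsilon> x"
      unfolding soft_sup_square_def using k by (intro powr_mono2) auto
    then show "\<bar>x $ i\<bar>\<^sup>2 \<le> soft_sup_square k \<epsilon> x"
      using k \<epsilon> by (simp add: powr_powr add_nonneg_pos)
  qed
  then have "infnorm x \<le> sqrt (soft_sup_square k \<epsilon> x)" by (rule infnorm_leI)
  then have "(infnorm x)\<^sup>2 \<le> (sqrt (soft_sup_square k \<epsilon> x))\<^sup>2" by (rule power_mono) simp
  then show ?thesis by (simp add: soft_sup_square_nonneg)
qed

lemma continuous_soft_sup_square:
  assumes "k \<ge> 1" "\<epsilon> > 0"
  shows "continuous_on S (soft_sup_square k \<epsilon> :: real ^ 'n \<Rightarrow> real)"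
proof -
  have "((x $ i)\<^sup>2 + \<epsilon>) \<noteq> 0" for x :: "real ^ 'n" and i
    using assms by (metis add_nonneg_pos less_numeral_extra(3) zero_le_power2)
  moreover have "(\<Sum>i\<in>UNIV. ((x $ i)\<^sup>2 + \<epsilon>) powr k) \<noteq> 0" for x :: "real ^ 'n"
  proof -
    have "(\<Sum>i\<in>UNIV. ((x $ i)\<^sup>2 + \<epsilon>) powr k) > 0"
      by (intro sum_pos) (use calculation in auto)
    then show ?thesis by linarith
  qed
  ultimately show ?thesis unfolding soft_sup_square_def[abs_def]
    by (intro continuous_on_powr continuous_intros) auto
qed

text \<open>The power mean inequality for the exponents \<open>k - 1\<close> and \<open>k\<close>: Young's inequality compares every
summand with the mean \<open>B\<close> of the \<open>k\<close>-th powers.\<close>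

lemma power_mean_sum:
  fixes a :: "'n::finite \<Rightarrow> real"
  assumes k: "k \<ge> 1" and a: "\<And>i. a i > 0"
  shows "(\<Sum>i\<in>UNIV. a i powr (k - 1))
    \<le> real CARD('n) powr (1 / k) * (\<Sum>i\<in>UNIV. a i powr k) powr (1 - 1 / k)"
proof -
  define A where "A = (\<Sum>i\<in>(UNIV :: 'n set). a i powr k)"
  define N where "N = real CARD('n)"
  define B where "B = A / N"
  have N: "N > 0" by (simp add: N_def)
  have A: "A > 0" unfolding A_def by (intro sum_pos) (use a in \<open>auto simp: less_imp_neq[symmetric]\<close>)
  then have B: "B > 0" using N by (simp add: B_def)
  have *: "a i powr (k - 1) * B powr (1 / k) \<le> (1 - 1 / k) * a i powr k + 1 / k * B" for i
  proof -
    have "(a i powr k) powr (1 - 1 / k) * B powr (1 / k) \<le> (1 - 1 / k) * a i powr k + 1 / k * B"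
      by (rule Youngs_inequality_0) (use k a[of i] B in auto)
    moreover have "k * (1 - 1 / k) = k - 1" using k by (simp add: field_simps)
    ultimately show ?thesis by (simp add: powr_powr)
  qed
  have "(\<Sum>i\<in>UNIV. a i powr (k - 1)) * B powr (1 / k)
      \<le> (\<Sum>i\<in>(UNIV :: 'n set). (1 - 1 / k) * a i powr k + 1 / k * B)"
    unfolding sum_distrib_right by (rule sum_mono) (rule *)
  also have "\<dots> = (1 - 1 / k) * A + 1 / k * (N * B)"
    by (simp add: sum.distrib sum_distrib_left A_def N_def)
  also have "\<dots> = A" using N by (simp add: B_def algebra_simps)
  finally have "(\<Sum>i\<in>UNIV. a i powr (k - 1)) \<le> A / B powr (1 / k)"
    using B by (simp add: pos_le_divide_eq)
  also have "\<dots> = N powr (1 / k) * A powr (1 - 1 / k)"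
    using A N by (simp add: B_def powr_divide powr_diff)
  finally show ?thesis by (simp add: A_def N_def)
qed

text \<open>Along a line the potential is \<open>A\<^sup>1\<^sup>/\<^sup>k\<close> for a sum \<open>A\<close> of \<open>k\<close>-th powers. In its second derivative
the term that comes from the outer power has the factor \<open>1 / k - 1 \<le> 0\<close> and can be dropped; the
other one is at most \<open>2 (2 k - 1) \<parallel>h\<parallel>\<^sub>\<infinity>\<^sup>2\<close> times a ratio of power sums, for which
\<open>power_mean_sum\<close> gives \<open>d\<^sup>1\<^sup>/\<^sup>k\<close>. The vector \<open>w\<close> depends on \<open>x\<close> only, so the linear term vanishes in
the mean for a centred \<open>h\<close>.\<close>

lemma soft_sup_square_smooth:
  fixes x :: "real ^ 'n"
  assumes k: "k \<ge> 1" and \<epsilon>: "\<epsilon> > 0"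
  obtains w where "\<And>h. soft_sup_square k \<epsilon> (x + h)
    \<le> soft_sup_square k \<epsilon> x + w \<bullet> h + (2 * k - 1) * real CARD('n) powr (1 / k) * (infnorm h)\<^sup>2"
proof -
  define A0 where "A0 = (\<Sum>i\<in>UNIV. ((x $ i)\<^sup>2 + \<epsilon>) powr k)"
  define w :: "real ^ 'n" where
    "w = (\<chi> i. A0 powr (1 / k - 1) * (((x $ i)\<^sup>2 + \<epsilon>) powr (k - 1) * (2 * x $ i)))"
  have "soft_sup_square k \<epsilon> (x + h)
    \<le> soft_sup_square k \<epsilon> x + w \<bullet> h + (2 * k - 1) * real CARD('n) powr (1 / k) * (infnorm h)\<^sup>2" for h
  proof -
    define a where "a = (\<lambda>s i. (x $ i + s * h $ i)\<^sup>2 + \<epsilon>)"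
    define A where "A = (\<lambda>s. \<Sum>i\<in>UNIV. a s i powr k)"
    define B where "B = (\<lambda>s. \<Sum>i\<in>UNIV. a s i powr (k - 1) * (2 * (x $ i + s * h $ i) * h $ i))"
    define B' where "B' = (\<lambda>s. \<Sum>i\<in>UNIV. (k - 1) * a s i powr (k - 2) * (2 * (x $ i + s * h $ i) * h $ i)\<^sup>2
        + a s i powr (k - 1) * (2 * (h $ i)\<^sup>2))"
    define f' where "f' = (\<lambda>s. A s powr (1 / k - 1) * B s)"
    define f'' where "f'' = (\<lambda>s. (1 / k - 1) * A s powr (1 / k - 2) * (k * B s) * B s
        + A s powr (1 / k - 1) * B' s)"
    let ?c = "(2 * k - 1) * real CARD('n) powr (1 / k) * (infnorm h)\<^sup>2"
    have a: "a s i > 0" for s i using \<epsilon> by (simp add: a_def add_nonneg_pos)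
    have A: "A s > 0" for s unfolding A_def by (intro sum_pos) (use a in \<open>auto simp: less_imp_neq[symmetric]\<close>)
    have da: "((\<lambda>s. a s i) has_real_derivative 2 * (x $ i + s * h $ i) * h $ i) (at s)" for s i
      unfolding a_def by (auto intro!: derivative_eq_intros)
    have dap: "((\<lambda>s. a s i powr p) has_real_derivative p * a s i powr (p - 1) * (2 * (x $ i
        + s * h $ i) * h $ i)) (at s)" for s i p
      using DERIV_fun_powr[OF da a, where r = p] by simp
    have dA: "(A has_real_derivative k * B s) (at s)" for s
    proof -
      have "k * B s = (\<Sum>i\<in>UNIV. k * a s i powr (k - 1) * (2 * (x $ i + s * h $ i) * h $ i))"
        by (simp add: B_def sum_distrib_left mult.assoc)
      then show ?thesis unfolding A_def by (simp only:) (rule DERIV_sum[OF dap])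
    qed
    have dB: "(B has_real_derivative B' s) (at s)" for s
    proof -
      have "((\<lambda>s. a s i powr (k - 1) * (2 * (x $ i + s * h $ i) * h $ i)) has_real_derivative
         (k - 1) * a s i powr (k - 2) * (2 * (x $ i + s * h $ i) * h $ i)\<^sup>2
             + a s i powr (k - 1) * (2 * (h $ i)\<^sup>2)) (at s)" for i
      proof -
        have lin: "((\<lambda>s. 2 * (x $ i + s * h $ i) * h $ i) has_real_derivative 2 * (h $ i)\<^sup>2) (at s)"
          by (auto intro!: derivative_eq_intros simp: power2_eq_square)
        show ?thesis using DERIV_mult[OF dap[where i = i and p = "k - 1" and s = s] lin]
          by (simp add: power2_eq_square algebra_simps)
      qed
      then show ?thesis unfolding B_def B'_def by (rule DERIV_sum)
    qed
    have dAp: "((\<lambda>s. A s powr p) has_real_derivative p * A s powr (p - 1) * (k * B s)) (at s)" for s p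
      using DERIV_fun_powr[OF dA A, where r = p] by simp
    have "(\<lambda>s. A s powr (1 / k)) 1 \<le> (\<lambda>s. A s powr (1 / k)) 0 + f' 0 + ?c"
    proof (rule taylor_upper_of_second_deriv_bound[where f = "\<lambda>s. A s powr (1 / k)"])
      fix s
      show "((\<lambda>s. A s powr (1 / k)) has_real_derivative f' s) (at s)"
        using dAp[where p = "1 / k" and s = s] k by (simp add: f'_def)
      show "(f' has_real_derivative f'' s) (at s)"
        using DERIV_mult[OF dAp[where p = "1 / k - 1" and s = s] dB[of s]]
            by (simp add: f'_def f''_def algebra_simps)
      have "(k - 1) * a s i powr (k - 2) * (2 * (x $ i + s * h $ i) * h $ i)\<^sup>2
          + a s i powr (k - 1) * (2 * (h $ i)\<^sup>2)
          \<le> 2 * (2 * k - 1) * (infnorm h)\<^sup>2 * a s i powr (k - 1)" for i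
      proof -
        have "(x $ i + s * h $ i)\<^sup>2 \<le> a s i" using \<epsilon> by (simp add: a_def)
        then have "4 * (k - 1) * (h $ i)\<^sup>2 * a s i powr (k - 2) * (x $ i + s * h $ i)\<^sup>2
            \<le> 4 * (k - 1) * (h $ i)\<^sup>2 * a s i powr (k - 2) * a s i"
          using k by (intro mult_left_mono) auto
        moreover have "a s i powr (k - 2) * a s i = a s i powr (k - 1)"
          using powr_add[of "a s i" "k - 2" 1] a[of s i] by simp
        moreover have "(k - 1) * p * (2 * y * t)\<^sup>2 = 4 * (k - 1) * t\<^sup>2 * p * y\<^sup>2" for p y t :: real
          by (simp only: power_mult_distrib) simp
        ultimately have "(k - 1) * a s i powr (k - 2) * (2 * (x $ i + s * h $ i) * h $ i)\<^sup>2
            \<le> 4 * (k - 1) * (h $ i)\<^sup>2 * a s i powr (k - 1)"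
          by (simp only: mult.assoc)
        then have "(k - 1) * a s i powr (k - 2) * (2 * (x $ i + s * h $ i) * h $ i)\<^sup>2
            + a s i powr (k - 1) * (2 * (h $ i)\<^sup>2)
            \<le> 2 * (2 * k - 1) * a s i powr (k - 1) * (h $ i)\<^sup>2" by (simp add: algebra_simps)
        also have "\<dots> \<le> 2 * (2 * k - 1) * a s i powr (k - 1) * (infnorm h)\<^sup>2"
          using power_mono[OF component_le_infnorm_cart[of h i], of 2] k by (intro mult_left_mono) auto
        finally show ?thesis by (simp add: mult_ac)
      qed
      then have "B' s \<le> 2 * (2 * k - 1) * (infnorm h)\<^sup>2 * (\<Sum>i\<in>UNIV. a s i powr (k - 1))"
        unfolding B'_def sum_distrib_left by (intro sum_mono)
      also have "\<dots> \<le> 2 * (2 * k - 1) * (infnorm h)\<^sup>2 * (real CARD('n) powr (1 / k) * A s powr (1 - 1 / k))"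
        unfolding A_def using power_mean_sum[OF k, of "a s"] a k by (intro mult_left_mono) auto
      finally have "A s powr (1 / k - 1) * B' s
          \<le> A s powr (1 / k - 1) * (2 * (2 * k - 1) * (infnorm h)\<^sup>2 * (real CARD('n) powr (1 / k) * A s powr (1 - 1 / k)))"
        by (rule mult_left_mono) simp
      also have "\<dots> = 2 * ?c * (A s powr (1 / k - 1) * A s powr (1 - 1 / k))" by (simp only: mult_ac)
      also have "A s powr (1 / k - 1) * A s powr (1 - 1 / k) = 1"
        using A[of s] by (simp flip: powr_add)
      finally have "A s powr (1 / k - 1) * B' s \<le> 2 * ?c" by simp
      moreover have "(1 / k - 1) * A s powr (1 / k - 2) * (k * B s) * B s
          = - ((1 - 1 / k) * k * (A s powr (1 / k - 2) * (B s)\<^sup>2))"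
        by (simp add: power2_eq_square algebra_simps)
      moreover have "(1 - 1 / k) * k * (A s powr (1 / k - 2) * (B s)\<^sup>2) \<ge> 0" using k
          by (intro mult_nonneg_nonneg) auto
      ultimately show "f'' s \<le> 2 * ?c" unfolding f''_def by linarith
    qed
    moreover have "A 1 powr (1 / k) = soft_sup_square k \<epsilon> (x + h)" "A 0 powr (1 / k) = soft_sup_square k \<epsilon> x"
      by (simp_all add: A_def a_def soft_sup_square_def)
    moreover have "f' 0 = w \<bullet> h"
      by (simp add: f'_def w_def A_def A0_def B_def a_def inner_vec_def sum_distrib_left mult_ac)
    ultimately show ?thesis by simp
  qed
  then show thesis by (rule that)
qed

definition dimension_factor :: "real \<Rightarrow> real" where
  "dimension_factor n = exp 1 * (2 * ln n - 1)"

definition potential_order :: "real \<Rightarrow> real" where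
  "potential_order n = max 1 (ln n)"

lemma potential_order_ge_one: "potential_order n \<ge> 1"
  by (simp add: potential_order_def)

lemma exp_one_lower: "exp (1::real) \<ge> 27 / 10"
proof -
  have "(\<Sum>i<6. (1::real) ^ i /\<^sub>R fact i) \<le> exp 1"
    unfolding exp_def by (rule sum_le_suminf[OF summable_exp_generic]) auto
  then show ?thesis by (simp add: eval_nat_numeral)
qed

lemma dimension_factor_lower:
  assumes "n \<ge> 2"
  shows "dimension_factor n \<ge> 9 / 10"
proof -
  have "ln n \<ge> 2 / 3" using ln2_ge_two_thirds assms ln_mono[of 2 n] by linarith
  then have "exp 1 * (2 * ln n - 1) \<ge> 27 / 10 * (1 / 3)"
    using exp_one_lower by (intro mult_mono) auto
  then show ?thesis by (simp add: dimension_factor_def)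
qed

text \<open>From dimension three on, \<open>k = ln n\<close> gives \<open>n\<^sup>1\<^sup>/\<^sup>k = e\<close>, hence exactly \<open>dimension_factor n\<close>. In
dimension two \<open>ln n < 1\<close>, so \<open>k = 1\<close>: the potential is a constant plus the squared Euclidean
norm, the left-hand side is \<open>2\<close>, and \<open>20 / 9\<close> is the ratio of \<open>2\<close> to the lower bound \<open>9 / 10\<close> for \<open>dimension_factor\<close>.\<close>

lemma potential_constant_le:
  fixes n :: nat
  assumes n: "n \<ge> 2"
  defines "k \<equiv> potential_order (real n)"
  shows "(2 * k - 1) * real n powr (1 / k) \<le> 20 / 9 * dimension_factor (real n)"
proof (cases "n \<ge> 3")
  case True
  have "exp 1 \<le> (3 :: real)" by (rule exp_le)
  then have "1 \<le> ln (real n)" using True by (subst ln_ge_iff) auto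
  then have k: "k = ln (real n)" by (simp add: k_def potential_order_def)
  have "real n powr (1 / k) = exp 1"
    using True \<open>1 \<le> ln (real n)\<close> by (simp add: k powr_def)
  then have "(2 * k - 1) * real n powr (1 / k) = dimension_factor (real n)"
    by (simp add: k dimension_factor_def)
  then show ?thesis using dimension_factor_lower[of "real n"] n by linarith
next
  case False
  then have "n = 2" using n by simp
  have "ln 2 \<le> (1 :: real)" using ln_le_minus_one[of "2 :: real"] by simp
  then have "k = 1" by (simp add: k_def potential_order_def \<open>n = 2\<close>)
  then show ?thesis using dimension_factor_lower[of "real n"] n \<open>n = 2\<close> by simp
qed

section \<open>Independent pairs and joint measurability\<close>

text \<open>Independence of two random variables whose values may have different types, such as a data point and
a direction.\<close>

definition (in prob_space) indep_pair ::
  "'s measure \<Rightarrow> ('a \<Rightarrow> 's) \<Rightarrow> 't measure \<Rightarrow> ('a \<Rightarrow> 't) \<Rightarrow> bool" where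
  "indep_pair S X T Y \<longleftrightarrow> X \<in> measurable M S \<and> Y \<in> measurable M T \<and>
     (\<forall>A\<in>sets S. \<forall>B\<in>sets T. prob ((X -` A \<inter> space M) \<inter> (Y -` B \<inter> space M))
        = prob (X -` A \<inter> space M) * prob (Y -` B \<inter> space M))"

lemma (in prob_space) indep_pair_distr:
  assumes "indep_pair S X T Y"
  shows "distr M S X \<Otimes>\<^sub>M distr M T Y = distr M (S \<Otimes>\<^sub>M T) (\<lambda>\<omega>. (X \<omega>, Y \<omega>))"
proof -
  have X[measurable]: "X \<in> measurable M S" and Y[measurable]: "Y \<in> measurable M T"
    using assms by (auto simp: indep_pair_def)
  interpret X: prob_space "distr M S X" by (rule prob_space_distr) simp
  interpret Y: prob_space "distr M T Y" by (rule prob_space_distr) simp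
  show ?thesis
  proof (rule pair_measure_eqI)
    fix A B assume "A \<in> sets (distr M S X)" "B \<in> sets (distr M T Y)"
    then have A[measurable]: "A \<in> sets S" and B[measurable]: "B \<in> sets T" by auto
    have "(\<lambda>\<omega>. (X \<omega>, Y \<omega>)) -` (A \<times> B) \<inter> space M = (X -` A \<inter> space M) \<inter> (Y -` B \<inter> space M)" by auto
    then show "emeasure (distr M S X) A * emeasure (distr M T Y) B
        = emeasure (distr M (S \<Otimes>\<^sub>M T) (\<lambda>\<omega>. (X \<omega>, Y \<omega>))) (A \<times> B)"
      using assms A B by (simp add: emeasure_distr indep_pair_def emeasure_eq_measure ennreal_mult)
  qed (simp_all add: X.sigma_finite_measure_axioms Y.sigma_finite_measure_axioms)
qed

lemma (in prob_space) indep_pair_compose: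
  assumes "indep_pair S X T Y" and f: "f \<in> measurable S S'" and g: "g \<in> measurable T T'"
  shows "indep_pair S' (\<lambda>\<omega>. f (X \<omega>)) T' (\<lambda>\<omega>. g (Y \<omega>))"
proof -
  have X: "X \<in> measurable M S" and Y: "Y \<in> measurable M T"
    using assms by (auto simp: indep_pair_def)
  have "(\<lambda>\<omega>. f (X \<omega>)) -` A \<inter> space M = X -` (f -` A \<inter> space S) \<inter> space M" for A
    using measurable_space[OF X] by auto
  moreover have "(\<lambda>\<omega>. g (Y \<omega>)) -` A \<inter> space M = Y -` (g -` A \<inter> space T) \<inter> space M" for A
    using measurable_space[OF Y] by auto
  moreover have "prob ((X -` (f -` A \<inter> space S) \<inter> space M) \<inter> (Y -` (g -` B \<inter> space T) \<inter> space M))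
      = prob (X -` (f -` A \<inter> space S) \<inter> space M) * prob (Y -` (g -` B \<inter> space T) \<inter> space M)"
    if "A \<in> sets S'" "B \<in> sets T'" for A B
    using assms(1) measurable_sets[OF f that(1)] measurable_sets[OF g that(2)]
    by (simp only: indep_pair_def)
  ultimately have "\<forall>A\<in>sets S'. \<forall>B\<in>sets T'.
      prob (((\<lambda>\<omega>. f (X \<omega>)) -` A \<inter> space M) \<inter> ((\<lambda>\<omega>. g (Y \<omega>)) -` B \<inter> space M))
      = prob ((\<lambda>\<omega>. f (X \<omega>)) -` A \<inter> space M) * prob ((\<lambda>\<omega>. g (Y \<omega>)) -` B \<inter> space M)"
    by (intro ballI) (simp only:)
  then show ?thesis
    unfolding indep_pair_def by (intro conjI measurable_compose[OF X f] measurable_compose[OF Y g])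
qed

lemma (in prob_space) indep_pair_imp_indep_var: "indep_pair S X T Y \<Longrightarrow> indep_var S X T Y"
  unfolding indep_var_distribution_eq using indep_pair_distr by (auto simp: indep_pair_def)

text \<open>Fubini's theorem in the form in which a variable that is independent of the past is averaged out
first, with the past kept fixed. The inner integral is written over \<open>M\<close> again, so that facts about
expectations apply to it.\<close>

lemma (in prob_space) nn_integral_indep_pair:
  assumes indep: "indep_pair N1 X N2 Z" and h[measurable]: "h \<in> borel_measurable (N1 \<Otimes>\<^sub>M N2)"
  shows "(\<integral>\<^sup>+\<omega>. h (X \<omega>, Z \<omega>) \<partial>M) = (\<integral>\<^sup>+\<omega>. (\<integral>\<^sup>+\<omega>'. h (X \<omega>, Z \<omega>') \<partial>M) \<partial>M)"
proof -
  have X[measurable]: "X \<in> measurable M N1" and Z[measurable]: "Z \<in> measurable M N2"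
    using indep by (auto simp: indep_pair_def)
  interpret Z: prob_space "distr M N2 Z" by (rule prob_space_distr) simp
  have "(\<integral>\<^sup>+\<omega>. h (X \<omega>, Z \<omega>) \<partial>M) = (\<integral>\<^sup>+p. h p \<partial>distr M (N1 \<Otimes>\<^sub>M N2) (\<lambda>x. (X x, Z x)))"
    by (simp add: nn_integral_distr)
  also have "\<dots> = (\<integral>\<^sup>+x. \<integral>\<^sup>+z. h (x, z) \<partial>distr M N2 Z \<partial>distr M N1 X)"
    unfolding indep_pair_distr[OF indep, symmetric] by (rule Z.nn_integral_fst[symmetric]) measurable
  also have "\<dots> = (\<integral>\<^sup>+\<omega>. \<integral>\<^sup>+z. h (X \<omega>, z) \<partial>distr M N2 Z \<partial>M)"
    by (subst nn_integral_distr) measurable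
  also have "\<dots> = (\<integral>\<^sup>+\<omega>. (\<integral>\<^sup>+\<omega>'. h (X \<omega>, Z \<omega>') \<partial>M) \<partial>M)"
    by (intro nn_integral_cong nn_integral_distr) (auto intro!: measurable_compose[OF _ h] measurable_Pair measurable_const measurable_space[OF X])
  finally show ?thesis .
qed

text \<open>A \<open>G\<close>-Lipschitz function is the infimum of the cones \<open>l q z + G * dist y q\<close> over a dense set of
apices \<open>q\<close>; with a countable dense set this is a countable infimum of jointly measurable functions.\<close>

lemma borel_measurable_lipschitz_pair:
  fixes l :: "real ^ 'n \<Rightarrow> 'b \<Rightarrow> real"
  assumes meas[measurable]: "\<And>y. l y \<in> borel_measurable N"
    and lip: "\<And>z. z \<in> space N \<Longrightarrow> G-lipschitz_on UNIV (\<lambda>y. l y z)"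
  shows "(\<lambda>p. l (fst p) (snd p)) \<in> borel_measurable (borel \<Otimes>\<^sub>M N)"
proof -
  obtain Q :: "(real ^ 'n) set" where Q: "countable Q" "\<And>X. open X \<Longrightarrow> X \<noteq> {} \<Longrightarrow> \<exists>q\<in>Q. q \<in> X"
    using countable_dense_exists by metis
  have [measurable]: "countable Q" by (rule Q)
  have Qne: "Q \<noteq> {}" using Q(2)[of UNIV] by auto
  have eq: "l y z = (INF q\<in>Q. l q z + G * dist y q)" if z: "z \<in> space N" for y z
  proof (rule antisym)
    have G: "G \<ge> 0" using lip[OF z] by (rule lipschitz_on_nonneg)
    have bound: "l y z \<le> l q z + G * dist y q" "l q z \<le> l y z + G * dist y q" for q
      using lipschitz_onD[OF lip[OF z], of y q] by (auto simp: dist_real_def)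
    then show "l y z \<le> (INF q\<in>Q. l q z + G * dist y q)" by (intro cINF_greatest Qne)
    show "(INF q\<in>Q. l q z + G * dist y q) \<le> l y z"
    proof (rule field_le_epsilon)
      fix e :: real assume e: "e > 0"
      obtain q where q: "q \<in> Q" "q \<in> ball y (e / (2 * G + 1))"
        using Q(2)[OF open_ball, of y "e / (2 * G + 1)"] centre_in_ball[of y "e / (2 * G + 1)"]
          divide_pos_pos[OF e, of "2 * G + 1"] G
              by (metis add_nonneg_pos empty_iff mult_nonneg_nonneg zero_le_numeral zero_less_one)
      have "(INF q\<in>Q. l q z + G * dist y q) \<le> l q z + G * dist y q"
        by (rule cINF_lower[OF _ q(1)]) (use bound in \<open>auto intro!: bdd_belowI2\<close>)
      also have "\<dots> \<le> l y z + 2 * G * dist y q" using bound(2)[of q] by simp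
      also have "2 * G * dist y q \<le> (2 * G + 1) * dist y q" by (simp add: mult_right_mono)
      also have "\<dots> \<le> e" using q(2) G by (simp add: pos_less_divide_eq mult.commute less_imp_le)
      finally show "(INF q\<in>Q. l q z + G * dist y q) \<le> l y z + e" by simp
    qed
  qed
  have "(\<lambda>p. INF q\<in>Q. l q (snd p) + G * dist (fst p) q) \<in> borel_measurable (borel \<Otimes>\<^sub>M N)"
    by measurable
  then show ?thesis
    by (subst measurable_cong[where g = "\<lambda>p. INF q\<in>Q. l q (snd p) + G * dist (fst p) q"])
       (auto simp: space_pair_measure eq)
qed

lemma borel_measurable_vecI:
  fixes f :: "'a \<Rightarrow> real ^ 'n"
  assumes "\<And>i. (\<lambda>x. f x $ i) \<in> borel_measurable N"
  shows "f \<in> borel_measurable N"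
  by (subst borel_measurable_euclidean_space) (use assms in \<open>auto simp: Basis_vec_def inner_axis\<close>)

lemma borel_measurable_vec_nth [measurable (raw)]:
  fixes f :: "'a \<Rightarrow> real ^ 'n"
  assumes "f \<in> borel_measurable N"
  shows "(\<lambda>x. f x $ i) \<in> borel_measurable N"
  by (rule borel_measurable_continuous_on[OF continuous_on_component[OF continuous_on_id] assms])

section \<open>The gradient estimate from one random direction\<close>

locale smooth_stochastic_loss = prob_space \<Xi> for \<Xi> :: "'b measure" +
  fixes l :: "real ^ 'n \<Rightarrow> 'b \<Rightarrow> real" and G L :: real
  assumes loss_integrable: "\<And>y. integrable \<Xi> (l y)"
    and lipschitz: "\<And>z. z \<in> space \<Xi> \<Longrightarrow> G-lipschitz_on UNIV (\<lambda>y. l y z)"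
    and sample_diff: "\<And>z y. z \<in> space \<Xi> \<Longrightarrow> (\<lambda>y. l y z) differentiable (at y)"
    and sample_smooth: "\<And>z y y'. z \<in> space \<Xi> \<Longrightarrow>
         norm (grad (\<lambda>y. l y z) y - grad (\<lambda>y. l y z) y') \<le> L * norm (y - y')"
    and mean_diff: "\<And>y. mean_loss \<Xi> l differentiable (at y)"
    and unbiased: "\<And>y. (\<integral>z. grad (\<lambda>y. l y z) y \<partial>\<Xi>) = grad (mean_loss \<Xi> l) y"
begin

definition sgrad :: "real ^ 'n \<Rightarrow> 'b \<Rightarrow> real ^ 'n" where
  "sgrad y z = grad (\<lambda>y. l y z) y"

abbreviation mgrad :: "real ^ 'n \<Rightarrow> real ^ 'n" where
  "mgrad \<equiv> grad (mean_loss \<Xi> l)"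

lemma G_nonneg: "G \<ge> 0"
proof -
  obtain z where "z \<in> space \<Xi>" using not_empty by auto
  then show ?thesis using lipschitz lipschitz_on_nonneg by blast
qed

lemma L_nonneg: "L \<ge> 0"
proof -
  obtain z where "z \<in> space \<Xi>" using not_empty by auto
  then show ?thesis by (rule lipschitz_gradient_constant_nonneg[OF sample_smooth])
qed

lemma DERIV_sample_line:
  assumes "z \<in> space \<Xi>"
  shows "((\<lambda>s. l (y + s *\<^sub>R h) z) has_real_derivative (sgrad y z \<bullet> h)) (at 0)"
  using GDERIV_line[of "\<lambda>y. l y z" y 0 h "sgrad y z"]
    differentiable_imp_GDERIV_grad[OF sample_diff[OF assms]] by (simp add: sgrad_def)

text \<open>Gradients as limits along a fixed sequence: they inherit the Lipschitz bound and the joint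
measurability of the loss.\<close>

lemma sgrad_difference_quotient:
  assumes "z \<in> space \<Xi>"
  shows "(\<lambda>n. (l (y + inverse (real (Suc n)) *\<^sub>R h) z - l y z) / inverse (real (Suc n))) \<longlonglongrightarrow> sgrad y z \<bullet> h"
proof -
  have "filterlim (\<lambda>n. inverse (real (Suc n))) (at 0) sequentially"
    using LIMSEQ_inverse_real_of_nat by (intro filterlim_atI) auto
  moreover have "((\<lambda>s. (l (y + s *\<^sub>R h) z - l y z) / s) \<longlongrightarrow> sgrad y z \<bullet> h) (at 0)"
    using DERIV_sample_line[OF assms, of y h] by (simp add: has_field_derivative_iff)
  ultimately show ?thesis by (rule filterlim_compose[rotated])
qed

lemma norm_sgrad_le:
  assumes z: "z \<in> space \<Xi>"
  shows "norm (sgrad y z) \<le> G"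
proof -
  have "sgrad y z \<bullet> sgrad y z \<le> G * norm (sgrad y z)"
  proof (rule LIMSEQ_le_const2[OF sgrad_difference_quotient[OF z]], intro exI allI impI)
    fix n :: nat
    have "l (y + inverse (real (Suc n)) *\<^sub>R sgrad y z) z - l y z
        \<le> G * (inverse (real (Suc n)) * norm (sgrad y z))"
      using lipschitz_onD[OF lipschitz[OF z], of "y + inverse (real (Suc n)) *\<^sub>R sgrad y z" y]
      by (simp add: dist_norm abs_le_iff)
    then show "(l (y + inverse (real (Suc n)) *\<^sub>R sgrad y z) z - l y z) / inverse (real (Suc n))
        \<le> G * norm (sgrad y z)"
      by (simp add: pos_divide_le_eq mult_ac)
  qed
  then have "norm (sgrad y z) * norm (sgrad y z) \<le> G * norm (sgrad y z)"
    by (simp add: dot_square_norm power2_eq_square)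
  then show ?thesis using G_nonneg by (cases "norm (sgrad y z) = 0") auto
qed

lemma loss_measurable_pair [measurable]:
  "(\<lambda>p. l (fst p) (snd p)) \<in> borel_measurable (borel \<Otimes>\<^sub>M \<Xi>)"
  by (rule borel_measurable_lipschitz_pair[OF borel_measurable_integrable[OF loss_integrable] lipschitz])

lemma loss_measurable_compose:
  assumes [measurable]: "f \<in> borel_measurable N" "\<zeta> \<in> measurable N \<Xi>"
  shows "(\<lambda>\<omega>. l (f \<omega>) (\<zeta> \<omega>)) \<in> borel_measurable N"
  using measurable_compose[OF measurable_Pair[OF assms] loss_measurable_pair] by simp

lemma sgrad_measurable_compose:
  assumes f[measurable]: "f \<in> borel_measurable N" and \<zeta>[measurable]: "\<zeta> \<in> measurable N \<Xi>"
  shows "(\<lambda>\<omega>. sgrad (f \<omega>) (\<zeta> \<omega>)) \<in> borel_measurable N"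
proof (rule borel_measurable_vecI)
  fix i
  show "(\<lambda>\<omega>. sgrad (f \<omega>) (\<zeta> \<omega>) $ i) \<in> borel_measurable N"
  proof (rule borel_measurable_LIMSEQ_real)
    fix \<omega> assume "\<omega> \<in> space N"
    then have "\<zeta> \<omega> \<in> space \<Xi>" using \<zeta> by (rule measurable_space[rotated])
    from sgrad_difference_quotient[OF this, of "f \<omega>" "axis i 1"]
    show "(\<lambda>n. (l (f \<omega> + inverse (real (Suc n)) *\<^sub>R axis i 1) (\<zeta> \<omega>) - l (f \<omega>) (\<zeta> \<omega>)) / inverse (real (Suc n)))
       \<longlonglongrightarrow> sgrad (f \<omega>) (\<zeta> \<omega>) $ i" by (simp add: inner_axis)
  next
    fix n
    show "(\<lambda>\<omega>. (l (f \<omega> + inverse (real (Suc n)) *\<^sub>R axis i 1) (\<zeta> \<omega>) - l (f \<omega>) (\<zeta> \<omega>)) / inverse (real (Suc n)))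
       \<in> borel_measurable N"
      by (intro borel_measurable_divide borel_measurable_diff loss_measurable_compose borel_measurable_add) simp_all
  qed
qed

lemma integrable_sgrad: "integrable \<Xi> (sgrad y)"
  by (rule integrable_const_bound[where B = G])
     (use norm_sgrad_le sgrad_measurable_compose[of "\<lambda>_. y" \<Xi> "\<lambda>z. z"] in auto)

lemma integral_sgrad_component: "(\<integral>z. sgrad y z $ i \<partial>\<Xi>) = mgrad y $ i"
proof -
  have "(\<integral>z. sgrad y z $ i \<partial>\<Xi>) = (\<integral>z. sgrad y z \<partial>\<Xi>) $ i"
    by (rule integral_bounded_linear[OF bounded_linear_vec_nth integrable_sgrad])
  then show ?thesis using unbiased[of y] by (simp add: sgrad_def[abs_def])
qed

lemma norm_mgrad_le: "norm (mgrad y) \<le> G"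
proof -
  have "norm (\<integral>z. sgrad y z \<partial>\<Xi>) \<le> (\<integral>z. norm (sgrad y z) \<partial>\<Xi>)" by (rule integral_norm_bound)
  also have "\<dots> \<le> (\<integral>z. G \<partial>\<Xi>)"
    using integrable_sgrad norm_sgrad_le by (intro integral_mono) auto
  finally show ?thesis using unbiased[of y] by (simp add: sgrad_def[abs_def] prob_space)
qed

lemma mgrad_lipschitz: "norm (mgrad y - mgrad y') \<le> L * norm (y - y')"
proof -
  have eq: "mgrad y - mgrad y' = (\<integral>z. sgrad y z - sgrad y' z \<partial>\<Xi>)"
    using unbiased[of y] unbiased[of y'] integrable_sgrad[of y] integrable_sgrad[of y']
    by (simp add: sgrad_def[abs_def])
  have "norm (\<integral>z. sgrad y z - sgrad y' z \<partial>\<Xi>) \<le> (\<integral>z. norm (sgrad y z - sgrad y' z) \<partial>\<Xi>)"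
    by (rule integral_norm_bound)
  also have "\<dots> \<le> (\<integral>z. L * norm (y - y') \<partial>\<Xi>)"
    using integrable_sgrad[of y] integrable_sgrad[of y'] sample_smooth[folded sgrad_def]
    by (intro integral_mono integrable_norm) auto
  finally show ?thesis unfolding eq by (simp add: prob_space)
qed

lemma continuous_mgrad: "continuous_on S mgrad"
  by (rule lipschitz_on_continuous_on[of L])
     (rule lipschitz_onI, use mgrad_lipschitz L_nonneg in \<open>auto simp: dist_norm\<close>)

lemma mgrad_measurable [measurable]: "mgrad \<in> borel_measurable borel"
  by (rule borel_measurable_continuous_onI[OF continuous_mgrad])

lemma sample_remainder:
  assumes z: "z \<in> space \<Xi>"
  shows "\<bar>l (y + h) z - l y z - sgrad y z \<bullet> h\<bar> \<le> L / 2 * (norm h)\<^sup>2"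
  using l_smooth_quadratic_bound[OF sample_diff[OF z] sample_smooth[OF z], of y h] by (simp add: sgrad_def)

text \<open>The centred main part of one summand of the estimate, for a pair of a data point and a direction.\<close>

definition sample_error :: "real ^ 'n \<Rightarrow> 'b \<times> (real ^ 'n) \<Rightarrow> real ^ 'n" where
  "sample_error y p = (sgrad y (fst p) \<bullet> snd p) *\<^sub>R snd p - mgrad y"

text \<open>For a sign vector the squared Euclidean norm is \<open>d\<close>, so the Taylor remainder of each difference
quotient is at most \<open>L * \<nu> * d / 2\<close> after division by \<open>\<nu>\<close>, and each coordinate of the direction has
modulus one.\<close>

lemma zo_grad_est_error:
  fixes w :: "nat \<Rightarrow> real ^ 'n"
  assumes m: "m > 0" and \<nu>: "\<nu> > 0"
    and z: "\<And>j. j \<in> {1..m} \<Longrightarrow> \<zeta> j \<in> space \<Xi>"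
    and w: "\<And>j i. j \<in> {1..m} \<Longrightarrow> w j $ i \<in> {-1, 1}"
  shows "infnorm (zo_grad_est l m \<nu> \<zeta> w y - mgrad y)
    \<le> infnorm (\<Sum>j=1..m. sample_error y (\<zeta> j, w j)) / real m + L * \<nu> * real CARD('n) / 2"
proof -
  define \<rho> where "\<rho> = (\<lambda>j. l (y + \<nu> *\<^sub>R w j) (\<zeta> j) - l y (\<zeta> j) - sgrad y (\<zeta> j) \<bullet> (\<nu> *\<^sub>R w j))"
  have wsq: "(norm (w j))\<^sup>2 = real CARD('n)" if "j \<in> {1..m}" for j
  proof -
    have "(w j $ i)\<^sup>2 = 1" for i using w[OF that, of i] by auto
    then show ?thesis by (simp add: power2_norm_eq_inner inner_vec_def flip: power2_eq_square)
  qed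
  have \<rho>: "\<bar>\<rho> j\<bar> \<le> L / 2 * \<nu>\<^sup>2 * real CARD('n)" if j: "j \<in> {1..m}" for j
    using sample_remainder[OF z[OF j], of y "\<nu> *\<^sub>R w j"] wsq[OF j]
    by (simp add: \<rho>_def power_mult_distrib)
  have "zo_grad_est l m \<nu> \<zeta> w y
      = (1 / (real m * \<nu>)) *\<^sub>R (\<Sum>j=1..m. \<nu> *\<^sub>R ((sgrad y (\<zeta> j) \<bullet> w j) *\<^sub>R w j) + \<rho> j *\<^sub>R w j)"
    unfolding zo_grad_est_def by (intro arg_cong2[where f = "(*\<^sub>R)"] sum.cong) (auto simp: \<rho>_def algebra_simps)
  also have "\<dots> = (1 / real m) *\<^sub>R (\<Sum>j=1..m. (sgrad y (\<zeta> j) \<bullet> w j) *\<^sub>R w j)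
      + (1 / (real m * \<nu>)) *\<^sub>R (\<Sum>j=1..m. \<rho> j *\<^sub>R w j)"
    unfolding sum.distrib scaleR_sum_right[symmetric] scaleR_add_right using \<nu> by simp
  also have "(\<Sum>j=1..m. (sgrad y (\<zeta> j) \<bullet> w j) *\<^sub>R w j)
      = (\<Sum>j=1..m. sample_error y (\<zeta> j, w j)) + real m *\<^sub>R mgrad y"
    by (simp add: sample_error_def sum_subtractf scaleR_conv_of_real sum_constant_scaleR)
  finally have eq: "zo_grad_est l m \<nu> \<zeta> w y - mgrad y
     = (1 / real m) *\<^sub>R (\<Sum>j=1..m. sample_error y (\<zeta> j, w j)) + (1 / (real m * \<nu>)) *\<^sub>R (\<Sum>j=1..m. \<rho> j *\<^sub>R w j)"
    using m by (simp add: scaleR_add_right)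
  have "infnorm (\<Sum>j=1..m. \<rho> j *\<^sub>R w j) \<le> real m * (L / 2 * \<nu>\<^sup>2 * real CARD('n))"
  proof (rule infnorm_leI)
    fix i
    have "\<bar>(\<Sum>j=1..m. \<rho> j *\<^sub>R w j) $ i\<bar> \<le> (\<Sum>j=1..m. \<bar>\<rho> j * w j $ i\<bar>)"
      by (simp add: sum_component)
    also have "\<dots> \<le> (\<Sum>j=1..m. L / 2 * \<nu>\<^sup>2 * real CARD('n))"
    proof (rule sum_mono)
      fix j assume j: "j \<in> {1..m}"
      have "\<bar>w j $ i\<bar> = 1" using w[OF j, of i] by auto
      then show "\<bar>\<rho> j * w j $ i\<bar> \<le> L / 2 * \<nu>\<^sup>2 * real CARD('n)" using \<rho>[OF j] by (simp add: abs_mult)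
    qed
    finally show "\<bar>(\<Sum>j=1..m. \<rho> j *\<^sub>R w j) $ i\<bar> \<le> real m * (L / 2 * \<nu>\<^sup>2 * real CARD('n))" by simp
  qed
  then have "1 / (real m * \<nu>) * infnorm (\<Sum>j=1..m. \<rho> j *\<^sub>R w j)
      \<le> 1 / (real m * \<nu>) * (real m * (L / 2 * \<nu>\<^sup>2 * real CARD('n)))"
    using m \<nu> by (intro mult_left_mono) auto
  also have "\<dots> = L * \<nu> * real CARD('n) / 2" using m \<nu> by (simp add: power2_eq_square)
  finally show ?thesis unfolding eq
    using m \<nu> by (intro order_trans[OF infnorm_triangle]) (simp add: infnorm_mul)
qed

end

text \<open>One data point and one direction. Of the independence of the coordinates of \<open>w\<close>, only their
covariance is kept, because the moments computed below are at most quadratic in \<open>w\<close>.\<close>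

locale rademacher_sample = loss: smooth_stochastic_loss \<Xi> l G L + prob_space M
  for \<Xi> :: "'b measure" and l :: "real ^ 'n \<Rightarrow> 'b \<Rightarrow> real" and G L :: real and M :: "'a measure" +
  fixes \<zeta> :: "'a \<Rightarrow> 'b" and w :: "'a \<Rightarrow> real ^ 'n"
  assumes \<zeta>_meas [measurable]: "\<zeta> \<in> measurable M \<Xi>" and \<zeta>_distr: "distr M \<Xi> \<zeta> = \<Xi>"
    and w_meas [measurable]: "w \<in> borel_measurable M"
    and w_sign: "\<And>\<omega> i. \<omega> \<in> space M \<Longrightarrow> w \<omega> $ i \<in> {-1, 1}"
    and w_cov: "\<And>i k. expectation (\<lambda>\<omega>. w \<omega> $ i * w \<omega> $ k) = (if i = k then 1 else 0)"
    and indep: "indep_pair \<Xi> \<zeta> borel w"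
begin

lemma space_\<zeta>: "\<omega> \<in> space M \<Longrightarrow> \<zeta> \<omega> \<in> space \<Xi>"
  by (rule measurable_space[OF \<zeta>_meas])

lemma abs_w: "\<omega> \<in> space M \<Longrightarrow> \<bar>w \<omega> $ i\<bar> = 1"
  using w_sign[of \<omega> i] by auto

lemma sgrad_component_measurable:
  "(\<lambda>z. loss.sgrad y z $ i) \<in> borel_measurable \<Xi>"
  using loss.sgrad_measurable_compose[of "\<lambda>_. y" \<Xi> "\<lambda>z. z"] by (simp add: borel_measurable_vec_nth)

lemma product_moment:
  fixes f :: "'b \<Rightarrow> real"
  assumes f[measurable]: "f \<in> borel_measurable \<Xi>" and bound: "\<And>z. z \<in> space \<Xi> \<Longrightarrow> \<bar>f z\<bar> \<le> B"
  shows "integrable M (\<lambda>\<omega>. f (\<zeta> \<omega>) * (w \<omega> $ i * w \<omega> $ k))"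
    and "expectation (\<lambda>\<omega>. f (\<zeta> \<omega>) * (w \<omega> $ i * w \<omega> $ k)) = (\<integral>z. f z \<partial>\<Xi>) * (if i = k then 1 else 0)"
proof -
  have ww: "(\<lambda>x :: real ^ 'n. x $ i * x $ k) \<in> borel_measurable borel" by measurable
  have ind: "indep_var borel (\<lambda>\<omega>. f (\<zeta> \<omega>)) borel (\<lambda>\<omega>. w \<omega> $ i * w \<omega> $ k)"
    by (rule indep_pair_imp_indep_var[OF indep_pair_compose[OF indep f ww]])
  have i1: "integrable M (\<lambda>\<omega>. f (\<zeta> \<omega>))"
    by (rule integrable_const_bound[where B = B]) (use bound space_\<zeta> in auto)
  have i2: "integrable M (\<lambda>\<omega>. w \<omega> $ i * w \<omega> $ k)"
    by (rule integrable_const_bound[where B = 1]) (auto simp: abs_mult abs_w)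
  show "integrable M (\<lambda>\<omega>. f (\<zeta> \<omega>) * (w \<omega> $ i * w \<omega> $ k))"
    by (rule indep_var_integrable[OF ind i1 i2])
  have "expectation (\<lambda>\<omega>. f (\<zeta> \<omega>)) = (\<integral>z. f z \<partial>distr M \<Xi> \<zeta>)"
    by (rule integral_distr[symmetric]) measurable
  then show "expectation (\<lambda>\<omega>. f (\<zeta> \<omega>) * (w \<omega> $ i * w \<omega> $ k)) = (\<integral>z. f z \<partial>\<Xi>) * (if i = k then 1 else 0)"
    using indep_var_lebesgue_integral[OF ind i1 i2] w_cov[of i k] by (simp add: \<zeta>_distr)
qed

lemma sample_error_mean_zero:
  shows "integrable M (\<lambda>\<omega>. b \<bullet> loss.sample_error y (\<zeta> \<omega>, w \<omega>))"
    and "expectation (\<lambda>\<omega>. b \<bullet> loss.sample_error y (\<zeta> \<omega>, w \<omega>)) = 0"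
proof -
  have bound: "\<bar>loss.sgrad y z $ k\<bar> \<le> G" if "z \<in> space \<Xi>" for z k
    using component_le_norm_cart[of "loss.sgrad y z" k] loss.norm_sgrad_le[OF that, of y] by linarith
  have eq: "b \<bullet> loss.sample_error y (\<zeta> \<omega>, w \<omega>)
     = (\<Sum>i\<in>UNIV. \<Sum>k\<in>UNIV. b $ i * (loss.sgrad y (\<zeta> \<omega>) $ k * (w \<omega> $ k * w \<omega> $ i))) - b \<bullet> loss.mgrad y" for \<omega>
  proof -
    have "b \<bullet> loss.sample_error y (\<zeta> \<omega>, w \<omega>) = (b \<bullet> w \<omega>) * (loss.sgrad y (\<zeta> \<omega>) \<bullet> w \<omega>) - b \<bullet> loss.mgrad y"
      by (simp add: loss.sample_error_def inner_diff_right)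
    also have "(b \<bullet> w \<omega>) * (loss.sgrad y (\<zeta> \<omega>) \<bullet> w \<omega>)
        = (\<Sum>i\<in>UNIV. \<Sum>k\<in>UNIV. b $ i * (loss.sgrad y (\<zeta> \<omega>) $ k * (w \<omega> $ k * w \<omega> $ i)))"
      unfolding inner_vec_def sum_product by (simp add: mult_ac)
    finally show ?thesis .
  qed
  note pm = product_moment[OF sgrad_component_measurable bound]
  show "integrable M (\<lambda>\<omega>. b \<bullet> loss.sample_error y (\<zeta> \<omega>, w \<omega>))"
    unfolding eq by (intro Bochner_Integration.integrable_diff Bochner_Integration.integrable_sum integrable_mult_right pm) auto
  have "expectation (\<lambda>\<omega>. b \<bullet> loss.sample_error y (\<zeta> \<omega>, w \<omega>))
     = (\<Sum>i\<in>UNIV. \<Sum>k\<in>UNIV. b $ i * (loss.mgrad y $ k * (if k = i then 1 else 0))) - b \<bullet> loss.mgrad y"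
    unfolding eq using pm
    by (subst Bochner_Integration.integral_diff)
       (auto intro!: Bochner_Integration.integrable_sum simp: Bochner_Integration.integral_sum pm loss.integral_sgrad_component prob_space)
  then show "expectation (\<lambda>\<omega>. b \<bullet> loss.sample_error y (\<zeta> \<omega>, w \<omega>)) = 0"
    by (simp add: inner_vec_def if_distrib[of "\<lambda>t. _ * t"] cong: if_cong)
qed

text \<open>The sup norm of \<open>(g \<bullet> w) w\<close> is \<open>\<bar>g \<bullet> w\<bar>\<close>, whose second moment is that of the Euclidean norm of \<open>g\<close>,
independently of the dimension.\<close>

lemma sample_error_second_moment:
  shows "integrable M (\<lambda>\<omega>. (infnorm (loss.sample_error y (\<zeta> \<omega>, w \<omega>)))\<^sup>2)"
    and "expectation (\<lambda>\<omega>. (infnorm (loss.sample_error y (\<zeta> \<omega>, w \<omega>)))\<^sup>2) \<le> 4 * G\<^sup>2"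
proof -
  let ?g = "\<lambda>\<omega>. loss.sgrad y (\<zeta> \<omega>)"
  have bound: "\<bar>loss.sgrad y z $ k\<bar> \<le> G" if "z \<in> space \<Xi>" for z k
    using component_le_norm_cart[of "loss.sgrad y z" k] loss.norm_sgrad_le[OF that, of y] by linarith
  have bound2: "\<bar>loss.sgrad y z $ i * loss.sgrad y z $ k\<bar> \<le> G * G" if "z \<in> space \<Xi>" for z i k
    unfolding abs_mult using bound[OF that] loss.G_nonneg by (intro mult_mono) auto
  note pm = product_moment[OF borel_measurable_times[OF sgrad_component_measurable sgrad_component_measurable] bound2]
  have eq: "(?g \<omega> \<bullet> w \<omega>)\<^sup>2 = (\<Sum>i\<in>UNIV. \<Sum>k\<in>UNIV. (?g \<omega> $ i * ?g \<omega> $ k) * (w \<omega> $ i * w \<omega> $ k))" for \<omega>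
    by (simp add: power2_eq_square inner_vec_def sum_product mult_ac)
  have int: "integrable M (\<lambda>\<omega>. (?g \<omega> \<bullet> w \<omega>)\<^sup>2)"
    unfolding eq by (intro Bochner_Integration.integrable_sum pm) auto
  have "expectation (\<lambda>\<omega>. (?g \<omega> \<bullet> w \<omega>)\<^sup>2)
      = (\<Sum>i\<in>UNIV. \<Sum>k\<in>UNIV. (\<integral>z. loss.sgrad y z $ i * loss.sgrad y z $ k \<partial>\<Xi>) * (if i = k then 1 else 0))"
    unfolding eq using pm by (auto intro!: Bochner_Integration.integrable_sum simp: Bochner_Integration.integral_sum)
  also have "\<dots> = (\<Sum>i\<in>UNIV. (\<integral>z. loss.sgrad y z $ i * loss.sgrad y z $ i \<partial>\<Xi>))"
    by (simp add: if_distrib[of "\<lambda>t. _ * t"] cong: if_cong)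
  also have "\<dots> = (\<integral>z. (\<Sum>i\<in>UNIV. loss.sgrad y z $ i * loss.sgrad y z $ i) \<partial>\<Xi>)"
  proof (rule Bochner_Integration.integral_sum[symmetric])
    fix i
    show "integrable \<Xi> (\<lambda>z. loss.sgrad y z $ i * loss.sgrad y z $ i)"
    proof (rule loss.integrable_const_bound[where B = "G * G"])
      show "AE z in \<Xi>. norm (loss.sgrad y z $ i * loss.sgrad y z $ i) \<le> G * G"
        by (rule AE_I2) (simp only: real_norm_def bound2)
    qed (intro borel_measurable_times sgrad_component_measurable)
  qed
  also have "\<dots> \<le> (\<integral>z. G\<^sup>2 \<partial>\<Xi>)"
  proof (rule integral_mono_AE')
    show "AE z in \<Xi>. (\<Sum>i\<in>UNIV. loss.sgrad y z $ i * loss.sgrad y z $ i) \<le> G\<^sup>2"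
    proof (rule AE_I2)
      fix z assume "z \<in> space \<Xi>"
      then have "(norm (loss.sgrad y z))\<^sup>2 \<le> G\<^sup>2" by (intro power_mono loss.norm_sgrad_le) auto
      then show "(\<Sum>i\<in>UNIV. loss.sgrad y z $ i * loss.sgrad y z $ i) \<le> G\<^sup>2"
        by (simp add: power2_norm_eq_inner inner_vec_def)
    qed
  qed (auto intro!: sum_nonneg)
  finally have second: "expectation (\<lambda>\<omega>. (?g \<omega> \<bullet> w \<omega>)\<^sup>2) \<le> G\<^sup>2" by (simp add: loss.prob_space)
  have le: "(infnorm (loss.sample_error y (\<zeta> \<omega>, w \<omega>)))\<^sup>2
      \<le> 2 * (?g \<omega> \<bullet> w \<omega>)\<^sup>2 + 2 * G\<^sup>2" if \<omega>: "\<omega> \<in> space M" for \<omega>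
  proof -
    have "infnorm (w \<omega>) \<le> 1" by (rule infnorm_leI) (simp add: abs_w[OF \<omega>])
    then have "infnorm ((?g \<omega> \<bullet> w \<omega>) *\<^sub>R w \<omega>) \<le> \<bar>?g \<omega> \<bullet> w \<omega>\<bar>"
      unfolding infnorm_mul using mult_left_mono[of "infnorm (w \<omega>)" 1 "\<bar>?g \<omega> \<bullet> w \<omega>\<bar>"] by simp
    moreover have "infnorm (- loss.mgrad y) \<le> G"
      using infnorm_le_norm[of "loss.mgrad y"] loss.norm_mgrad_le[of y] by (simp add: infnorm_neg)
    ultimately have "infnorm (loss.sample_error y (\<zeta> \<omega>, w \<omega>)) \<le> \<bar>?g \<omega> \<bullet> w \<omega>\<bar> + G"
      using infnorm_triangle[of "(?g \<omega> \<bullet> w \<omega>) *\<^sub>R w \<omega>" "- loss.mgrad y"] by (simp add: loss.sample_error_def)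
    then have "(infnorm (loss.sample_error y (\<zeta> \<omega>, w \<omega>)))\<^sup>2 \<le> (\<bar>?g \<omega> \<bullet> w \<omega>\<bar> + G)\<^sup>2" by (rule power_mono) simp
    also have "\<dots> \<le> 2 * \<bar>?g \<omega> \<bullet> w \<omega>\<bar>\<^sup>2 + 2 * G\<^sup>2"
      using sum_squares_bound[of "\<bar>?g \<omega> \<bullet> w \<omega>\<bar>" G] by (simp add: power2_sum)
    finally show ?thesis by simp
  qed
  have int2: "integrable M (\<lambda>\<omega>. 2 * (?g \<omega> \<bullet> w \<omega>)\<^sup>2 + 2 * G\<^sup>2)" using int by simp
  have meas: "(\<lambda>\<omega>. (infnorm (loss.sample_error y (\<zeta> \<omega>, w \<omega>)))\<^sup>2) \<in> borel_measurable M"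
  proof -
    have "(infnorm :: real ^ 'n \<Rightarrow> real) \<in> borel_measurable borel"
      by (intro borel_measurable_continuous_onI continuous_on_infnorm continuous_on_id)
    moreover have "(\<lambda>\<omega>. loss.sample_error y (\<zeta> \<omega>, w \<omega>)) \<in> borel_measurable M"
      unfolding loss.sample_error_def fst_conv snd_conv
      using loss.sgrad_measurable_compose[OF measurable_const \<zeta>_meas, of y] w_meas
      by (intro borel_measurable_diff borel_measurable_scaleR borel_measurable_inner) auto
    ultimately show ?thesis by (intro borel_measurable_power) (rule measurable_compose)
  qed
  show *: "integrable M (\<lambda>\<omega>. (infnorm (loss.sample_error y (\<zeta> \<omega>, w \<omega>)))\<^sup>2)"
    by (rule Bochner_Integration.integrable_bound[OF int2 meas]) (use le in \<open>auto intro!: AE_I2\<close>)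
  have "expectation (\<lambda>\<omega>. (infnorm (loss.sample_error y (\<zeta> \<omega>, w \<omega>)))\<^sup>2)
      \<le> expectation (\<lambda>\<omega>. 2 * (?g \<omega> \<bullet> w \<omega>)\<^sup>2 + 2 * G\<^sup>2)"
    by (rule integral_mono[OF * int2 le])
  also have "\<dots> = 2 * expectation (\<lambda>\<omega>. (?g \<omega> \<bullet> w \<omega>)\<^sup>2) + 2 * G\<^sup>2" using int by (simp add: prob_space)
  finally show "expectation (\<lambda>\<omega>. (infnorm (loss.sample_error y (\<zeta> \<omega>, w \<omega>)))\<^sup>2)
      \<le> 4 * G\<^sup>2" using second by linarith
qed

text \<open>The linear term of \<open>soft_sup_square_smooth\<close> has mean zero, so adding one sample raises the mean
potential by the quadratic term only.\<close>

lemma potential_step: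
  assumes k: "k \<ge> 1" and \<epsilon>: "\<epsilon> > 0"
  shows "(\<integral>\<^sup>+\<omega>. ennreal (soft_sup_square k \<epsilon> (s + loss.sample_error y (\<zeta> \<omega>, w \<omega>))) \<partial>M)
    \<le> ennreal (soft_sup_square k \<epsilon> s) + ennreal ((2 * k - 1) * real CARD('n) powr (1 / k) * (4 * G\<^sup>2))"
proof -
  let ?c = "(2 * k - 1) * real CARD('n) powr (1 / k)"
  let ?Y = "\<lambda>\<omega>. loss.sample_error y (\<zeta> \<omega>, w \<omega>)"
  have c: "?c \<ge> 0" using k by simp
  obtain b where b: "\<And>h. soft_sup_square k \<epsilon> (s + h) \<le> soft_sup_square k \<epsilon> s + b \<bullet> h + ?c * (infnorm h)\<^sup>2"
    using soft_sup_square_smooth[OF k \<epsilon>, of s] by blast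
  let ?U = "\<lambda>\<omega>. soft_sup_square k \<epsilon> s + b \<bullet> ?Y \<omega> + ?c * (infnorm (?Y \<omega>))\<^sup>2"
  have int: "integrable M ?U" using sample_error_mean_zero(1) sample_error_second_moment(1)
    by (intro Bochner_Integration.integrable_add integrable_mult_right) auto
  have "(\<integral>\<^sup>+\<omega>. ennreal (soft_sup_square k \<epsilon> (s + ?Y \<omega>)) \<partial>M) \<le> (\<integral>\<^sup>+\<omega>. ennreal (?U \<omega>) \<partial>M)"
    by (intro nn_integral_mono ennreal_leI b)
  also have "\<dots> = ennreal (expectation ?U)"
    by (rule nn_integral_eq_integral[OF int]) (use b soft_sup_square_nonneg order_trans in \<open>blast intro!: AE_I2\<close>)
  also have "expectation ?U = soft_sup_square k \<epsilon> s + ?c * expectation (\<lambda>\<omega>. (infnorm (?Y \<omega>))\<^sup>2)"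
    using sample_error_mean_zero[of b y] sample_error_second_moment(1)[of y] by (simp add: prob_space)
  also have "ennreal \<dots> \<le> ennreal (soft_sup_square k \<epsilon> s + ?c * (4 * G\<^sup>2))"
    using sample_error_second_moment(2)[of y] c by (intro ennreal_leI add_left_mono mult_left_mono)
  also have "\<dots> = ennreal (soft_sup_square k \<epsilon> s) + ennreal (?c * (4 * G\<^sup>2))"
    by (intro ennreal_plus soft_sup_square_nonneg mult_nonneg_nonneg[OF c]) simp
  finally show ?thesis .
qed

end

section \<open>The error of the mini-batch estimate\<close>

locale zo_sampling = loss: smooth_stochastic_loss \<Xi> l G L + prob_space M
  for \<Xi> :: "'b measure" and l :: "real ^ 'n \<Rightarrow> 'b \<Rightarrow> real" and G L :: real and M :: "'a measure" +
  fixes T m :: nat and \<xi> :: "nat \<Rightarrow> nat \<Rightarrow> 'a \<Rightarrow> 'b"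
    and u :: "nat \<Rightarrow> nat \<Rightarrow> 'a \<Rightarrow> real ^ 'n" and \<tau> :: "'a \<Rightarrow> nat"
  assumes scheme: "sampling_scheme M \<Xi> T m \<xi> u \<tau>"
begin

text \<open>The sigma-algebras whose joint independence \<open>sampling_scheme\<close> asserts, and their index set.\<close>

definition source_events :: "'n source \<Rightarrow> 'a set set" where
  "source_events k = (case k of
     Data t j \<Rightarrow> sets (vimage_algebra (space M) (\<xi> t j) \<Xi>)
   | Coord t j i \<Rightarrow> sets (vimage_algebra (space M) (\<lambda>\<omega>. u t j \<omega> $ i) (count_space {-1, 1}))
   | Output \<Rightarrow> sets (vimage_algebra (space M) \<tau> (count_space {1..T})))"

definition sources :: "'n source set" where
  "sources = {Data t j | t j. t \<in> {1..T} \<and> j \<in> {1..m}} \<union>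
        {Coord t j i | t j i. t \<in> {1..T} \<and> j \<in> {1..m}} \<union> {Output}"

text \<open>The information carried by a set of sources.\<close>

definition alg :: "'n source set \<Rightarrow> 'a measure" where
  "alg A = sigma (space M) (\<Union>k\<in>A. source_events k)"

lemma indep_sources: "indep_sets source_events sources"
  using scheme unfolding sampling_scheme_def source_events_def[abs_def] sources_def by blast

lemma source_events_subset: "source_events k \<subseteq> Pow (space M)"
  by (auto simp: source_events_def split: source.splits dest!: sets.sets_into_space)

lemma space_alg [simp]: "space (alg A) = space M"
  unfolding alg_def by (rule space_measure_of) (use source_events_subset in auto)

lemma sets_alg: "sets (alg A) = sigma_sets (space M) (\<Union>k\<in>A. source_events k)"
  unfolding alg_def by (rule sets_measure_of) (use source_events_subset in auto)

lemma sets_alg_le: "A \<subseteq> sources \<Longrightarrow> sets (alg A) \<subseteq> sets M"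
  unfolding sets_alg using indep_sources
  by (intro sets.sigma_sets_subset) (auto simp: indep_sets_def)

lemma alg_mono: "A \<subseteq> B \<Longrightarrow> sets (alg A) \<subseteq> sets (alg B)"
  unfolding sets_alg by (intro sigma_sets_mono') auto

lemma measurable_alg_mono:
  assumes "f \<in> measurable (alg A) N" "A \<subseteq> B"
  shows "f \<in> measurable (alg B) N"
  using assms alg_mono[OF assms(2)] by (auto simp: measurable_def)

lemma measurable_alg_imp_measurable:
  assumes "f \<in> measurable (alg A) N" "A \<subseteq> sources"
  shows "f \<in> measurable M N"
  using assms sets_alg_le[OF assms(2)] by (auto simp: measurable_def)

lemma vimage_alg_measurable:
  assumes "k \<in> A" "source_events k = sets (vimage_algebra (space M) f N)" "f \<in> space M \<rightarrow> space N"
  shows "f \<in> measurable (alg A) N"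
proof (rule measurableI)
  fix Y assume "Y \<in> sets N"
  then have "f -` Y \<inter> space M \<in> source_events k" unfolding assms(2) by (rule in_vimage_algebra)
  then show "f -` Y \<inter> space (alg A) \<in> sets (alg A)"
    unfolding sets_alg space_alg using assms(1) by (intro sigma_sets.Basic) auto
qed (use assms(3) in auto)

lemma
  assumes "t \<in> {1..T}" "j \<in> {1..m}"
  shows data_measurable_M: "\<xi> t j \<in> measurable M \<Xi>" and data_distr: "distr M \<Xi> (\<xi> t j) = \<Xi>"
    and coord_measurable_M: "(\<lambda>\<omega>. u t j \<omega> $ i) \<in> measurable M (count_space {-1, 1})"
    and coord_distr: "distr M (count_space {-1, 1}) (\<lambda>\<omega>. u t j \<omega> $ i) = uniform_count_measure {-1, 1}"
  using scheme assms unfolding sampling_scheme_def by auto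

lemma output_measurable_M: "\<tau> \<in> measurable M (count_space {1..T})"
  and output_distr: "distr M (count_space {1..T}) \<tau> = uniform_count_measure {1..T}"
  using scheme unfolding sampling_scheme_def by auto

lemma coord_sign:
  assumes "t \<in> {1..T}" "j \<in> {1..m}" "\<omega> \<in> space M"
  shows "u t j \<omega> $ i \<in> {-1, 1}"
  using measurable_space[OF coord_measurable_M[OF assms(1,2)] assms(3), of i] by simp

lemma data_measurable:
  assumes "t \<in> {1..T}" "j \<in> {1..m}" "Data t j \<in> A"
  shows "\<xi> t j \<in> measurable (alg A) \<Xi>"
  by (rule vimage_alg_measurable[OF assms(3)])
     (use measurable_space[OF data_measurable_M[OF assms(1,2)]] in \<open>auto simp: source_events_def\<close>)

lemma coord_measurable:
  assumes "t \<in> {1..T}" "j \<in> {1..m}" "Coord t j i \<in> A"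
  shows "(\<lambda>\<omega>. u t j \<omega> $ i) \<in> borel_measurable (alg A)"
proof -
  have "(\<lambda>\<omega>. u t j \<omega> $ i) \<in> measurable (alg A) (count_space {-1, 1})"
    by (rule vimage_alg_measurable[OF assms(3)])
       (use coord_sign[OF assms(1,2)] in \<open>auto simp: source_events_def\<close>)
  moreover have "(\<lambda>a. a) \<in> borel_measurable (count_space {-1, 1 :: real})" by simp
  ultimately show ?thesis by (rule measurable_compose)
qed

lemma direction_measurable:
  assumes "t \<in> {1..T}" "j \<in> {1..m}" "range (Coord t j) \<subseteq> A"
  shows "u t j \<in> borel_measurable (alg A)"
  by (rule borel_measurable_vecI, rule coord_measurable[OF assms(1,2)]) (use assms(3) in auto)

lemma output_measurable: "\<tau> \<in> measurable (alg {Output}) (count_space {1..T})"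
  by (rule vimage_alg_measurable[of Output])
     (use measurable_space[OF output_measurable_M] in \<open>auto simp: source_events_def\<close>)

text \<open>Disjoint groups of independent sigma-algebras generate independent sigma-algebras.\<close>

lemma indep_alg:
  assumes X: "X \<in> measurable (alg A) S" and Y: "Y \<in> measurable (alg B) N"
    and AB: "A \<subseteq> sources" "B \<subseteq> sources" "A \<inter> B = {}"
  shows "indep_pair S X N Y"
proof -
  have "indep_sets (\<lambda>b. sigma_sets (space M) (\<Union>k\<in>(case b of True \<Rightarrow> A | False \<Rightarrow> B). source_events k)) UNIV"
  proof (rule indep_sets_collect_sigma)
    show "indep_sets source_events (\<Union>b\<in>UNIV. case b of True \<Rightarrow> A | False \<Rightarrow> B)"
      by (rule indep_sets_mono_index[OF _ indep_sources]) (use AB in \<open>auto split: bool.splits\<close>)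
    show "Int_stable (source_events k)" for k
      by (auto simp: source_events_def Int_stable_def split: source.splits)
    show "disjoint_family_on (case_bool A B) UNIV"
      using AB by (auto simp: disjoint_family_on_def split: bool.splits)
  qed
  moreover have "(\<lambda>b. sigma_sets (space M) (\<Union>k\<in>(case b of True \<Rightarrow> A | False \<Rightarrow> B). source_events k))
      = case_bool (sets (alg A)) (sets (alg B))"
    by (rule ext) (simp add: sets_alg split: bool.split)
  ultimately have ind: "indep_set (sets (alg A)) (sets (alg B))" by (simp add: indep_set_def)
  show ?thesis unfolding indep_pair_def
  proof (intro conjI ballI)
    fix C E assume "C \<in> sets S" "E \<in> sets N"
    then show "prob ((X -` C \<inter> space M) \<inter> (Y -` E \<inter> space M))
        = prob (X -` C \<inter> space M) * prob (Y -` E \<inter> space M)"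
      using measurable_sets[OF X, of C] measurable_sets[OF Y, of E] by (intro indep_setD[OF ind]) auto
  qed (use measurable_alg_imp_measurable X Y AB in auto)
qed

lemma coord_expectation:
  assumes "t \<in> {1..T}" "j \<in> {1..m}"
  shows "expectation (\<lambda>\<omega>. u t j \<omega> $ i) = 0"
proof -
  have "expectation (\<lambda>\<omega>. u t j \<omega> $ i) = (\<integral>a. a \<partial>distr M (count_space {-1, 1}) (\<lambda>\<omega>. u t j \<omega> $ i))"
    by (rule integral_distr[symmetric, OF coord_measurable_M[OF assms]]) simp
  also have "\<dots> = 0" unfolding coord_distr[OF assms] by (subst integral_uniform_count_measure) auto
  finally show ?thesis .
qed

lemma rademacher_sample:
  assumes tj: "t \<in> {1..T}" "j \<in> {1..m}"
  shows "rademacher_sample \<Xi> l G L M (\<xi> t j) (u t j)"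
proof
  let ?C = "range (Coord t j) :: 'n source set"
  have C: "?C \<subseteq> sources" "{Data t j} \<subseteq> sources" using tj by (auto simp: sources_def)
  have u: "u t j \<in> borel_measurable (alg ?C)" by (rule direction_measurable[OF tj]) simp
  show "\<xi> t j \<in> measurable M \<Xi>" "distr M \<Xi> (\<xi> t j) = \<Xi>"
    using tj by (rule data_measurable_M, rule data_distr)
  show "random_variable borel (u t j)" by (rule measurable_alg_imp_measurable[OF u C(1)])
  show "u t j \<omega> $ i \<in> {-1, 1}" if "\<omega> \<in> space M" for \<omega> i by (rule coord_sign[OF tj that])
  show "indep_pair \<Xi> (\<xi> t j) borel (u t j)"
    by (rule indep_alg[OF data_measurable[OF tj, of "{Data t j}"] u C(2,1)]) auto
  fix i k
  show "expectation (\<lambda>\<omega>. u t j \<omega> $ i * u t j \<omega> $ k) = (if i = k then 1 else 0)"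
  proof (cases "i = k")
    case True
    have "expectation (\<lambda>\<omega>. u t j \<omega> $ k * u t j \<omega> $ k) = expectation (\<lambda>\<omega>. 1)"
      using coord_sign[OF tj, of _ k] by (intro Bochner_Integration.integral_cong) fastforce+
    then show ?thesis using True by (simp add: prob_space)
  next
    case False
    have int: "integrable M (\<lambda>\<omega>. u t j \<omega> $ i)" for i
    proof (rule integrable_const_bound[where B = 1])
      show "AE \<omega> in M. norm (u t j \<omega> $ i) \<le> 1"
        by (rule AE_I2) (use coord_sign[OF tj, of _ i] in fastforce)
      show "(\<lambda>\<omega>. u t j \<omega> $ i) \<in> borel_measurable M"
        using measurable_alg_imp_measurable[OF coord_measurable[OF tj, of i ?C] C(1)] by simp
    qed
    have "indep_pair borel (\<lambda>\<omega>. u t j \<omega> $ i) borel (\<lambda>\<omega>. u t j \<omega> $ k)"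
      by (rule indep_alg[OF coord_measurable[OF tj] coord_measurable[OF tj], of i "{Coord t j i}" k "{Coord t j k}"])
         (use False C in auto)
    from indep_var_lebesgue_integral[OF indep_pair_imp_indep_var[OF this] int int]
    show ?thesis using False by (simp add: coord_expectation[OF tj])
  qed
qed

text \<open>What is known after \<open>j\<close> samples of round \<open>t\<close>; at \<open>j = 0\<close> this is the past of the round.\<close>

definition samples_up_to :: "nat \<Rightarrow> nat \<Rightarrow> 'n source set" where
  "samples_up_to t j = {Data s i | s i. s \<in> {1..T} \<and> i \<in> {1..m} \<and> (s < t \<or> s = t \<and> i \<le> j)} \<union>
     {Coord s i k | s i k. s \<in> {1..T} \<and> i \<in> {1..m} \<and> (s < t \<or> s = t \<and> i \<le> j)}"

lemma samples_up_to_subset: "samples_up_to t j \<subseteq> sources - {Output}"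
  by (auto simp: samples_up_to_def sources_def)

lemma samples_up_to_mono: "s < t \<or> s = t \<and> i \<le> j \<Longrightarrow> samples_up_to s i \<subseteq> samples_up_to t j"
  by (auto simp: samples_up_to_def)

lemma sample_error_measurable:
  assumes y: "y \<in> borel_measurable N" and "\<zeta> \<in> measurable N \<Xi>" "w \<in> borel_measurable N"
  shows "(\<lambda>\<omega>. loss.sample_error (y \<omega>) (\<zeta> \<omega>, w \<omega>)) \<in> borel_measurable N"
  unfolding loss.sample_error_def fst_conv snd_conv
  using assms loss.sgrad_measurable_compose[OF assms(1,2)] measurable_compose[OF y loss.mgrad_measurable]
  by (intro borel_measurable_diff borel_measurable_scaleR borel_measurable_inner) auto

definition partial_error :: "nat \<Rightarrow> ('a \<Rightarrow> real ^ 'n) \<Rightarrow> nat \<Rightarrow> 'a \<Rightarrow> real ^ 'n" where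
  "partial_error t y j \<omega> = (\<Sum>i=1..j. loss.sample_error (y \<omega>) (\<xi> t i \<omega>, u t i \<omega>))"

lemma partial_error_measurable:
  assumes t: "t \<in> {1..T}" and y: "y \<in> borel_measurable (alg (samples_up_to t 0))" and j: "j \<le> m"
  shows "partial_error t y j \<in> borel_measurable (alg (samples_up_to t j))"
  unfolding partial_error_def[abs_def]
proof (intro borel_measurable_sum sample_error_measurable)
  fix i assume i: "i \<in> {1..j}"
  then have ti: "i \<in> {1..m}" "Data t i \<in> samples_up_to t j" "range (Coord t i) \<subseteq> samples_up_to t j"
    using j t by (auto simp: samples_up_to_def)
  show "y \<in> borel_measurable (alg (samples_up_to t j))"
      by (rule measurable_alg_mono[OF y samples_up_to_mono]) simp
  show "\<xi> t i \<in> measurable (alg (samples_up_to t j)) \<Xi>" by (rule data_measurable[OF t ti(1,2)])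
  show "u t i \<in> borel_measurable (alg (samples_up_to t j))" by (rule direction_measurable[OF t ti(1,3)])
qed

text \<open>The point \<open>y\<close> and the sum of the first \<open>j\<close> errors depend on the earlier sources only, and sample
\<open>j + 1\<close> is independent of them. Fubini's theorem reduces the induction step to \<open>potential_step\<close> at a
fixed point and a fixed partial sum.\<close>

lemma partial_error_potential:
  assumes t: "t \<in> {1..T}" and y: "y \<in> borel_measurable (alg (samples_up_to t 0))"
    and k: "k \<ge> 1" and \<epsilon>: "\<epsilon> > 0"
  defines "c \<equiv> (2 * k - 1) * real CARD('n) powr (1 / k) * (4 * G\<^sup>2)"
  shows "j \<le> m \<Longrightarrow> (\<integral>\<^sup>+\<omega>. ennreal (soft_sup_square k \<epsilon> (partial_error t y j \<omega>)) \<partial>M)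
     \<le> ennreal (real CARD('n) powr (1 / k) * \<epsilon> + real j * c)"
proof (induction j)
  case 0
  then show ?case
    by (simp add: partial_error_def soft_sup_square_zero[OF k \<epsilon>] emeasure_space_1)
next
  case (Suc j)
  have c: "c \<ge> 0" using k by (simp add: c_def)
  have tj: "Suc j \<in> {1..m}" using Suc.prems by auto
  let ?now = "insert (Data t (Suc j)) (range (Coord t (Suc j))) :: 'n source set"
  interpret S: rademacher_sample \<Xi> l G L M "\<xi> t (Suc j)" "u t (Suc j)"
    by (rule rademacher_sample[OF t tj])
  let ?X = "\<lambda>\<omega>. (y \<omega>, partial_error t y j \<omega>)" and ?Z = "\<lambda>\<omega>. (\<xi> t (Suc j) \<omega>, u t (Suc j) \<omega>)"
  let ?H = "soft_sup_square k \<epsilon> :: real ^ 'n \<Rightarrow> real"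
  define h where "h = (\<lambda>(x, z). ennreal (?H (snd x + loss.sample_error (fst x) (fst z, snd z))))"
  have X: "?X \<in> measurable (alg (samples_up_to t j)) (borel \<Otimes>\<^sub>M borel)"
    using Suc.prems by (intro measurable_Pair partial_error_measurable[OF t y] measurable_alg_mono[OF y samples_up_to_mono]) auto
  have Z: "?Z \<in> measurable (alg ?now) (\<Xi> \<Otimes>\<^sub>M borel)"
    by (intro measurable_Pair data_measurable[OF t tj] direction_measurable[OF t tj]) auto
  have indep: "indep_pair (borel \<Otimes>\<^sub>M borel) ?X (\<Xi> \<Otimes>\<^sub>M borel) ?Z"
  proof (rule indep_alg[OF X Z])
    show "samples_up_to t j \<subseteq> sources" using samples_up_to_subset by blast
    show "?now \<subseteq> sources" using t tj by (auto simp: sources_def)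
    show "samples_up_to t j \<inter> ?now = {}" by (auto simp: samples_up_to_def)
  qed
  have H: "?H \<in> borel_measurable borel"
    by (intro borel_measurable_continuous_onI continuous_soft_sup_square k \<epsilon>)
  have h: "h \<in> borel_measurable ((borel \<Otimes>\<^sub>M borel) \<Otimes>\<^sub>M (\<Xi> \<Otimes>\<^sub>M borel))"
    unfolding h_def case_prod_unfold
    by (intro measurable_compose[OF _ measurable_ennreal] measurable_compose[OF _ H] borel_measurable_add
        sample_error_measurable) measurable
  have "(\<integral>\<^sup>+\<omega>. ennreal (?H (partial_error t y (Suc j) \<omega>)) \<partial>M) = (\<integral>\<^sup>+\<omega>. h (?X \<omega>, ?Z \<omega>) \<partial>M)"
    by (simp add: h_def partial_error_def)
  also have "\<dots> = (\<integral>\<^sup>+\<omega>. (\<integral>\<^sup>+\<omega>'. h (?X \<omega>, ?Z \<omega>') \<partial>M) \<partial>M)"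
    by (rule nn_integral_indep_pair[OF indep h])
  also have "\<dots> \<le> (\<integral>\<^sup>+\<omega>. ennreal (?H (partial_error t y j \<omega>)) + ennreal c \<partial>M)"
    unfolding h_def c_def by (intro nn_integral_mono) (simp add: S.potential_step[OF k \<epsilon>])
  also have "\<dots> = (\<integral>\<^sup>+\<omega>. ennreal (?H (partial_error t y j \<omega>)) \<partial>M) + ennreal c"
  proof (subst nn_integral_add)
    have "partial_error t y j \<in> borel_measurable M"
      using Suc.prems samples_up_to_subset[of t j]
      by (intro measurable_alg_imp_measurable[OF partial_error_measurable[OF t y, of j]]) auto
    then show "(\<lambda>\<omega>. ennreal (?H (partial_error t y j \<omega>))) \<in> borel_measurable M"
      by (intro measurable_compose[OF _ measurable_ennreal] measurable_compose[OF _ H])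
  qed (simp_all add: emeasure_space_1)
  also have "\<dots> \<le> ennreal (real CARD('n) powr (1 / k) * \<epsilon> + real j * c) + ennreal c"
    using Suc by (intro add_right_mono) auto
  also have "\<dots> = ennreal (real CARD('n) powr (1 / k) * \<epsilon> + real (Suc j) * c)"
    using c \<epsilon> by (simp add: algebra_simps flip: ennreal_plus)
  finally show ?case .
qed

text \<open>The parameter \<open>\<epsilon>\<close> of the potential is arbitrary, and its contribution at \<open>j = 0\<close> disappears as it
tends to \<open>0\<close>.\<close>

lemma partial_error_second_moment:
  assumes t: "t \<in> {1..T}" and y: "y \<in> borel_measurable (alg (samples_up_to t 0))" and n: "CARD('n) \<ge> 2"
  shows "(\<integral>\<^sup>+\<omega>. ennreal ((infnorm (partial_error t y m \<omega>))\<^sup>2) \<partial>M)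
     \<le> ennreal (real m * (80 / 9 * dimension_factor (real CARD('n)) * G\<^sup>2))"
proof (rule ennreal_le_epsilon)
  fix e :: real assume e: "e > 0"
  define k where "k = potential_order (real CARD('n))"
  define N where "N = real CARD('n) powr (1 / k)"
  have k: "k \<ge> 1" by (simp add: k_def potential_order_ge_one)
  have N: "N > 0" by (simp add: N_def)
  define \<epsilon> where "\<epsilon> = e / N"
  have \<epsilon>: "\<epsilon> > 0" using e N by (simp add: \<epsilon>_def)
  have "(\<integral>\<^sup>+\<omega>. ennreal ((infnorm (partial_error t y m \<omega>))\<^sup>2) \<partial>M)
      \<le> (\<integral>\<^sup>+\<omega>. ennreal (soft_sup_square k \<epsilon> (partial_error t y m \<omega>)) \<partial>M)"
    by (intro nn_integral_mono ennreal_leI infnorm_square_le_soft_sup_square k \<epsilon>)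
  also have "\<dots> \<le> ennreal (N * \<epsilon> + real m * ((2 * k - 1) * N * (4 * G\<^sup>2)))"
    unfolding N_def by (rule partial_error_potential[OF t y k \<epsilon>]) simp
  also have "\<dots> \<le> ennreal (real m * (80 / 9 * dimension_factor (real CARD('n)) * G\<^sup>2) + e)"
  proof (rule ennreal_leI)
    have "(2 * k - 1) * N * (4 * G\<^sup>2) \<le> 20 / 9 * dimension_factor (real CARD('n)) * (4 * G\<^sup>2)"
      unfolding k_def N_def by (intro mult_right_mono potential_constant_le n) auto
    then have "real m * ((2 * k - 1) * N * (4 * G\<^sup>2))
        \<le> real m * (20 / 9 * dimension_factor (real CARD('n)) * (4 * G\<^sup>2))"
      by (rule mult_left_mono) simp
    moreover have "N * \<epsilon> = e" using N by (simp add: \<epsilon>_def)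
    ultimately show "N * \<epsilon> + real m * ((2 * k - 1) * N * (4 * G\<^sup>2))
        \<le> real m * (80 / 9 * dimension_factor (real CARD('n)) * G\<^sup>2) + e" by simp
  qed
  also have "\<dots> = ennreal (real m * (80 / 9 * dimension_factor (real CARD('n)) * G\<^sup>2)) + ennreal e"
    using dimension_factor_lower[of "real CARD('n)"] n e by (intro ennreal_plus) auto
  finally show "(\<integral>\<^sup>+\<omega>. ennreal ((infnorm (partial_error t y m \<omega>))\<^sup>2) \<partial>M)
      \<le> ennreal (real m * (80 / 9 * dimension_factor (real CARD('n)) * G\<^sup>2)) + ennreal e" .
qed

text \<open>The first summand is the fluctuation, in which the batch size cancels the dimension factor; the
second one comes from the bias, in which \<open>\<nu>\<close> cancels the dimension.\<close>

lemma zo_error_second_moment: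
  assumes t: "t \<in> {1..T}" and y: "y \<in> borel_measurable (alg (samples_up_to t 0))" and n: "CARD('n) \<ge> 2"
    and m: "m > 0" "real m \<ge> 2 * real T * dimension_factor (real CARD('n))"
    and \<nu>: "\<nu> = 1 / (real CARD('n) * sqrt (real T))"
  shows "(\<integral>\<^sup>+\<omega>. ennreal ((infnorm (zo_grad_est l m \<nu> (\<lambda>j. \<xi> t j \<omega>) (\<lambda>j. u t j \<omega>) (y \<omega>) - loss.mgrad (y \<omega>)))\<^sup>2) \<partial>M)
     \<le> ennreal ((80 / 9 * G\<^sup>2 + L\<^sup>2 / 2) / real T)"
proof -
  let ?e = "\<lambda>\<omega>. infnorm (zo_grad_est l m \<nu> (\<lambda>j. \<xi> t j \<omega>) (\<lambda>j. u t j \<omega>) (y \<omega>) - loss.mgrad (y \<omega>))"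
  let ?S = "\<lambda>\<omega>. infnorm (partial_error t y m \<omega>)"
  let ?\<kappa> = "dimension_factor (real CARD('n))"
  have T: "real T > 0" using t by auto
  have \<kappa>: "?\<kappa> > 0" using dimension_factor_lower[of "real CARD('n)"] n by simp
  have \<nu>0: "\<nu> > 0" using T by (simp add: \<nu>)
  have b: "L * \<nu> * real CARD('n) / 2 = L / (2 * sqrt (real T))" by (simp add: \<nu>)
  have le: "(?e \<omega>)\<^sup>2 \<le> 2 / (real m)\<^sup>2 * (?S \<omega>)\<^sup>2 + L\<^sup>2 / (2 * real T)" if \<omega>: "\<omega> \<in> space M" for \<omega>
  proof -
    have "?e \<omega> \<le> ?S \<omega> / real m + L / (2 * sqrt (real T))"
      unfolding partial_error_def b[symmetric]
      by (rule loss.zo_grad_est_error[OF m(1) \<nu>0])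
         (use measurable_space[OF data_measurable_M[OF t] \<omega>] coord_sign[OF t _ \<omega>] in auto)
    then have "(?e \<omega>)\<^sup>2 \<le> (?S \<omega> / real m + L / (2 * sqrt (real T)))\<^sup>2" by (rule power_mono) simp
    also have "\<dots> \<le> 2 * (?S \<omega> / real m)\<^sup>2 + 2 * (L / (2 * sqrt (real T)))\<^sup>2"
      using sum_squares_bound[of "?S \<omega> / real m" "L / (2 * sqrt (real T))"] by (simp add: power2_sum)
    also have "\<dots> = 2 / (real m)\<^sup>2 * (?S \<omega>)\<^sup>2 + L\<^sup>2 / (2 * real T)"
      using T by (simp add: power_divide power_mult_distrib)
    finally show ?thesis .
  qed
  have S_meas: "(\<lambda>\<omega>. ennreal ((?S \<omega>)\<^sup>2)) \<in> borel_measurable M"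
  proof -
    have "partial_error t y m \<in> borel_measurable M"
      using samples_up_to_subset[of t m]
      by (intro measurable_alg_imp_measurable[OF partial_error_measurable[OF t y, of m]]) auto
    moreover have "(\<lambda>x :: real ^ 'n. (infnorm x)\<^sup>2) \<in> borel_measurable borel"
      by (intro borel_measurable_continuous_onI continuous_intros)
    ultimately show ?thesis by (intro measurable_compose[OF _ measurable_ennreal]) (rule measurable_compose)
  qed
  have "(\<integral>\<^sup>+\<omega>. ennreal ((?e \<omega>)\<^sup>2) \<partial>M) \<le> (\<integral>\<^sup>+\<omega>. ennreal (2 / (real m)\<^sup>2) * ennreal ((?S \<omega>)\<^sup>2)
      + ennreal (L\<^sup>2 / (2 * real T)) \<partial>M)"
    using le T by (intro nn_integral_mono) (simp add: ennreal_leI flip: ennreal_mult ennreal_plus)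
  also have "\<dots> = ennreal (2 / (real m)\<^sup>2) * (\<integral>\<^sup>+\<omega>. ennreal ((?S \<omega>)\<^sup>2) \<partial>M) + ennreal (L\<^sup>2 / (2 * real T))"
    using S_meas by (simp add: nn_integral_add nn_integral_cmult emeasure_space_1)
  also have "\<dots> \<le> ennreal (2 / (real m)\<^sup>2) * ennreal (real m * (80 / 9 * ?\<kappa> * G\<^sup>2))
      + ennreal (L\<^sup>2 / (2 * real T))"
    by (intro add_right_mono mult_left_mono partial_error_second_moment[OF t y n]) simp
  also have "\<dots> = ennreal (2 / (real m)\<^sup>2 * (real m * (80 / 9 * ?\<kappa> * G\<^sup>2)) + L\<^sup>2 / (2 * real T))"
    using \<kappa> T by (simp flip: ennreal_mult ennreal_plus)
  also have "\<dots> \<le> ennreal ((80 / 9 * G\<^sup>2 + L\<^sup>2 / 2) / real T)"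
  proof (rule ennreal_leI)
    have "2 * ?\<kappa> / real m \<le> 1 / real T"
      using m T by (simp add: field_simps)
    then have "2 * ?\<kappa> / real m * (80 / 9 * G\<^sup>2) \<le> 1 / real T * (80 / 9 * G\<^sup>2)" by (rule mult_right_mono) simp
    moreover have "2 / (real m)\<^sup>2 * (real m * (80 / 9 * ?\<kappa> * G\<^sup>2)) = 2 * ?\<kappa> / real m * (80 / 9 * G\<^sup>2)"
      using m(1) by (simp add: power2_eq_square)
    ultimately show "2 / (real m)\<^sup>2 * (real m * (80 / 9 * ?\<kappa> * G\<^sup>2)) + L\<^sup>2 / (2 * real T)
        \<le> (80 / 9 * G\<^sup>2 + L\<^sup>2 / 2) / real T"
      by (simp add: add_divide_distrib)
  qed
  finally show ?thesis .
qed

text \<open>The output index is independent of every quantity that is computed from the other sources.\<close>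

lemma expectation_at_output:
  fixes F :: "nat \<Rightarrow> 'a \<Rightarrow> real"
  assumes F: "\<And>t. t \<in> {1..T} \<Longrightarrow> F t \<in> borel_measurable (alg (sources - {Output}))"
  shows "(\<lambda>\<omega>. F (\<tau> \<omega>) \<omega>) \<in> borel_measurable M"
    and "(\<integral>\<^sup>+\<omega>. ennreal (F (\<tau> \<omega>) \<omega>) \<partial>M) = ennreal (1 / real T) * (\<Sum>t=1..T. (\<integral>\<^sup>+\<omega>. ennreal (F t \<omega>) \<partial>M))"
proof -
  have \<tau>: "\<tau> \<omega> \<in> {1..T}" if "\<omega> \<in> space M" for \<omega>
    using measurable_space[OF output_measurable_M that] by simp
  have FM: "F t \<in> borel_measurable M" if "t \<in> {1..T}" for t
    by (rule measurable_alg_imp_measurable[OF F[OF that]]) auto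
  have ind: "{\<omega> \<in> space M. \<tau> \<omega> = t} \<in> sets M" if "t \<in> {1..T}" for t
  proof -
    have "{\<omega> \<in> space M. \<tau> \<omega> = t} = \<tau> -` {t} \<inter> space M" by auto
    then show ?thesis using measurable_sets[OF output_measurable_M, of "{t}"] that by simp
  qed
  have "(\<lambda>\<omega>. \<Sum>t=1..T. F t \<omega> * indicator {\<omega> \<in> space M. \<tau> \<omega> = t} \<omega>) \<in> borel_measurable M"
    using FM ind by (intro borel_measurable_sum borel_measurable_times borel_measurable_indicator) auto
  moreover have "F (\<tau> \<omega>) \<omega> = (\<Sum>t=1..T. F t \<omega> * indicator {\<omega> \<in> space M. \<tau> \<omega> = t} \<omega>)" if "\<omega> \<in> space M" for \<omega>
    using \<tau>[OF that] that by (simp add: indicator_def if_distrib[of "\<lambda>x. _ * x"] cong: if_cong)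
  ultimately show "(\<lambda>\<omega>. F (\<tau> \<omega>) \<omega>) \<in> borel_measurable M"
    by (simp cong: measurable_cong)
  have ind_meas: "(\<lambda>\<omega>. indicator {t} (\<tau> \<omega>) :: ennreal) \<in> borel_measurable M" for t
    by (rule measurable_compose[OF output_measurable_M]) simp
  have one: "(\<integral>\<^sup>+\<omega>. ennreal (F t \<omega>) * indicator {t} (\<tau> \<omega>) \<partial>M)
      = ennreal (1 / real T) * (\<integral>\<^sup>+\<omega>. ennreal (F t \<omega>) \<partial>M)"
    if t: "t \<in> {1..T}" for t
  proof -
    have indep: "indep_pair borel (F t) (count_space {1..T}) \<tau>"
      by (rule indep_alg[OF F[OF t] output_measurable]) (auto simp: sources_def)
    define h :: "real \<times> nat \<Rightarrow> ennreal" where "h = (\<lambda>p. ennreal (fst p) * indicator {t} (snd p))"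
    have h: "h \<in> borel_measurable (borel \<Otimes>\<^sub>M count_space {1..T})"
      unfolding h_def
      by (intro borel_measurable_times_ennreal measurable_compose[OF measurable_fst measurable_ennreal]
          measurable_compose[OF measurable_snd borel_measurable_indicator]) (use t in simp)
    have "(\<integral>\<^sup>+\<omega>. ennreal (F t \<omega>) * indicator {t} (\<tau> \<omega>) \<partial>M) = (\<integral>\<^sup>+\<omega>. (\<integral>\<^sup>+\<omega>'. h (F t \<omega>, \<tau> \<omega>') \<partial>M) \<partial>M)"
      using nn_integral_indep_pair[OF indep h] by (simp add: h_def)
    also have "\<dots> = (\<integral>\<^sup>+\<omega>. ennreal (F t \<omega>) * (\<integral>\<^sup>+\<omega>'. indicator {t} (\<tau> \<omega>') \<partial>M) \<partial>M)"
      unfolding h_def fst_conv snd_conv by (intro nn_integral_cong nn_integral_cmult ind_meas)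
    also have "(\<integral>\<^sup>+\<omega>'. indicator {t} (\<tau> \<omega>') \<partial>M) = (\<integral>\<^sup>+s. indicator {t} s \<partial>distr M (count_space {1..T}) \<tau>)"
      by (rule nn_integral_distr[OF output_measurable_M, symmetric]) simp
    also have "\<dots> = ennreal (1 / real T)"
      unfolding output_distr using t
      by (subst nn_integral_indicator) (auto simp: uniform_count_measure_def emeasure_point_measure_finite)
    also have "(\<integral>\<^sup>+\<omega>. ennreal (F t \<omega>) * ennreal (1 / real T) \<partial>M)
        = ennreal (1 / real T) * (\<integral>\<^sup>+\<omega>. ennreal (F t \<omega>) \<partial>M)"
      using FM[OF t] by (subst nn_integral_multc) (auto simp: mult.commute)
    finally show ?thesis .
  qed
  have "(\<integral>\<^sup>+\<omega>. ennreal (F (\<tau> \<omega>) \<omega>) \<partial>M) = (\<integral>\<^sup>+\<omega>. (\<Sum>t=1..T. ennreal (F t \<omega>) * indicator {t} (\<tau> \<omega>)) \<partial>M)"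
  proof (rule nn_integral_cong)
    fix \<omega> assume "\<omega> \<in> space M"
    then show "ennreal (F (\<tau> \<omega>) \<omega>) = (\<Sum>t=1..T. ennreal (F t \<omega>) * indicator {t} (\<tau> \<omega>))"
      using \<tau> by (simp add: indicator_def if_distrib[of "\<lambda>x. _ * x"] cong: if_cong)
  qed
  also have "\<dots> = (\<Sum>t=1..T. \<integral>\<^sup>+\<omega>. ennreal (F t \<omega>) * indicator {t} (\<tau> \<omega>) \<partial>M)"
  proof (rule nn_integral_sum)
    fix t assume t: "t \<in> {1..T}"
    show "(\<lambda>\<omega>. ennreal (F t \<omega>) * indicator {t} (\<tau> \<omega>)) \<in> borel_measurable M"
      by (intro borel_measurable_times_ennreal measurable_compose[OF FM[OF t] measurable_ennreal] ind_meas)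
  qed
  finally show "(\<integral>\<^sup>+\<omega>. ennreal (F (\<tau> \<omega>) \<omega>) \<partial>M) = ennreal (1 / real T) * (\<Sum>t=1..T. (\<integral>\<^sup>+\<omega>. ennreal (F t \<omega>) \<partial>M))"
    by (simp add: one sum_distrib_left)
qed

end

section \<open>The algorithm as a random process\<close>

lemma prox_map_measurable:
  fixes K :: "(real ^ 'n) set"
  assumes K: "closed K" "convex K" "K \<noteq> {}" and r: "convex_on UNIV r"
    and D: "\<And>y. y \<in> K \<Longrightarrow> l1_norm y \<le> D"
    and x: "x \<in> borel_measurable N" and g: "g \<in> borel_measurable N" and \<eta>: "\<eta> \<in> borel_measurable N"
    and pos: "\<And>\<omega>. \<omega> \<in> space N \<Longrightarrow> \<eta> \<omega> > 0"
  shows "(\<lambda>\<omega>. prox_map K r (x \<omega>) (g \<omega>) (\<eta> \<omega>)) \<in> borel_measurable N"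
proof -
  let ?A = "UNIV \<times> UNIV \<times> {0<..} :: ((real ^ 'n) \<times> (real ^ 'n) \<times> real) set"
  have "(\<lambda>\<omega>. (x \<omega>, g \<omega>, \<eta> \<omega>)) \<in> measurable N (restrict_space borel ?A)"
    using pos by (intro measurable_restrict_space2 borel_measurable_Pair x g \<eta>) auto
  moreover have "(\<lambda>(x, g, \<eta>). prox_map K r x g \<eta>) \<in> borel_measurable (restrict_space borel ?A)"
    by (rule borel_measurable_continuous_on_restrict[OF prox_map_continuous[OF K r D]])
  ultimately have "(\<lambda>\<omega>. case (x \<omega>, g \<omega>, \<eta> \<omega>) of (x, g, \<eta>) \<Rightarrow> prox_map K r x g \<eta>) \<in> borel_measurable N"
    by (rule measurable_compose)
  then show ?thesis by (simp only: prod.case)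
qed

lemma l1_norm_measurable [measurable]: "l1_norm \<in> borel_measurable (borel :: (real ^ 'n) measure)"
  unfolding l1_norm_def[abs_def] by measurable

lemma (in smooth_stochastic_loss) zo_grad_est_measurable:
  assumes y: "y \<in> borel_measurable N"
    and \<zeta>: "\<And>j. j \<in> {1..m} \<Longrightarrow> \<zeta> j \<in> measurable N \<Xi>"
    and w: "\<And>j. j \<in> {1..m} \<Longrightarrow> w j \<in> borel_measurable N"
  shows "(\<lambda>\<omega>. zo_grad_est l m \<nu> (\<lambda>j. \<zeta> j \<omega>) (\<lambda>j. w j \<omega>) (y \<omega>)) \<in> borel_measurable N"
  unfolding zo_grad_est_def
  by (intro borel_measurable_scaleR borel_measurable_const borel_measurable_sum borel_measurable_diff
      loss_measurable_compose borel_measurable_add y \<zeta> w)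

locale zo_adaexpgrad_process = zo_sampling \<Xi> l G L M T m \<xi> u \<tau>
  for \<Xi> :: "'b measure" and l :: "real ^ 'n \<Rightarrow> 'b \<Rightarrow> real" and G L :: real and M :: "'a measure"
    and T m :: nat and \<xi> u \<tau> +
  fixes K :: "(real ^ 'n) set" and r :: "real ^ 'n \<Rightarrow> real" and D R \<nu> :: real and x1 :: "real ^ 'n"
    and x v :: "nat \<Rightarrow> 'a \<Rightarrow> real ^ 'n" and \<alpha> :: "nat \<Rightarrow> 'a \<Rightarrow> real"
  assumes K: "closed K" "convex K" and r: "convex_on UNIV r"
    and D: "\<And>y. y \<in> K \<Longrightarrow> l1_norm y \<le> D"
    and R: "\<And>y. y \<in> K \<Longrightarrow> mean_loss \<Xi> l y + r y \<in> {0..R}"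
    and x1: "x1 \<in> K"
    and run: "\<And>\<omega>. \<omega> \<in> space M \<Longrightarrow>
      zo_adaexpgrad_plus K r l T m \<nu> x1 (\<lambda>t j. \<xi> t j \<omega>) (\<lambda>t j. u t j \<omega>)
        (\<lambda>t. x t \<omega>) (\<lambda>t. v t \<omega>) (\<lambda>t. \<alpha> t \<omega>)"
begin

definition est :: "nat \<Rightarrow> 'a \<Rightarrow> real ^ 'n" where
  "est t \<omega> = zo_grad_est l m \<nu> (\<lambda>j. \<xi> t j \<omega>) (\<lambda>j. u t j \<omega>) (x t \<omega>)"

definition stationarity :: "nat \<Rightarrow> 'a \<Rightarrow> real" where
  "stationarity t \<omega> = (l1_norm (gen_grad K r D (x t \<omega>) (loss.mgrad (x t \<omega>)) (\<alpha> t \<omega>)))\<^sup>2"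

lemma pathwise:
  assumes \<omega>: "\<omega> \<in> space M"
  shows "adaexpgrad_run K r (mean_loss \<Xi> l) L D R T (\<lambda>t. x t \<omega>) (\<lambda>t. v t \<omega>) (\<lambda>t. est t \<omega>) (\<lambda>t. \<alpha> t \<omega>)"
proof
  note path = run[OF \<omega>, unfolded zo_adaexpgrad_plus_def]
  show "x 1 \<omega> \<in> K" using path x1 by blast
  show "\<alpha> t \<omega> = sqrt (max (\<Sum>s=1..<t. (step_lambda (x s \<omega>) (v s \<omega>))\<^sup>2 * (\<alpha> s \<omega>)\<^sup>2 * (l1_norm (v s \<omega> - x s \<omega>))\<^sup>2) 1)"
    if "t \<in> {1..T+1}" for t using path that by blast
  show "v t \<omega> = prox_map K r (x t \<omega>) (est t \<omega>) (\<alpha> t \<omega>)" if "t \<in> {1..T}" for t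
    using path that unfolding est_def by blast
  show "x (t + 1) \<omega> = (1 - \<alpha> t \<omega> / \<alpha> (t + 1) \<omega>) *\<^sub>R x t \<omega> + (\<alpha> t \<omega> / \<alpha> (t + 1) \<omega>) *\<^sub>R v t \<omega>"
    if "t \<in> {1..T}" for t using path that by blast
qed (use K r loss.mean_diff loss.mgrad_lipschitz D R in auto)

text \<open>The iterates and step sizes of round \<open>t + 1\<close> and the prox points of round \<open>t\<close> depend only on the
samples of the first \<open>t\<close> rounds. All earlier values are carried along, because the step size refers
to the whole history.\<close>

lemma adapted:
  "t \<le> T \<Longrightarrow> (\<forall>s\<in>{1..Suc t}. x s \<in> borel_measurable (alg (samples_up_to (Suc t) 0)) \<and>
       \<alpha> s \<in> borel_measurable (alg (samples_up_to (Suc t) 0)))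
     \<and> (\<forall>s\<in>{1..t}. v s \<in> borel_measurable (alg (samples_up_to (Suc t) 0)))"
proof (induction t)
  case 0
  have "x 1 \<in> borel_measurable (alg (samples_up_to (Suc 0) 0))"
    using run unfolding zo_adaexpgrad_plus_def by (subst measurable_cong[where g = "\<lambda>_. x1"]) auto
  moreover have "\<alpha> 1 \<in> borel_measurable (alg (samples_up_to (Suc 0) 0))"
    using adaexpgrad_run.\<alpha>_eq[OF pathwise, of _ 1] by (subst measurable_cong[where g = "\<lambda>_. 1"]) auto
  ultimately show ?case by simp
next
  case (Suc t)
  let ?N = "alg (samples_up_to (Suc (Suc t)) 0)"
  have t: "Suc t \<in> {1..T}" using Suc.prems by auto
  have mono: "f \<in> borel_measurable (alg (samples_up_to (Suc t) 0)) \<Longrightarrow> f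
      \<in> borel_measurable ?N" for f :: "'a \<Rightarrow> 'c::topological_space"
    by (rule measurable_alg_mono[OF _ samples_up_to_mono]) auto
  have x: "x s \<in> borel_measurable ?N" and \<alpha>: "\<alpha> s \<in> borel_measurable ?N" if "s \<in> {1..Suc t}" for s
    using Suc that by (auto intro!: mono)
  have v_old: "v s \<in> borel_measurable ?N" if "s \<in> {1..t}" for s
    using Suc that by (auto intro!: mono)
  have x_t: "x (Suc t) \<in> borel_measurable ?N" and \<alpha>_t: "\<alpha> (Suc t) \<in> borel_measurable ?N"
    using x[of "Suc t"] \<alpha>[of "Suc t"] by auto
  have est: "est (Suc t) \<in> borel_measurable ?N"
    unfolding est_def[abs_def]
    by (intro loss.zo_grad_est_measurable x_t data_measurable[OF t] direction_measurable[OF t])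
       (use t in \<open>auto simp: samples_up_to_def\<close>)
  have v_t: "v (Suc t) \<in> borel_measurable ?N"
  proof (subst measurable_cong[where g = "\<lambda>\<omega>. prox_map K r (x (Suc t) \<omega>) (est (Suc t) \<omega>) (\<alpha> (Suc t) \<omega>)"])
    fix \<omega> assume "\<omega> \<in> space ?N"
    then show "v (Suc t) \<omega> = prox_map K r (x (Suc t) \<omega>) (est (Suc t) \<omega>) (\<alpha> (Suc t) \<omega>)"
      using adaexpgrad_run.v_eq[OF pathwise t] by simp
  next
    have "\<alpha> (Suc t) \<omega> > 0" if "\<omega> \<in> space M" for \<omega>
      using adaexpgrad_run.\<alpha>_ge_1[OF pathwise[OF that], of "Suc t"] t by auto
    then show "(\<lambda>\<omega>. prox_map K r (x (Suc t) \<omega>) (est (Suc t) \<omega>) (\<alpha> (Suc t) \<omega>)) \<in> borel_measurable ?N"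
      using x1 by (intro prox_map_measurable[OF K _ r D x_t est \<alpha>_t]) auto
  qed
  have v: "v s \<in> borel_measurable ?N" if "s \<in> {1..Suc t}" for s
    using that v_old[of s] v_t by (cases "s = Suc t") auto
  have \<alpha>_new: "\<alpha> (Suc (Suc t)) \<in> borel_measurable ?N"
  proof (subst measurable_cong[where g = "\<lambda>\<omega>. sqrt (max (\<Sum>s=1..<Suc (Suc t).
      (step_lambda (x s \<omega>) (v s \<omega>))\<^sup>2 * (\<alpha> s \<omega>)\<^sup>2 * (l1_norm (v s \<omega> - x s \<omega>))\<^sup>2) 1)"])
    fix \<omega> assume "\<omega> \<in> space ?N"
    then show "\<alpha> (Suc (Suc t)) \<omega> = sqrt (max (\<Sum>s=1..<Suc (Suc t).
      (step_lambda (x s \<omega>) (v s \<omega>))\<^sup>2 * (\<alpha> s \<omega>)\<^sup>2 * (l1_norm (v s \<omega> - x s \<omega>))\<^sup>2) 1)"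
      using adaexpgrad_run.\<alpha>_eq[OF pathwise, of \<omega> "Suc (Suc t)"] t by simp
  next
    have "(\<lambda>\<omega>. (step_lambda (x s \<omega>) (v s \<omega>))\<^sup>2 * (\<alpha> s \<omega>)\<^sup>2 * (l1_norm (v s \<omega> - x s \<omega>))\<^sup>2) \<in> borel_measurable ?N"
      if "s \<in> {1..<Suc (Suc t)}" for s
    proof -
      have s: "s \<in> {1..Suc t}" using that by auto
      note [measurable] = x[OF s] v[OF s] \<alpha>[OF s]
      show ?thesis unfolding step_lambda_def by measurable
    qed
    then show "(\<lambda>\<omega>. sqrt (max (\<Sum>s=1..<Suc (Suc t).
      (step_lambda (x s \<omega>) (v s \<omega>))\<^sup>2 * (\<alpha> s \<omega>)\<^sup>2 * (l1_norm (v s \<omega> - x s \<omega>))\<^sup>2) 1)) \<in> borel_measurable ?N"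
      by (intro measurable_compose[OF _ borel_measurable_sqrt] borel_measurable_max
          borel_measurable_sum borel_measurable_const)
  qed
  have x_new: "x (Suc (Suc t)) \<in> borel_measurable ?N"
  proof (subst measurable_cong[where g = "\<lambda>\<omega>. (1 - \<alpha> (Suc t) \<omega> / \<alpha> (Suc (Suc t)) \<omega>) *\<^sub>R x (Suc t) \<omega>
      + (\<alpha> (Suc t) \<omega> / \<alpha> (Suc (Suc t)) \<omega>) *\<^sub>R v (Suc t) \<omega>"])
    fix \<omega> assume "\<omega> \<in> space ?N"
    then show "x (Suc (Suc t)) \<omega> = (1 - \<alpha> (Suc t) \<omega> / \<alpha> (Suc (Suc t)) \<omega>) *\<^sub>R x (Suc t) \<omega>
      + (\<alpha> (Suc t) \<omega> / \<alpha> (Suc (Suc t)) \<omega>) *\<^sub>R v (Suc t) \<omega>"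
      using adaexpgrad_run.x_eq[OF pathwise t, of \<omega>] by simp
  next
    note [measurable] = x_t v_t \<alpha>_t \<alpha>_new
    show "(\<lambda>\<omega>. (1 - \<alpha> (Suc t) \<omega> / \<alpha> (Suc (Suc t)) \<omega>) *\<^sub>R x (Suc t) \<omega>
      + (\<alpha> (Suc t) \<omega> / \<alpha> (Suc (Suc t)) \<omega>) *\<^sub>R v (Suc t) \<omega>) \<in> borel_measurable ?N"
      by measurable
  qed
  have "x s \<in> borel_measurable ?N \<and> \<alpha> s \<in> borel_measurable ?N" if "s \<in> {1..Suc (Suc t)}" for s
    using that x[of s] \<alpha>[of s] x_new \<alpha>_new by (cases "s = Suc (Suc t)") auto
  with v show ?case by blast
qed

lemma iterate_measurable:
  assumes t: "t \<in> {1..T}"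
  shows "x t \<in> borel_measurable (alg (samples_up_to t 0))" "\<alpha> t \<in> borel_measurable (alg (samples_up_to t 0))"
  using adapted[of "t - 1"] t by auto

lemma stationarity_measurable:
  assumes t: "t \<in> {1..T}"
  shows "stationarity t \<in> borel_measurable (alg (sources - {Output}))"
proof -
  let ?N = "alg (sources - {Output})"
  have x[measurable]: "x t \<in> borel_measurable ?N" and \<alpha>[measurable]: "\<alpha> t \<in> borel_measurable ?N"
    using iterate_measurable[OF t] samples_up_to_subset by (auto intro: measurable_alg_mono)
  have g: "(\<lambda>\<omega>. loss.mgrad (x t \<omega>)) \<in> borel_measurable ?N"
    by (rule measurable_compose[OF x loss.mgrad_measurable])
  have "\<alpha> t \<omega> > 0" if "\<omega> \<in> space M" for \<omega>
    using adaexpgrad_run.\<alpha>_ge_1[OF pathwise[OF that], of t] t by auto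
  then have [measurable]: "(\<lambda>\<omega>. prox_map K r (x t \<omega>) (loss.mgrad (x t \<omega>)) (\<alpha> t \<omega>)) \<in> borel_measurable ?N"
    using x1 by (intro prox_map_measurable[OF K _ r D x g \<alpha>]) auto
  show ?thesis unfolding stationarity_def[abs_def] gen_grad_def by measurable
qed

text \<open>The pathwise bound is averaged, with the second moment of the errors inserted. Nonnegative integrals
are used until the end, so integrability comes as a result.\<close>

lemma expected_stationarity_bound:
  assumes n: "CARD('n) \<ge> 2" and T: "T \<ge> 1"
    and m: "m > 0" "real m \<ge> 2 * real T * dimension_factor (real CARD('n))"
    and \<nu>: "\<nu> = 1 / (real CARD('n) * sqrt (real T))"
  defines "B \<equiv> 4 * R + 5 * R\<^sup>2 + 10 * L\<^sup>2 * (D + 1)\<^sup>2 + 7 * (80 / 9 * G\<^sup>2 + L\<^sup>2 / 2)"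
  shows "integrable M (\<lambda>\<omega>. stationarity (\<tau> \<omega>) \<omega>)"
    and "expectation (\<lambda>\<omega>. stationarity (\<tau> \<omega>) \<omega>) \<le> B / real T"
proof -
  define e where "e = (\<lambda>t \<omega>. (infnorm (est t \<omega> - loss.mgrad (x t \<omega>)))\<^sup>2)"
  define A where "A = 4 * R + 5 * R\<^sup>2 + 10 * L\<^sup>2 * (D + 1)\<^sup>2"
  have R0: "R \<ge> 0" using R[OF x1] by auto
  then have A: "A \<ge> 0" by (simp add: A_def)
  have e_meas: "(\<lambda>\<omega>. ennreal (e t \<omega>)) \<in> borel_measurable M" if t: "t \<in> {1..T}" for t
  proof -
    have src: "samples_up_to t 0 \<subseteq> sources" using samples_up_to_subset by blast
    have x: "x t \<in> borel_measurable M"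
      by (rule measurable_alg_imp_measurable[OF iterate_measurable(1)[OF t] src])
    have "est t \<in> borel_measurable M"
      unfolding est_def[abs_def]
      by (intro loss.zo_grad_est_measurable x data_measurable_M[OF t]
          rademacher_sample.w_meas[OF rademacher_sample[OF t]])
    then have "(\<lambda>\<omega>. est t \<omega> - loss.mgrad (x t \<omega>)) \<in> borel_measurable M"
      by (intro borel_measurable_diff measurable_compose[OF x loss.mgrad_measurable])
    moreover have "(\<lambda>y :: real ^ 'n. (infnorm y)\<^sup>2) \<in> borel_measurable borel"
      by (intro borel_measurable_continuous_onI continuous_intros)
    ultimately show ?thesis unfolding e_def
      by (intro measurable_compose[OF _ measurable_ennreal]) (rule measurable_compose)
  qed
  have F_meas: "(\<lambda>\<omega>. ennreal (stationarity t \<omega>)) \<in> borel_measurable M" if "t \<in> {1..T}" for t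
    by (intro measurable_compose[OF _ measurable_ennreal]
        measurable_alg_imp_measurable[OF stationarity_measurable[OF that]]) auto
  have "(\<Sum>t=1..T. (\<integral>\<^sup>+\<omega>. ennreal (stationarity t \<omega>) \<partial>M)) = (\<integral>\<^sup>+\<omega>. (\<Sum>t=1..T. ennreal (stationarity t \<omega>)) \<partial>M)"
    using F_meas by (intro nn_integral_sum[symmetric])
  also have "\<dots> \<le> (\<integral>\<^sup>+\<omega>. ennreal A + ennreal 7 * (\<Sum>t=1..T. ennreal (e t \<omega>)) \<partial>M)"
  proof (rule nn_integral_mono)
    fix \<omega> assume "\<omega> \<in> space M"
    from adaexpgrad_run.sum_gen_grad_square_bound[OF pathwise[OF this]]
    have "(\<Sum>t=1..T. stationarity t \<omega>) \<le> A + 7 * (\<Sum>t=1..T. e t \<omega>)"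
      by (simp add: stationarity_def e_def A_def)
    then have "ennreal (\<Sum>t=1..T. stationarity t \<omega>) \<le> ennreal (A + 7 * (\<Sum>t=1..T. e t \<omega>))" by (rule ennreal_leI)
    also have "\<dots> = ennreal A + ennreal 7 * ennreal (\<Sum>t=1..T. e t \<omega>)"
      using A by (subst ennreal_plus) (auto simp: e_def sum_nonneg ennreal_mult)
    finally show "(\<Sum>t=1..T. ennreal (stationarity t \<omega>)) \<le> ennreal A + ennreal 7 * (\<Sum>t=1..T. ennreal (e t \<omega>))"
      by (simp add: stationarity_def e_def sum_ennreal)
  qed
  also have "\<dots> = ennreal A + ennreal 7 * (\<Sum>t=1..T. \<integral>\<^sup>+\<omega>. ennreal (e t \<omega>) \<partial>M)"
  proof -
    have "(\<lambda>\<omega>. \<Sum>t=1..T. ennreal (e t \<omega>)) \<in> borel_measurable M"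
      by (rule borel_measurable_sum) (rule e_meas)
    moreover have "(\<integral>\<^sup>+\<omega>. (\<Sum>t=1..T. ennreal (e t \<omega>)) \<partial>M) = (\<Sum>t=1..T. \<integral>\<^sup>+\<omega>. ennreal (e t \<omega>) \<partial>M)"
      by (rule nn_integral_sum) (rule e_meas)
    ultimately show ?thesis by (simp add: nn_integral_add nn_integral_cmult emeasure_space_1)
  qed
  also have "\<dots> \<le> ennreal A + ennreal 7 * (\<Sum>t=1..T. ennreal ((80 / 9 * G\<^sup>2 + L\<^sup>2 / 2) / real T))"
    unfolding e_def est_def
    by (intro add_left_mono mult_left_mono sum_mono zo_error_second_moment[OF _ _ n m \<nu>] iterate_measurable) auto
  also have "(\<Sum>t=1..T. ennreal ((80 / 9 * G\<^sup>2 + L\<^sup>2 / 2) / real T))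
      = ennreal (\<Sum>t=1..T. (80 / 9 * G\<^sup>2 + L\<^sup>2 / 2) / real T)"
    by (rule sum_ennreal) simp
  also have "(\<Sum>t=1..T. (80 / 9 * G\<^sup>2 + L\<^sup>2 / 2) / real T) = 80 / 9 * G\<^sup>2 + L\<^sup>2 / 2"
    using T by simp
  also have "ennreal A + ennreal 7 * ennreal (80 / 9 * G\<^sup>2 + L\<^sup>2 / 2) = ennreal B"
  proof -
    have "ennreal a + ennreal 7 * ennreal b = ennreal (a + 7 * b)" if "a \<ge> 0" "b \<ge> 0" for a b
      using that by (simp add: ennreal_plus ennreal_mult)
    from this[OF A, of "80 / 9 * G\<^sup>2 + L\<^sup>2 / 2"] show ?thesis by (simp add: B_def A_def)
  qed
  finally have sum_le: "(\<Sum>t=1..T. (\<integral>\<^sup>+\<omega>. ennreal (stationarity t \<omega>) \<partial>M)) \<le> ennreal B" .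
  have B: "B \<ge> 0" using A by (simp add: B_def A_def)
  have out: "(\<lambda>\<omega>. stationarity (\<tau> \<omega>) \<omega>) \<in> borel_measurable M"
    "(\<integral>\<^sup>+\<omega>. ennreal (stationarity (\<tau> \<omega>) \<omega>) \<partial>M)
      = ennreal (1 / real T) * (\<Sum>t=1..T. (\<integral>\<^sup>+\<omega>. ennreal (stationarity t \<omega>) \<partial>M))"
    by (rule expectation_at_output; fact stationarity_measurable)+
  have "(\<integral>\<^sup>+\<omega>. ennreal (stationarity (\<tau> \<omega>) \<omega>) \<partial>M) \<le> ennreal (1 / real T) * ennreal B"
    unfolding out(2) by (intro mult_left_mono sum_le) simp
  also have "\<dots> = ennreal (B / real T)" using B by (simp flip: ennreal_mult)
  finally have le: "(\<integral>\<^sup>+\<omega>. ennreal (stationarity (\<tau> \<omega>) \<omega>) \<partial>M) \<le> ennreal (B / real T)" .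
  have nn: "stationarity t \<omega> \<ge> 0" for t \<omega> by (simp add: stationarity_def)
  show int: "integrable M (\<lambda>\<omega>. stationarity (\<tau> \<omega>) \<omega>)"
    by (rule integrableI_nonneg[OF out(1)]) (use nn le in \<open>auto intro: le_less_trans\<close>)
  have "ennreal (expectation (\<lambda>\<omega>. stationarity (\<tau> \<omega>) \<omega>)) \<le> ennreal (B / real T)"
    using le nn_integral_eq_integral[OF int] nn by simp
  then show "expectation (\<lambda>\<omega>. stationarity (\<tau> \<omega>) \<omega>) \<le> B / real T"
    using B by (simp add: ennreal_le_iff)
qed

end

section \<open>The convergence rate\<close>

text \<open>A positive batch size excludes dimension one, where \<open>2 ln n - 1\<close> is negative. Let \<open>X\<close> be the real
number that is rounded up to \<open>m\<close>. For \<open>m = X\<close> the square root would be \<open>1 / T\<close>; since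
\<open>X \<ge> 9 / 5\<close>, rounding loses at most a factor \<open>9 / 4\<close> under the root.\<close>

lemma batch_size_facts:
  fixes n T m :: nat
  assumes "n \<ge> 1" "T \<ge> 1" "m > 0" and m: "int m = \<lceil>2 * real T * exp 1 * (2 * ln (real n) - 1)\<rceil>"
  shows "n \<ge> 2" "real m \<ge> 2 * real T * dimension_factor (real n)"
    and "2 / 3 / real T \<le> sqrt (2 * exp 1 * (2 * ln (real n) - 1) / (real m * real T))"
proof -
  define X where "X = 2 * real T * dimension_factor (real n)"
  have m: "int m = \<lceil>X\<rceil>" using m by (simp add: X_def dimension_factor_def mult.assoc)
  have T: "real T \<ge> 1" using assms by simp
  show n: "n \<ge> 2"
  proof (rule ccontr)
    assume "\<not> n \<ge> 2"
    then have "n = 1" using assms by simp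
    then have "X \<le> 0" using T by (simp add: X_def dimension_factor_def)
    then show False using m \<open>m > 0\<close> by linarith
  qed
  have up: "real m \<ge> X" and lo: "real m < X + 1" using m by linarith+
  then show "real m \<ge> 2 * real T * dimension_factor (real n)" by (simp add: X_def)
  have \<kappa>: "dimension_factor (real n) \<ge> 9 / 10" using dimension_factor_lower n by simp
  have "1 * (9 / 10) \<le> real T * dimension_factor (real n)" using T \<kappa> by (intro mult_mono) auto
  then have "X \<ge> 9 / 5" by (simp add: X_def)
  then have "4 * real m \<le> 9 * X" using lo by linarith
  have "(2 / 3 / real T)\<^sup>2 \<le> 2 * dimension_factor (real n) / (real m * real T)"
  proof -
    have "4 / 9 / real T \<le> 2 * dimension_factor (real n) / real m"
      using \<open>4 * real m \<le> 9 * X\<close> assms T by (simp add: field_simps X_def)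
    from divide_right_mono[OF this, of "real T"] T show ?thesis by (simp add: power2_eq_square)
  qed
  then show "2 / 3 / real T \<le> sqrt (2 * exp 1 * (2 * ln (real n) - 1) / (real m * real T))"
    by (intro real_le_rsqrt) (simp add: dimension_factor_def mult.assoc)
qed

lemma bound_constants_le:
  fixes G L \<sigma> D R :: real
  assumes "R \<ge> 0"
  shows "4 * R + 5 * R\<^sup>2 + 10 * L\<^sup>2 * (D + 1)\<^sup>2 + 7 * (80 / 9 * G\<^sup>2 + L\<^sup>2 / 2)
    \<le> 2 / 3 * (10 * (10 * G\<^sup>2 + 8 * \<sigma>\<^sup>2 + 2 * L\<^sup>2) + (8 * R\<^sup>2 + 8 * R + 16 * L\<^sup>2 * (D + 1)\<^sup>2))"
proof -
  have *: "4 * R + 5 * p + 10 * q + 7 * (80 / 9 * a + b / 2)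
      \<le> 2 / 3 * (10 * (10 * a + 8 * c + 2 * b) + (8 * p + 8 * R + 16 * q))"
    if "0 \<le> a" "0 \<le> b" "0 \<le> c" "0 \<le> p" "0 \<le> q" for a b c p q :: real
  proof -
    have "7 * (80 / 9 * a + b / 2) = 560 / 9 * a + 7 / 2 * b"
      "2 / 3 * (10 * (10 * a + 8 * c + 2 * b) + (8 * p + 8 * R + 16 * q))
        = 200 / 3 * a + 160 / 3 * c + 40 / 3 * b + (16 / 3 * p + 16 / 3 * R + 32 / 3 * q)" by simp_all
    with that assms show ?thesis by linarith
  qed
  show ?thesis
    unfolding mult.assoc[of _ "L\<^sup>2" "(D + 1)\<^sup>2"] by (rule *) simp_all
qed

theorem theorem3p4:
  fixes K :: "(real ^ 'n) set"
    and r :: "real ^ 'n \<Rightarrow> real"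
    and l :: "real ^ 'n \<Rightarrow> 'b \<Rightarrow> real"
    and M :: "'a measure" and \<Xi> :: "'b measure"
    and G L \<sigma> D R \<nu> V C :: real
    and T m :: nat
    and x1 :: "real ^ 'n"
    and \<xi> :: "nat \<Rightarrow> nat \<Rightarrow> 'a \<Rightarrow> 'b"
    and u :: "nat \<Rightarrow> nat \<Rightarrow> 'a \<Rightarrow> real ^ 'n"
    and \<tau> :: "'a \<Rightarrow> nat"
    and x v :: "nat \<Rightarrow> 'a \<Rightarrow> real ^ 'n"
    and \<alpha> :: "nat \<Rightarrow> 'a \<Rightarrow> real"
  assumes "prob_space M" and "prob_space \<Xi>"
    and "closed K" and "convex K" and "convex_on UNIV r"
    and loss_integrable: "\<And>y. integrable \<Xi> (l y)"
    and lipschitz: "\<And>z. z \<in> space \<Xi> \<Longrightarrow> G-lipschitz_on UNIV (\<lambda>y. l y z)"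
    and smooth: "\<And>z y. z \<in> space \<Xi> \<Longrightarrow> (\<lambda>y. l y z) differentiable (at y)"
      "\<And>z y y'. z \<in> space \<Xi> \<Longrightarrow>
         norm (grad (\<lambda>y. l y z) y - grad (\<lambda>y. l y z) y') \<le> L * norm (y - y')"
    and unbiased: "\<And>y. mean_loss \<Xi> l differentiable (at y)"
      "\<And>y. (\<integral>z. grad (\<lambda>y. l y z) y \<partial>\<Xi>) = grad (mean_loss \<Xi> l) y"
    and variance: "\<And>y. y \<in> K \<Longrightarrow>
      (\<integral>z. (norm (grad (mean_loss \<Xi> l) y - grad (\<lambda>y. l y z) y))\<^sup>2 \<partial>\<Xi>) \<le> \<sigma>\<^sup>2"
    and "D > 0"
    and prox_bounded:
      "\<And>y g \<eta>. \<eta> > 0 \<Longrightarrow> y \<in> K \<Longrightarrow> l1_norm (prox_map K r y g \<eta>) \<le> D"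
    and "R > 0"
    and objective_bounded: "\<And>y. y \<in> K \<Longrightarrow> mean_loss \<Xi> l y + r y \<in> {0..R}"
    and "T \<ge> 1"
    and "m > 0" and "int m = \<lceil>2 * real T * exp 1 * (2 * ln (real CARD('n)) - 1)\<rceil>"
    and "\<nu> = 1 / (real CARD('n) * sqrt (real T))"
    and "sampling_scheme M \<Xi> T m \<xi> u \<tau>"
    and "x1 \<in> K"
    and run: "\<And>\<omega>. \<omega> \<in> space M \<Longrightarrow>
      zo_adaexpgrad_plus K r l T m \<nu> x1 (\<lambda>t j. \<xi> t j \<omega>) (\<lambda>t j. u t j \<omega>)
        (\<lambda>t. x t \<omega>) (\<lambda>t. v t \<omega>) (\<lambda>t. \<alpha> t \<omega>)"
    and "C = 8 * R\<^sup>2 + 8 * R + 16 * L\<^sup>2 * (D + 1)\<^sup>2"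
    and "V = 10 * G\<^sup>2 + 8 * \<sigma>\<^sup>2 + 2 * L\<^sup>2"
  shows "integrable M (\<lambda>\<omega>. (l1_norm (gen_grad K r D (x (\<tau> \<omega>) \<omega>)
             (grad (mean_loss \<Xi> l) (x (\<tau> \<omega>) \<omega>)) (\<alpha> (\<tau> \<omega>) \<omega>)))\<^sup>2)
    \<and> (\<integral>\<omega>. (l1_norm (gen_grad K r D (x (\<tau> \<omega>) \<omega>)
             (grad (mean_loss \<Xi> l) (x (\<tau> \<omega>) \<omega>)) (\<alpha> (\<tau> \<omega>) \<omega>)))\<^sup>2 \<partial>M)
        \<le> sqrt (2 * exp 1 * (2 * ln (real CARD('n)) - 1) / (real m * real T)) * (10 * V + C)"
proof -
  interpret process: zo_adaexpgrad_process \<Xi> l G L M T m \<xi> u \<tau> K r D R \<nu> x1 x v \<alpha>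
  proof (intro zo_adaexpgrad_process.intro zo_sampling.intro smooth_stochastic_loss.intro
      zo_adaexpgrad_process_axioms.intro zo_sampling_axioms.intro smooth_stochastic_loss_axioms.intro)
    have "K \<noteq> {}" using \<open>x1 \<in> K\<close> by auto
    show "l1_norm y \<le> D" if "y \<in> K" for y
      by (rule prox_bounded_imp_l1_norm_le[OF \<open>closed K\<close> \<open>convex K\<close> \<open>K \<noteq> {}\<close> \<open>convex_on UNIV r\<close> _ prox_bounded that])
         (use \<open>D > 0\<close> in simp_all)
  qed fact+
  have n1: "CARD('n) \<ge> 1" by (simp add: Suc_leI)
  note batch = batch_size_facts[OF n1 \<open>T \<ge> 1\<close> \<open>m > 0\<close> \<open>int m = _\<close>]
  let ?B = "4 * R + 5 * R\<^sup>2 + 10 * L\<^sup>2 * (D + 1)\<^sup>2 + 7 * (80 / 9 * G\<^sup>2 + L\<^sup>2 / 2)"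
  note bound = process.expected_stationarity_bound[OF batch(1) \<open>T \<ge> 1\<close> \<open>m > 0\<close> batch(2) \<open>\<nu> = _\<close>]
  have B: "?B \<le> 2 / 3 * (10 * V + C)"
    unfolding \<open>C = _\<close> \<open>V = _\<close> by (rule bound_constants_le) (use \<open>R > 0\<close> in simp)
  have VC: "10 * V + C \<ge> 0" unfolding \<open>C = _\<close> \<open>V = _\<close> using \<open>R > 0\<close> by simp
  have "?B / real T \<le> 2 / 3 * (10 * V + C) / real T" by (rule divide_right_mono[OF B]) simp
  also have "\<dots> = 2 / 3 / real T * (10 * V + C)" by simp
  also have "\<dots> \<le> sqrt (2 * exp 1 * (2 * ln (real CARD('n)) - 1) / (real m * real T)) * (10 * V + C)"
    by (rule mult_right_mono[OF batch(3) VC])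
  finally show ?thesis using bound unfolding process.stationarity_def by auto
qed

end
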